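(* Let $x > 2$ be a real number and let $h \geq 2$ be an integer. Let $\mathcal{N}_h(x)$ be the set of $h$-full natural numbers $n \leq x$. Then $$\sum_{n \in \mathcal{N}_h(x)} \omega(n) = \gamma_{0,h} x^{1/h} \log \log x + D_1 \gamma_{0,h} x^{1/h} + O_h \left( \frac{x^{1/h}}{\log x} \right),$$ and $$\sum_{n \in \mathcal{N}_h(x)} \omega^2(n) = \gamma_{0,h} x^{1/h} (\log \log x)^2 + (2 D_1 + 1) \gamma_{0,h} x^{1/h} \log \log x + D_2 \gamma_{0,h} x^{1/h} + O_h \left( \frac{x^{1/h} \log \log x}{\log x} \right).$$
   Context: For a natural number $n$, $\omega(n)$ denotes the number of distinct prime factors of $n$. A natural number $n = p_1^{s_1}\cdots p_r^{s_r}$ (distinct primes $p_i$) is $h$-full if $s_i \geq h$ for all $i$ (so $1$ is $h$-full). All sums and products over $p$ run over primes. $\zeta$ is the Riemann zeta function. $B_1 = \gamma + \sum_p \left( \log(1 - 1/p) + 1/p \right)$ is the Mertens constant, $\gamma$ the Euler–Mascheroni constant. Define $\gamma_{0,h} := \prod_p \left( 1 + \frac{p - p^{1/h}}{p^2 (p^{1/h}-1)} \right)$; for real $r > h$, $\mathcal{L}_h(r) := \sum_p \frac{1}{p^{(r/h)-1}(p - p^{1-1/h} + 1)}$; $D_1 := B_1 - \log h + \mathcal{L}_h(h+1) - \mathcal{L}_h(2h)$; $D_2 := D_1^2 + D_1 - \zeta(2) - \sum_p \left( \frac{1}{p - p^{1-1/h}+1}\right)^2$. $O_h$ means the implied constant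 depends only on $h$.
   Formalization: The second formula is proved for x ≥ x_0 for each x_0 > e (constant depending on h and x_0), not for all x > 2, since at x = e its error term vanishes while the difference of the two sides does not (D_2 ≠ 0, e.g. h = 2). *)

theory Defs
  imports "HOL-Analysis.Analysis" "HOL-Computational_Algebra.Primes"
begin

definition omega :: "nat \<Rightarrow> nat" where
  "omega n = card (prime_factors n)"

definition h_full :: "nat \<Rightarrow> nat \<Rightarrow> bool" where
  "h_full h n \<longleftrightarrow> n > 0 \<and> (\<forall>p\<in>prime_factors n. multiplicity p n \<ge> h)"

definition h_full_upto :: "nat \<Rightarrow> real \<Rightarrow> nat set" where
  "h_full_upto h x = {n. h_full h n \<and> real n \<le> x}"

(* The Dirichlet series, hence the Riemann zeta function only for s > 1. *)
definition zeta :: "real \<Rightarrow> real" where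
  "zeta s = (\<Sum>n. 1 / real (Suc n) powr s)"

definition mertens_B1 :: real where
  "mertens_B1 =
     euler_mascheroni + (\<Sum>\<^sub>\<infinity>p\<in>{p::nat. prime p}. ln (1 - 1 / real p) + 1 / real p)"

definition gamma0 :: "nat \<Rightarrow> real" where
  "gamma0 h = (\<Prod>p. if prime p
     then 1 + (real p - real p powr (1 / real h)) /
              ((real p)\<^sup>2 * (real p powr (1 / real h) - 1))
     else 1)"

(* Meant for r > h; the series diverges for r \<le> h. *)
definition L_series :: "nat \<Rightarrow> real \<Rightarrow> real" where
  "L_series h r = (\<Sum>\<^sub>\<infinity>p\<in>{p::nat. prime p}.
     1 / (real p powr (r / real h - 1) * (real p - real p powr (1 - 1 / real h) + 1)))"

definition D1 :: "nat \<Rightarrow> real" where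
  "D1 h = mertens_B1 - ln (real h) + L_series h (real h + 1) - L_series h (2 * real h)"

definition D2 :: "nat \<Rightarrow> real" where
  "D2 h = (D1 h)\<^sup>2 + D1 h - zeta 2
     - (\<Sum>\<^sub>\<infinity>p\<in>{p::nat. prime p}.
          (1 / (real p - real p powr (1 - 1 / real h) + 1))\<^sup>2)"

end

theory Submission
  imports Defs "HOL-Number_Theory.Prime_Powers" "HOL-Real_Asymp.Real_Asymp"
begin

text \<open>
  Every \<open>h\<close>-full number is uniquely \<open>a ^ h * b\<close> with \<open>b\<close> having all its exponents strictly between
  \<open>h\<close> and \<open>2 * h\<close>. The sum of \<open>b powr - s\<close> over such \<open>b\<close> converges for \<open>s > 1 / (h + 1)\<close>, so the number of
  \<open>h\<close>-full \<open>n \<le> y\<close> coprime to a finite set of primes is a constant multiple of \<open>y powr (1 / h)\<close> up to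
  a power saving that is uniform in the primes.

  Counting pairs \<open>(n, p)\<close> and triples \<open>(n, p, q)\<close> by the exact prime powers \<open>u = p ^ k\<close> and \<open>v = q ^ l\<close>
  dividing \<open>n\<close> turns the two moments into sums of \<open>w u\<close> over \<open>u \<le> x\<close> and of \<open>w u * w v\<close> over
  \<open>u * v \<le> x\<close> for a weight \<open>w\<close> on prime powers. By Mertens' first theorem the sum of \<open>w u * ln u\<close> over
  \<open>u \<le> x\<close> is \<open>ln x + O(1)\<close>. That property alone gives \<open>ln (ln x) + D + O(1 / ln x)\<close> for the first sum by
  partial summation, and \<open>(ln (ln x) + D)\<^sup>2 - \<pi>\<^sup>2 / 6\<close> for the second, the constant arising as the value
  of the dilogarithm at 1. Finally \<open>D\<close> is read off from the Mertens constant of the primes.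
\<close>

section \<open>Chebyshev's bound and Mertens' first theorem\<close>

text \<open>Where zeta(2) comes from: summing \<open>w u * W (x / u)\<close> with \<open>W y\<close>
  close to \<open>ln (ln y) + D\<close> requires
  \<open>ln (ln (x / u)) = ln (ln x) + ln (1 - t)\<close>, where \<open>t = ln u / ln x\<close>. In
  the variable \<open>t\<close> the weight behaves like \<open>dt / t\<close>, and the integral of
  \<open>ln (1 - t) / t\<close> over [0, 1] is \<open>- pi^2 / 6\<close>. The rest of
  \<open>D2\<close> is combinatorial: \<open>omega^2 = omega + omega * (omega - 1)\<close> gives
  \<open>D1^2 + D1\<close>, and the series of squares removes the pairs \<open>p = q\<close>, which
  a product of two weights counts but \<open>omega * (omega - 1)\<close> does not.

  The obstacle is the error term. For \<open>u\<close> near \<open>x\<close> the count of cofactors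
  up to \<open>x / u\<close> has no useful saving, so its errors must be summed against the weight
  with a gain of \<open>1 / ln x\<close>. This gain exists because the weight is thin on a
  logarithmic scale near \<open>x\<close>.

  The constant needs its own argument: \<open>D\<close> is a limit of partial sums while
  \<open>mertens_B1\<close> is an Euler product quantity, and an Abelian theorem for Dirichlet
  series at their singular point links the two.\<close>

definition primes_upto :: "nat \<Rightarrow> nat set" where
  "primes_upto n = {p. prime p \<and> p \<le> n}"

lemma finite_primes_upto [simp]: "finite (primes_upto n)"
  by (rule finite_subset[of _ "{..n}"]) (auto simp: primes_upto_def)

section \<open>Chebyshev's upper bound for the primes\<close>

lemma prod_primes_dvd:
  fixes n :: nat
  assumes "finite A" "\<And>p. p \<in> A \<Longrightarrow> prime p" "\<And>p. p \<in> A \<Longrightarrow> p dvd n"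
  shows "\<Prod>A dvd n"
  using assms
proof (induction A rule: finite_induct)
  case (insert p A)
  have "coprime p (\<Prod>A)"
    using insert.hyps insert.prems by (intro prod_coprime_right primes_coprime) auto
  thus ?case using insert by (auto intro: divides_mult)
qed auto

text \<open>Erdos's induction. Even \<open>n > 2\<close> add no prime. For
  \<open>n = 2 * m + 1\<close> the primes above \<open>m + 1\<close> all divide
  \<open>n choose m\<close>, and this coefficient is at most \<open>4 ^ m\<close> because it occurs
  twice in a row with sum \<open>2 * 4 ^ m\<close>. The primes up to \<open>m + 1\<close> are left
  to the induction hypothesis.\<close>

lemma primorial_le: "(\<Prod>p\<in>primes_upto n. p) \<le> 4 ^ n"
proof (induction n rule: less_induct)
  case (less n)
  show ?case
  proof (cases "n \<le> 2")
    case True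
    have "primes_upto 0 = {}" "primes_upto (Suc 0) = {}" "primes_upto 2 = {2}"
      by (auto simp: primes_upto_def dest: prime_ge_2_nat)
    moreover have "n = 0 \<or> n = Suc 0 \<or> n = 2" using True by auto
    ultimately show ?thesis by auto
  next
    case False
    hence n: "n > 2" by simp
    show ?thesis
    proof (cases "even n")
      case True
      have "\<not> prime n" using True n prime_odd_nat[of n] by auto
      hence "primes_upto n = primes_upto (n - 1)"
        using n by (auto simp: primes_upto_def le_less)
      thus ?thesis using less.IH[of "n - 1"] n
        by (metis One_nat_def diff_less dual_order.trans less_nat_zero_code
            linorder_neqE_nat nat_le_linear one_le_numeral power_increasing diff_le_self zero_less_one)
    next
      case False
      then obtain m where m: "n = 2 * m + 1" by (elim oddE)
      have m1: "m \<ge> 1" using n m by simp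
      let ?A = "{p. prime p \<and> m + 1 < p \<and> p \<le> n}"
      have fin: "finite ?A" by (rule finite_subset[of _ "{..n}"]) auto
      have split: "primes_upto n = primes_upto (m + 1) \<union> ?A"
        using m by (auto simp: primes_upto_def)
      have "\<Prod>?A dvd (2 * m + 1 choose m)"
      proof (rule prod_primes_dvd)
        show "finite ?A" by fact
      next
        fix p assume p: "p \<in> ?A"
        have "p dvd fact (2 * m + 1)" using p m prime_dvd_fact_iff[of p "2 * m + 1"] by (simp del: fact_Suc)
        also have "fact (2 * m + 1) = fact m * fact (m + 1) * (2 * m + 1 choose m)"
          using binomial_fact_lemma[of m "2 * m + 1"] by (simp add: algebra_simps)
        finally show "p dvd (2 * m + 1 choose m)"
          using p by (auto simp: prime_dvd_mult_iff prime_dvd_fact_iff simp del: fact_Suc)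
      qed auto
      hence "\<Prod>?A \<le> (2 * m + 1 choose m)"
        by (rule dvd_imp_le) simp
      also have "\<dots> \<le> 4 ^ m"
      proof -
        have "(2 * m + 1 choose m) + (2 * m + 1 choose (m + 1)) = (\<Sum>k\<in>{m, m+1}. 2 * m + 1 choose k)"
          by simp
        also have "\<dots> \<le> (\<Sum>k\<le>2 * m + 1. 2 * m + 1 choose k)"
          by (rule sum_mono2) auto
        also have "\<dots> = 2 * 4 ^ m" unfolding choose_row_sum by (simp add: power_mult)
        finally show ?thesis using binomial_symmetric[of m "2 * m + 1"] by simp
      qed
      finally have A: "\<Prod>?A \<le> 4 ^ m" .
      have "(\<Prod>p\<in>primes_upto n. p) = (\<Prod>p\<in>primes_upto (m + 1). p) * \<Prod>?A"
        unfolding split by (subst prod.union_disjoint) (use fin in \<open>auto simp: primes_upto_def\<close>)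
      also have "\<dots> \<le> 4 ^ (m + 1) * 4 ^ m"
        by (intro mult_mono less.IH A) (use m m1 in auto)
      also have "\<dots> = 4 ^ n" using m by (simp add: power_add mult_2)
      finally show ?thesis .
    qed
  qed
qed

lemma theta_le: "(\<Sum>p\<in>primes_upto n. ln (real p)) \<le> real n * ln 4"
proof -
  have "(\<Sum>p\<in>primes_upto n. ln (real p)) = ln (\<Prod>p\<in>primes_upto n. real p)"
    by (rule ln_prod [symmetric]) (auto simp: primes_upto_def prime_gt_0_nat)
  also have "(\<Prod>p\<in>primes_upto n. real p) = real (\<Prod>p\<in>primes_upto n. p)"
    by simp
  also have "ln \<dots> \<le> ln (4 ^ n)"
  proof (subst ln_le_cancel_iff)
    show "0 < real (\<Prod>p\<in>primes_upto n. p)"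
      by (simp only: of_nat_0_less_iff, rule prod_pos) (auto simp: primes_upto_def prime_gt_0_nat)
    show "real (\<Prod>p\<in>primes_upto n. p) \<le> 4 ^ n"
      using primorial_le[of n] by (metis of_nat_le_iff of_nat_numeral of_nat_power)
  qed auto
  finally show ?thesis by (simp add: ln_realpow)
qed

text \<open>Legendre's formula: expand each \<open>ln m\<close> over the divisors of
  \<open>m\<close> and exchange the sums; \<open>n div d\<close> counts the multiples of
  \<open>d\<close>.\<close>

lemma ln_fact_mangoldt:
  "ln (fact n :: real) = (\<Sum>d\<in>{1..n}. mangoldt d * real (n div d))"
proof -
  have "ln (fact n :: real) = (\<Sum>m\<in>{1..n}. ln (real m))"
    unfolding fact_prod of_nat_prod by (subst ln_prod) auto
  also have "\<dots> = (\<Sum>m\<in>{1..n}. \<Sum>d\<in>{1..n}. if d dvd m then mangoldt d else 0)"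
  proof (rule sum.cong)
    fix m assume m: "m \<in> {1..n}"
    have "ln (real m) = (\<Sum>d | d dvd m. mangoldt d)"
      using mangoldt_sum[of m, where 'a = real] m by simp
    also have "\<dots> = (\<Sum>d\<in>{1..n}. if d dvd m then mangoldt d else 0)"
      using m by (subst sum.inter_filter [symmetric])
        (auto intro!: sum.cong dest: dvd_imp_le intro: Nat.gr0I simp: Suc_le_eq)
    finally show "ln (real m) = (\<Sum>d\<in>{1..n}. if d dvd m then mangoldt d else 0)" .
  qed auto
  also have "\<dots> = (\<Sum>d\<in>{1..n}. \<Sum>m\<in>{1..n}. if d dvd m then mangoldt d else 0)"
    by (rule sum.swap)
  also have "\<dots> = (\<Sum>d\<in>{1..n}. mangoldt d * real (n div d))"
  proof (rule sum.cong)
    fix d assume d: "d \<in> {1..n}"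
    have "bij_betw (\<lambda>k. d * k) {1..n div d} {m\<in>{1..n}. d dvd m}"
      using d by (intro bij_betwI[of _ _ _ "\<lambda>m. m div d"])
        (auto simp: less_eq_div_iff_mult_less_eq mult.commute div_le_mono Suc_le_eq dvd_imp_le elim!: dvdE)
    hence "card {m\<in>{1..n}. d dvd m} = n div d"
      using bij_betw_same_card by fastforce
    thus "(\<Sum>m\<in>{1..n}. if d dvd m then mangoldt d else 0) = (mangoldt d * real (n div d) :: real)"
      by (subst sum.inter_filter [symmetric]) auto
  qed auto
  finally show ?thesis .
qed

lemma ln_fact_ge: "n \<ge> 1 \<Longrightarrow> ln (fact n :: real) \<ge> real n * ln (real n) - real n"
proof (induction n rule: nat_induct_at_least)
  case base
  show ?case by simp
next
  case (Suc n)
  have "ln (1 + 1 / real n) \<le> 1 / real n" by (rule ln_add_one_self_le_self) auto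
  moreover have "1 + 1 / real n = real (Suc n) / real n"
    using Suc.hyps by (simp add: field_simps)
  hence "ln (1 + 1 / real n) = ln (real (Suc n)) - ln (real n)"
    using Suc.hyps by (simp add: ln_div)
  ultimately have "real n * (ln (real (Suc n)) - ln (real n)) \<le> real n * (1 / real n)"
    by (intro mult_left_mono) auto
  hence "real n * (ln (real (Suc n)) - ln (real n)) \<le> 1"
    using Suc.hyps by simp
  moreover have "ln (fact (Suc n) :: real) = ln (real (Suc n)) + ln (fact n)"
    by (simp only: fact_Suc of_nat_mult) (subst ln_mult; simp)
  ultimately show ?case using Suc.IH by (simp add: algebra_simps)
qed

lemma ln_fact_le: "ln (fact n :: real) \<le> real n * ln (real n)"
proof (cases "n = 0")
  case False
  have "ln (fact n :: real) \<le> ln (real n ^ n)"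
    using False fact_le_power[of n, where 'a = real] by (subst ln_le_cancel_iff) auto
  thus ?thesis using False by (simp add: ln_realpow)
qed auto

lemma summable_on_nat_comparison:
  fixes f :: "nat \<Rightarrow> real"
  assumes "summable g" "\<And>n. n \<in> A \<Longrightarrow> \<bar>f n\<bar> \<le> g n" "\<And>n. 0 \<le> g n"
  shows "f summable_on A"
proof -
  have "g summable_on UNIV" using assms by (simp add: summable_on_UNIV_nonneg_real_iff)
  hence "g summable_on A" by (rule summable_on_subset) auto
  hence "(\<lambda>n. norm (f n)) summable_on A"
    by (rule summable_on_comparison_test) (use assms(2,3) in auto)
  thus ?thesis by (rule abs_summable_summable)
qed

lemma summable_ln_over_square: "summable (\<lambda>n. ln (real n) / (real n * (real n - 1)))"
proof (rule summable_comparison_test_ev)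
  have "\<forall>\<^sub>F n in sequentially. \<bar>ln (real n) / (real n * (real n - 1))\<bar> \<le> real n powr (-(3/2))"
    by real_asymp
  thus "\<forall>\<^sub>F n in sequentially. norm (ln (real n) / (real n * (real n - 1))) \<le> real n powr (-(3/2))"
    unfolding real_norm_def .
  show "summable (\<lambda>n. real n powr (-(3/2)))"
    by (subst summable_real_powr_iff) auto
qed

lemma ln_over_square_nonneg: "0 \<le> ln (real n) / (real n * (real n - 1))"
  by (cases "n = 0") auto

lemma sum_inverse_powers_le:
  fixes x :: real
  assumes "x > 1"
  shows "(\<Sum>k\<in>{2..n}. 1 / x ^ k) \<le> 1 / (x * (x - 1))"
proof -
  have "(\<Sum>k\<in>{2..n}. 1 / x ^ k) = 1 / (x * (x - 1)) - 1 / (x ^ n * (x - 1))" if "n \<ge> 1"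
    using that
  proof (induction n rule: nat_induct_at_least)
    case (Suc n)
    have "(\<Sum>k\<in>{2..Suc n}. 1 / x ^ k) = (\<Sum>k\<in>{2..n}. 1 / x ^ k) + 1 / x ^ Suc n"
      using Suc.hyps by simp
    moreover have "1 / (x ^ n * (x - 1)) = 1 / x ^ Suc n + 1 / (x ^ Suc n * (x - 1))"
      using assms by (simp add: field_simps)
    ultimately show ?case using Suc.IH by simp
  qed simp
  moreover have "1 / (x ^ n * (x - 1)) \<ge> 0" "1 / (x * (x - 1)) \<ge> 0" using assms by auto
  ultimately show ?thesis by (cases "n \<ge> 1") auto
qed

text \<open>The factorial identity involves all prime powers, Mertens' theorem only primes. The
  powers with exponent at least 2 of one prime add at most \<open>ln p / (p * (p - 1))\<close>, and
  this is summable even over all integers.\<close>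

lemma sum_mangoldt_nonprime_le:
  "(\<Sum>d | d \<in> {1..n} \<and> \<not> prime d. mangoldt d / real d)
     \<le> (\<Sum>d. ln (real d) / (real d * (real d - 1)))"
proof -
  let ?P = "primes_upto n \<times> {2..n}"
  have "(\<Sum>d | d \<in> {1..n} \<and> \<not> prime d. mangoldt d / real d)
      = (\<Sum>d | d \<in> {1..n} \<and> \<not> prime d \<and> primepow d. mangoldt d / real d)"
    by (rule sum.mono_neutral_right) (auto simp: mangoldt_def)
  also have "\<dots> \<le> (\<Sum>d\<in>(\<lambda>(p, k). p ^ k) ` ?P. mangoldt d / real d)"
  proof (rule sum_mono2)
    show "{d. d \<in> {1..n} \<and> \<not> prime d \<and> primepow d} \<subseteq> (\<lambda>(p, k). p ^ k) ` ?P"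
    proof safe
      fix d :: nat assume d: "d \<in> {1..n}" "\<not> prime d" "primepow d"
      then obtain p k where pk: "prime p" "k > 0" "d = p ^ k" by (auto simp: primepow_def)
      have "k \<noteq> 1" using pk d by auto
      moreover have "p \<le> p ^ k" using pk by (intro dvd_imp_le dvd_power) (auto simp: prime_gt_0_nat)
      moreover have "k < p ^ k" using pk by (intro power_gt_expt) (auto dest: prime_gt_1_nat)
      ultimately show "d \<in> (\<lambda>(p, k). p ^ k) ` ?P" using pk d
        by (intro image_eqI[of _ _ "(p, k)"]) (auto simp: primes_upto_def)
    qed
  qed (auto intro!: divide_nonneg_nonneg mangoldt_nonneg)
  also have "\<dots> \<le> (\<Sum>(p, k)\<in>?P. mangoldt (p ^ k) / real (p ^ k))"
    by (rule order.trans[OF sum_image_le])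
      (auto intro!: divide_nonneg_nonneg mangoldt_nonneg sum_mono simp: o_def case_prod_unfold)
  also have "\<dots> = (\<Sum>p\<in>primes_upto n. \<Sum>k\<in>{2..n}. mangoldt (p ^ k) / real (p ^ k))"
    by (rule sum.cartesian_product [symmetric])
  also have "\<dots> = (\<Sum>p\<in>primes_upto n. ln (real p) * (\<Sum>k\<in>{2..n}. 1 / real p ^ k))"
    by (intro sum.cong refl) (auto simp: sum_distrib_left primes_upto_def)
  also have "\<dots> \<le> (\<Sum>p\<in>primes_upto n. ln (real p) * (1 / (real p * (real p - 1))))"
    by (intro sum_mono mult_left_mono sum_inverse_powers_le)
       (auto simp: primes_upto_def dest: prime_gt_1_nat)
  also have "\<dots> \<le> (\<Sum>d. ln (real d) / (real d * (real d - 1)))"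
    using summable_ln_over_square
    by (simp, intro sum_le_suminf ballI ln_over_square_nonneg) auto
  finally show ?thesis .
qed

text \<open>Both bounds compare \<open>ln (fact n)\<close> with a sum of
  \<open>mangoldt d * (n div d)\<close>. Above: keep only primes and use
  \<open>n div p >= n / p - 1\<close>; the loss is Chebyshev's sum, at most \<open>n * ln 4\<close>.
  Below: drop the floors; the proper prime powers cost \<open>S\<close>, and the 1 comes from
  \<open>ln_fact_ge\<close>.\<close>

theorem Mertens_first:
  obtains K where "\<And>n. n \<ge> 1 \<Longrightarrow>
    \<bar>(\<Sum>p\<in>primes_upto n. ln (real p) / real p) - ln (real n)\<bar> \<le> K"
proof -
  define S where "S = (\<Sum>d. ln (real d) / (real d * (real d - 1)))"
  have S: "S \<ge> 0"
    using sum_mangoldt_nonprime_le[of 0] unfolding S_def by simp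
  show ?thesis
  proof (rule that[of "1 + S + ln 4"])
    fix n :: nat assume n: "n \<ge> 1"
    define T where "T = (\<Sum>p\<in>primes_upto n. ln (real p) / real p)"
    have "real n * T - (\<Sum>p\<in>primes_upto n. ln (real p))
        = (\<Sum>p\<in>primes_upto n. ln (real p) * (real n / real p - 1))"
      unfolding T_def sum_distrib_left sum_subtractf [symmetric]
      by (rule sum.cong) (auto simp: field_simps)
    also have "\<dots> \<le> (\<Sum>p\<in>primes_upto n. mangoldt p * real (n div p))"
    proof (rule sum_mono)
      fix p assume p: "p \<in> primes_upto n"
      have "real p \<ge> 1"
        using p by (auto simp: primes_upto_def dest: prime_ge_1_nat)
      moreover have "real n / real p - 1 \<le> real (n div p)"
        using floor_divide_of_nat_eq[of n p, where 'a = real] by linarith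
      ultimately show "ln (real p) * (real n / real p - 1) \<le> mangoldt p * real (n div p)"
        using p by (auto simp: primes_upto_def intro!: mult_left_mono)
    qed
    also have "\<dots> \<le> (\<Sum>d\<in>{1..n}. mangoldt d * real (n div d))"
      by (rule sum_mono2) (auto simp: primes_upto_def Suc_le_eq prime_gt_0_nat mangoldt_nonneg)
    also have "\<dots> \<le> real n * ln (real n)"
      using ln_fact_mangoldt[of n] ln_fact_le[of n] by simp
    finally have "real n * (T - ln (real n)) \<le> real n * ln 4"
      using theta_le[of n] by (simp add: algebra_simps)
    hence up: "T - ln (real n) \<le> ln 4" using n by simp
    have "real n * ln (real n) - real n \<le> (\<Sum>d\<in>{1..n}. mangoldt d * real (n div d))"
      using ln_fact_mangoldt[of n] ln_fact_ge[of n] n by simp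
    also have "\<dots> \<le> (\<Sum>d\<in>{1..n}. mangoldt d * (real n / real d))"
      by (intro sum_mono mult_left_mono mangoldt_nonneg of_nat_div_le_of_nat)
    also have "\<dots> = real n * (\<Sum>d\<in>{1..n}. mangoldt d / real d)"
      by (simp add: sum_distrib_left mult_ac)
    also have "{1..n} = primes_upto n \<union> {d. d \<in> {1..n} \<and> \<not> prime d}"
      by (auto simp: primes_upto_def Suc_le_eq prime_gt_0_nat)
    also have "(\<Sum>d\<in>\<dots>. mangoldt d / real d) = (\<Sum>p\<in>primes_upto n. mangoldt p / real p)
         + (\<Sum>d | d \<in> {1..n} \<and> \<not> prime d. mangoldt d / real d)"
      by (rule sum.union_disjoint) (auto simp: primes_upto_def)
    also have "(\<Sum>p\<in>primes_upto n. mangoldt p / real p) = T"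
      unfolding T_def by (rule sum.cong) (auto simp: primes_upto_def)
    finally have "real n * (ln (real n) - 1)
        \<le> real n * (T + (\<Sum>d | d \<in> {1..n} \<and> \<not> prime d. mangoldt d / real d))"
      by (simp add: algebra_simps)
    hence "ln (real n) - 1 \<le> T + (\<Sum>d | d \<in> {1..n} \<and> \<not> prime d. mangoldt d / real d)"
      using n by simp
    with sum_mangoldt_nonprime_le[of n] have "ln (real n) - 1 \<le> T + S" unfolding S_def by linarith
    moreover have "ln (4::real) \<ge> 0" by simp
    ultimately show "\<bar>T - ln (real n)\<bar> \<le> 1 + S + ln 4" using up S by linarith
  qed
qed

section \<open>Weights of logarithmic growth\<close>

definition upto_real :: "real \<Rightarrow> nat set" where
  "upto_real x = {n. 0 < n \<and> real n \<le> x}"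

lemma upto_real_eq: "upto_real x = {1..nat \<lfloor>x\<rfloor>}"
  by (auto simp: upto_real_def le_nat_iff le_floor_iff) linarith+

lemma finite_upto_real [simp, intro]: "finite (upto_real x)"
  by (simp add: upto_real_eq)

lemma finite_upto_real_Collect [simp]: "finite {n. 0 < n \<and> real n \<le> x}"
  using finite_upto_real[of x] by (simp add: upto_real_def)

lemma upto_real_of_nat: "upto_real (real n) = {1..n}"
  by (simp add: upto_real_eq)

lemma upto_real_mono: "x \<le> y \<Longrightarrow> upto_real x \<subseteq> upto_real y"
  by (auto simp: upto_real_def)

lemma ln_le_2_ln_floor:
  assumes "x \<ge> 2"
  shows "ln x \<le> 2 * ln (real (nat \<lfloor>x\<rfloor>))"
proof -
  define m where "m = nat \<lfloor>x\<rfloor>"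
  have m: "m \<ge> 2" "x < real m + 1" using assms by (auto simp: m_def le_nat_iff le_floor_iff)
  have "2 * real m \<le> real m * real m" using m(1) by (intro mult_right_mono) auto
  hence "real m + 1 \<le> real m * real m" using m(1) by linarith
  hence "ln x \<le> ln (real m * real m)" using m assms by (subst ln_le_cancel_iff) auto
  also have "\<dots> = 2 * ln (real m)" using m by (simp add: ln_mult)
  finally show ?thesis unfolding m_def .
qed

lemma ln_floor_diff:
  assumes "y \<ge> 1"
  shows "ln y - ln (real (nat \<lfloor>y\<rfloor>)) \<in> {0..1}"
proof -
  define n where "n = nat \<lfloor>y\<rfloor>"
  have n: "n \<ge> 1" "real n \<le> y" "y < real n + 1" using assms 
    by (auto simp: n_def le_nat_iff le_floor_iff)
  have "ln y - ln (real n) = ln (y / real n)" using n by (simp add: ln_div)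
  also have "\<dots> \<le> y / real n - 1" using n by (intro ln_le_minus_one) auto
  also have "\<dots> \<le> 1" using n by (simp add: field_simps)
  finally show ?thesis using n unfolding n_def by simp
qed

text \<open>The asymptotics of the partial sums and of the convolution square use only these three
  facts. The locale is instantiated by \<open>h_weight\<close> for the counting and by
  \<open>prime_weight\<close> for the value of the limit constant.\<close>

locale log_weight =
  fixes w :: "nat \<Rightarrow> real" and K :: real
  assumes nonneg: "w n \<ge> 0"
    and w_le_1: "n \<le> 1 \<Longrightarrow> w n = 0"
    and log_sum: "n \<ge> 1 \<Longrightarrow> \<bar>(\<Sum>k\<in>{1..n}. w k * ln (real k)) - ln (real n)\<bar> \<le> K"
begin

lemma K_nonneg: "K \<ge> 0"
  using log_sum[of 1] by simp

definition W :: "real \<Rightarrow> real" where "W x = (\<Sum>n\<in>upto_real x. w n)"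

lemma W_mono: "x \<le> y \<Longrightarrow> W x \<le> W y"
  unfolding W_def by (rule sum_mono2) (auto simp: upto_real_mono nonneg intro: subsetD[OF upto_real_mono])

lemma W_eq_0: "x < 2 \<Longrightarrow> W x = 0"
  unfolding W_def by (rule sum.neutral) (auto simp: upto_real_def intro!: w_le_1)

text \<open>The sign \<open>s\<close> treats increasing and decreasing \<open>f\<close> at once.\<close>
lemma partial_summation_nat:
  fixes f F :: "real \<Rightarrow> real" and s :: real
  assumes "m \<ge> 1" "m \<le> N" and s: "\<bar>s\<bar> = 1"
    and mono: "mono_on {ln (real m)..ln (real N)} (\<lambda>v. s * f v)"
    and deriv: "\<And>v. v \<in> {ln (real m)..ln (real N)} \<Longrightarrow> (F has_real_derivative f v) (at v)"
  shows "\<bar>(\<Sum>n\<in>{m<..N}. w n * ln (real n) * f (ln (real n))) - (F (ln (real N)) - F (ln (real m)))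
            - ((\<Sum>k\<in>{1..N}. w k * ln (real k)) - ln (real N)) * f (ln (real N))
            + ((\<Sum>k\<in>{1..m}. w k * ln (real k)) - ln (real m)) * f (ln (real m))\<bar>
         \<le> (1 + K) * (s * f (ln (real N)) - s * f (ln (real m)))"
  using \<open>m \<le> N\<close> mono deriv
proof (induction N rule: dec_induct)
  case base
  show ?case by simp
next
  case (step N)
  define l where "l = (\<lambda>n. ln (real n))"
  define e where "e = (\<lambda>n. (\<Sum>k\<in>{1..n}. w k * ln (real k)) - ln (real n))"
  have N: "N \<ge> 1" using step assms by simp
  have lN: "l N < l (Suc N)" "l m \<le> l N" using N assms(1) step.hyps by (auto simp: l_def)
  have sub: "{l m..l N} \<subseteq> {l m..l (Suc N)}" using lN by auto
  define A where "A = (\<Sum>n\<in>{m<..N}. w n * l n * f (l n)) - (F (l N) - F (l m)) - e N * f (l N) + e m * f (l m)"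
  have IH: "\<bar>A\<bar> \<le> (1 + K) * (s * f (l N) - s * f (l m))"
    unfolding A_def e_def l_def
  proof (rule step.IH)
    show "mono_on {ln (real m)..ln (real N)} (\<lambda>v. s * f v)"
      by (rule mono_on_subset[OF step.prems(1)]) (use sub in \<open>simp add: l_def\<close>)
    show "(F has_real_derivative f v) (at v)" if "v \<in> {ln (real m)..ln (real N)}" for v
      by (rule step.prems(2)) (use sub that in \<open>auto simp: l_def\<close>)
  qed
  obtain \<xi> where \<xi>: "l N < \<xi>" "\<xi> < l (Suc N)" "F (l (Suc N)) - F (l N) = (l (Suc N) - l N) * f \<xi>"
    using MVT2[OF lN(1), of F f] step.prems(2) lN unfolding l_def by auto
  have m1: "s * f (l N) \<le> s * f \<xi>" "s * f \<xi> \<le> s * f (l (Suc N))"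
    using \<xi> lN by (auto intro!: mono_onD[OF step.prems(1)] simp: l_def)
  have "w (Suc N) * l (Suc N) = e (Suc N) - e N + (l (Suc N) - l N)"
    unfolding e_def l_def by (simp add: algebra_simps)
  hence step_eq: "w (Suc N) * l (Suc N) * f (l (Suc N)) = (e (Suc N) - e N + (l (Suc N) - l N)) * f (l (Suc N))"
    by simp
  have set: "{m<..Suc N} = insert (Suc N) {m<..N}" using step by auto
  \<comment> \<open>Abel summation for a single step. As the boundary terms belong to the induction
    claim, only differences of values of \<open>f\<close> remain; monotonicity bounds both by the
    increment of \<open>s * f\<close>, which telescopes. The factor 1 bounds
    \<open>l (Suc N) - l N\<close>, the factor \<open>K\<close> bounds \<open>e N\<close>.\<close>
  have "(\<Sum>n\<in>{m<..Suc N}. w n * l n * f (l n)) - (F (l (Suc N)) - F (l m)) - e (Suc N) * f (l (Suc N)) + e m * f (l m)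
      = A + (l (Suc N) - l N) * (f (l (Suc N)) - f \<xi>) - e N * (f (l (Suc N)) - f (l N))"
    using \<xi>(3) unfolding A_def set by (simp add: step_eq) (simp add: algebra_simps)
  moreover have "\<bar>(l (Suc N) - l N) * (f (l (Suc N)) - f \<xi>)\<bar> \<le> 1 * (s * f (l (Suc N)) - s * f (l N))"
  proof -
    have "l (Suc N) - l N \<le> 1"
    proof -
      have "1 + 1 / real N = real (Suc N) / real N" using N by (simp add: field_simps)
      hence "l (Suc N) - l N = ln (1 + 1 / real N)" using N by (simp add: l_def ln_div)
      also have "\<dots> \<le> 1 / real N" by (rule ln_add_one_self_le_self) auto
      also have "\<dots> \<le> 1" using N by simp
      finally show ?thesis .
    qed
    moreover have "\<bar>f (l (Suc N)) - f \<xi>\<bar> = s * f (l (Suc N)) - s * f \<xi>"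
      using m1 s by (auto simp: abs_if split: if_splits)
    ultimately show ?thesis using m1 lN(1) unfolding abs_mult by (intro mult_mono) auto
  qed
  moreover have "\<bar>e N * (f (l (Suc N)) - f (l N))\<bar> \<le> K * (s * f (l (Suc N)) - s * f (l N))"
  proof -
    have "\<bar>f (l (Suc N)) - f (l N)\<bar> = s * f (l (Suc N)) - s * f (l N)"
      using m1 s by (auto simp: abs_if split: if_splits)
    moreover have "\<bar>e N\<bar> \<le> K" unfolding e_def using log_sum[OF N] .
    ultimately show ?thesis using m1 by (simp add: abs_mult mult_right_mono)
  qed
  ultimately have "\<bar>(\<Sum>n\<in>{m<..Suc N}. w n * l n * f (l n)) - (F (l (Suc N)) - F (l m)) - e (Suc N) * f (l (Suc N)) + e m * f (l m)\<bar>
     \<le> (1 + K) * (s * f (l N) - s * f (l m)) + 1 * (s * f (l (Suc N)) - s * f (l N)) + K * (s * f (l (Suc N)) - s * f (l N))"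
    using IH by linarith
  thus ?case by (simp add: e_def l_def algebra_simps)
qed

text \<open>The variation of \<open>f\<close> and the two boundary terms add up to at most
  \<open>(1 + 2 * K) * B\<close>, whichever way \<open>f\<close> is monotone. The remaining
  \<open>B\<close> pays for the passage from the integer part of \<open>y\<close> to
  \<open>y\<close>: the logarithms differ by at most 1, hence \<open>F\<close> by at most
  \<open>B\<close>.\<close>

lemma partial_summation:
  fixes f F :: "real \<Rightarrow> real" and s :: real
  assumes m: "m \<ge> 1" "real m \<le> y" and s: "\<bar>s\<bar> = 1"
    and mono: "mono_on {ln (real m)..ln y} (\<lambda>v. s * f v)"
    and deriv: "\<And>v. v \<in> {ln (real m)..ln y} \<Longrightarrow> (F has_real_derivative f v) (at v)"
    and f: "\<And>v. v \<in> {ln (real m)..ln y} \<Longrightarrow> f v \<in> {0..B}"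
  shows "\<bar>(\<Sum>n | m < n \<and> real n \<le> y. w n * ln (real n) * f (ln (real n))) - (F (ln y) - F (ln (real m)))\<bar>
           \<le> (2 + 2 * K) * B"
proof -
  define N where "N = nat \<lfloor>y\<rfloor>"
  have N: "m \<le> N" "real N \<le> y" using m by (auto simp: N_def le_nat_iff le_floor_iff)
  have set: "{n. m < n \<and> real n \<le> y} = {m<..N}" using m
    by (auto simp: N_def le_nat_iff le_floor_iff)
  define e where "e = (\<lambda>n. (\<Sum>k\<in>{1..n}. w k * ln (real k)) - ln (real n))"
  define S where "S = (\<Sum>n\<in>{m<..N}. w n * ln (real n) * f (ln (real n)))"
  have lN: "ln (real m) \<le> ln (real N)" "ln (real N) \<le> ln y" using N m by auto
  have 1: "\<bar>S - (F (ln (real N)) - F (ln (real m))) - e N * f (ln (real N)) + e m * f (ln (real m))\<bar>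
      \<le> (1 + K) * (s * f (ln (real N)) - s * f (ln (real m)))"
    unfolding S_def e_def
  proof (rule partial_summation_nat)
    show "mono_on {ln (real m)..ln (real N)} (\<lambda>v. s * f v)"
      by (rule mono_on_subset[OF mono]) (use lN in auto)
    show "(F has_real_derivative f v) (at v)" if "v \<in> {ln (real m)..ln (real N)}" for v
      by (rule deriv) (use lN that in auto)
  qed (use m N s in auto)
  have fN: "f (ln (real N)) \<in> {0..B}" and fm: "f (ln (real m)) \<in> {0..B}"
    by (rule f; use lN in simp)+
  have B: "B \<ge> 0" using fm by auto
  have 2: "\<bar>e N * f (ln (real N))\<bar> \<le> K * f (ln (real N))"
    using log_sum[of N] m N fN by (auto simp: abs_mult e_def intro!: mult_mono)
  have 3: "\<bar>e m * f (ln (real m))\<bar> \<le> K * f (ln (real m))"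
    using log_sum[of m] m fm by (auto simp: abs_mult e_def intro!: mult_mono)
  have 4: "\<bar>F (ln y) - F (ln (real N))\<bar> \<le> B"
  proof (cases "ln (real N) < ln y")
    case True
    obtain \<xi> where \<xi>: "ln (real N) < \<xi>" "\<xi> < ln y" "F (ln y) - F (ln (real N)) = (ln y - ln (real N)) * f \<xi>"
      using MVT2[OF True, of F f] deriv lN by auto
    have "ln y - ln (real N) \<in> {0..1}" unfolding N_def using m by (intro ln_floor_diff) auto
    moreover have "f \<xi> \<in> {0..B}" using \<xi> lN by (intro f) auto
    ultimately have "(ln y - ln (real N)) * f \<xi> \<le> 1 * B" "(ln y - ln (real N)) * f \<xi> \<ge> 0"
      using B by (intro mult_mono mult_nonneg_nonneg; simp)+
    thus ?thesis using \<xi> by simp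
  next
    case False
    thus ?thesis using lN B by auto
  qed
  have "\<bar>S - (F (ln y) - F (ln (real m)))\<bar> 
     \<le> (1 + K) * (s * f (ln (real N)) - s * f (ln (real m))) + K * f (ln (real N)) + K * f (ln (real m)) + B"
    using 1 2 3 4 by linarith
  also have "(1 + K) * (s * f (ln (real N)) - s * f (ln (real m))) + K * f (ln (real N)) + K * f (ln (real m)) \<le> (1 + 2 * K) * B"
  proof -
    have "s = 1 \<or> s = -1" using s by linarith
    thus ?thesis
    proof
      assume [simp]: "s = 1"
      have "(1 + 2 * K) * f (ln (real N)) \<le> (1 + 2 * K) * B"
        using K_nonneg fN by (intro mult_left_mono) auto
      thus ?thesis using fm by (simp add: algebra_simps)
    next
      assume [simp]: "s = -1"
      have "(1 + 2 * K) * f (ln (real m)) \<le> (1 + 2 * K) * B"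
        using K_nonneg fm by (intro mult_left_mono) auto
      thus ?thesis using fN by (simp add: algebra_simps)
    qed
  qed
  finally show ?thesis unfolding set S_def by (simp add: algebra_simps)
qed

lemma sum_upto_real_conv:
  "(\<Sum>n\<in>upto_real y. w n * g n) = (\<Sum>n | 1 < n \<and> real n \<le> y. w n * g n)"
proof (rule sum.mono_neutral_right)
  show "\<forall>i\<in>upto_real y - {n. 1 < n \<and> real n \<le> y}. w i * g i = 0"
    by (auto simp: upto_real_def intro!: w_le_1)
  show "{n. 1 < n \<and> real n \<le> y} \<subseteq> upto_real y"
    by (auto simp: upto_real_def)
qed auto

lemma partial_summation_1:
  fixes f F :: "real \<Rightarrow> real"
  assumes "y \<ge> 1"
    and "mono_on {0..ln y} f"
    and "\<And>v. v \<in> {0..ln y} \<Longrightarrow> (F has_real_derivative f v) (at v)"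
    and "\<And>v. v \<in> {0..ln y} \<Longrightarrow> f v \<ge> 0"
  shows "\<bar>(\<Sum>n\<in>upto_real y. w n * ln (real n) * f (ln (real n))) - (F (ln y) - F 0)\<bar>
           \<le> (2 + 2 * K) * f (ln y)"
proof -
  have "\<bar>(\<Sum>n | 1 < n \<and> real n \<le> y. w n * ln (real n) * f (ln (real n))) - (F (ln y) - F (ln (real 1)))\<bar>
           \<le> (2 + 2 * K) * f (ln y)"
  proof (rule partial_summation[where s = 1])
    show "f v \<in> {0..f (ln y)}" if "v \<in> {ln (real 1)..ln y}" for v
      using assms(4)[of v] mono_onD[OF assms(2), of v "ln y"] that by simp
  qed (use assms(1,2,3) in simp_all)
  thus ?thesis
    using sum_upto_real_conv[of "\<lambda>n. ln (real n) * f (ln (real n))" y] by (simp add: mult.assoc)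
qed

lemma log_sum_real:
  assumes "x \<ge> 1"
  shows "\<bar>(\<Sum>n\<in>upto_real x. w n * ln (real n)) - ln x\<bar> \<le> 1 + K"
proof -
  have "nat \<lfloor>x\<rfloor> \<ge> 1" using assms by (auto simp: le_nat_iff le_floor_iff)
  from log_sum[OF this] ln_floor_diff[OF assms] show ?thesis
    unfolding upto_real_eq by auto
qed

text \<open>Partial summation with the decreasing function \<open>1 / v\<close> and its
  antiderivative \<open>ln\<close>. It cancels the factor \<open>ln n\<close> of
  \<open>log_sum\<close>, and \<open>m >= 2\<close> keeps it bounded by
  \<open>1 / ln m\<close>.\<close>

lemma W_diff:
  assumes "m \<ge> 2" "real m \<le> y"
  shows "\<bar>(W y - ln (ln y)) - (W (real m) - ln (ln (real m)))\<bar> \<le> (2 + 2 * K) / ln (real m)"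
proof -
  have lm: "ln (real m) > 0" using assms by simp
  have "\<bar>(\<Sum>n | m < n \<and> real n \<le> y. w n * ln (real n) * inverse (ln (real n))) 
          - (ln (ln y) - ln (ln (real m)))\<bar> \<le> (2 + 2 * K) * inverse (ln (real m))"
  proof (rule partial_summation[where s = "-1"])
    show "mono_on {ln (real m)..ln y} (\<lambda>v. - 1 * inverse v)"
      using lm by (auto intro!: mono_onI le_imp_inverse_le)
    fix v assume v: "v \<in> {ln (real m)..ln y}"
    show "(ln has_real_derivative inverse v) (at v)"
      using v lm by (intro DERIV_ln) auto
    show "inverse v \<in> {0..inverse (ln (real m))}"
      using v lm by (auto intro!: le_imp_inverse_le)
  qed (use assms in auto)
  also have "(\<Sum>n | m < n \<and> real n \<le> y. w n * ln (real n) * inverse (ln (real n)))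
      = (\<Sum>n | m < n \<and> real n \<le> y. w n)"
    by (rule sum.cong) (use assms in auto)
  also have "\<dots> = W y - W (real m)"
  proof -
    have "upto_real y = upto_real (real m) \<union> {n. m < n \<and> real n \<le> y}"
      using assms by (auto simp: upto_real_def)
    moreover have "finite {n. m < n \<and> real n \<le> y}"
      by (rule finite_subset[OF _ finite_upto_real[of y]]) (auto simp: upto_real_def)
    ultimately have "W y = W (real m) + (\<Sum>n | m < n \<and> real n \<le> y. w n)"
      unfolding W_def by (simp add: sum.union_disjoint upto_real_def disjoint_iff)
    thus ?thesis by simp
  qed
  finally show ?thesis by (simp add: algebra_simps divide_inverse)
qed

definition D :: real where "D = lim (\<lambda>n. W (real n) - ln (ln (real n)))"

lemma W_tendsto: "(\<lambda>n. W (real n) - ln (ln (real n))) \<longlonglongrightarrow> D"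
proof -
  have "Cauchy (\<lambda>n. W (real n) - ln (ln (real n)))"
  proof (rule CauchyI')
    fix e :: real assume e: "e > 0"
    have "(\<lambda>m. (2 + 2 * K) / ln (real m)) \<longlonglongrightarrow> 0" by real_asymp
    hence "\<forall>\<^sub>F m in sequentially. (2 + 2 * K) / ln (real m) < e"
      using e by (rule order_tendstoD)
    hence "\<forall>\<^sub>F m in sequentially. (2 + 2 * K) / ln (real m) < e \<and> m \<ge> 2"
      using eventually_ge_at_top[of 2] by eventually_elim auto
    then obtain M where M: "\<And>m. m \<ge> M \<Longrightarrow> (2 + 2 * K) / ln (real m) < e \<and> m \<ge> 2"
      by (auto simp: eventually_at_top_linorder)
    show "\<exists>M. \<forall>m\<ge>M. \<forall>n>m. dist (W (real m) - ln (ln (real m))) (W (real n) - ln (ln (real n))) < e"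
    proof (intro exI allI impI)
      fix m n assume "m \<ge> M" "n > m"
      thus "dist (W (real m) - ln (ln (real m))) (W (real n) - ln (ln (real n))) < e"
        using M[of m] W_diff[of m "real n"] by (simp add: dist_real_def abs_minus_commute)
    qed
  qed
  thus ?thesis unfolding D_def by (simp add: Cauchy_convergent_iff convergent_LIMSEQ_iff)
qed

text \<open>\<open>D\<close> is a limit along integers, so \<open>x\<close> is compared with its
  integer part \<open>m\<close>, and \<open>m\<close> with infinity, at a cost of
  \<open>(2 + 2 * K) / ln m\<close> each; \<open>ln x <= 2 * ln m\<close> doubles the sum of the
  two.\<close>

lemma W_asymp:
  assumes "x \<ge> 2"
  shows "\<bar>W x - ln (ln x) - D\<bar> \<le> (8 + 8 * K) / ln x"
proof -
  define m where "m = nat \<lfloor>x\<rfloor>"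
  have m: "m \<ge> 2" "real m \<le> x" using assms by (auto simp: m_def le_nat_iff le_floor_iff)
  have "\<bar>D - (W (real m) - ln (ln (real m)))\<bar> \<le> (2 + 2 * K) / ln (real m)"
  proof (rule tendsto_upperbound)
    show "(\<lambda>n. \<bar>(W (real n) - ln (ln (real n))) - (W (real m) - ln (ln (real m)))\<bar>) \<longlonglongrightarrow>
        \<bar>D - (W (real m) - ln (ln (real m)))\<bar>"
      by (intro tendsto_intros W_tendsto)
    show "\<forall>\<^sub>F n in sequentially. \<bar>(W (real n) - ln (ln (real n))) - (W (real m) - ln (ln (real m)))\<bar>
        \<le> (2 + 2 * K) / ln (real m)"
      using eventually_ge_at_top[of m] by eventually_elim (use m in \<open>auto intro!: W_diff\<close>)
  qed auto
  moreover have "\<bar>(W x - ln (ln x)) - (W (real m) - ln (ln (real m)))\<bar> \<le> (2 + 2 * K) / ln (real m)"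
    using m by (intro W_diff)
  ultimately have "\<bar>W x - ln (ln x) - D\<bar> \<le> (4 + 4 * K) / ln (real m)"
    by (simp add: add_divide_distrib)
  also have "\<dots> \<le> (8 + 8 * K) / ln x"
    using ln_le_2_ln_floor[OF assms] m assms K_nonneg 
      mult_left_mono[OF ln_le_2_ln_floor[OF assms], of "4 + 4 * K"] by (simp add: m_def field_simps)
  finally show ?thesis .
qed

end

section \<open>The dilogarithm near 1\<close>

text \<open>The term for \<open>n = 0\<close> vanishes because \<open>1 / 0 = 0\<close>.\<close>
definition dilog :: "real \<Rightarrow> real" where
  "dilog t = (\<Sum>n. (1 / real n ^ 2) * t ^ n)"

lemma summable_one_over_square: "summable (\<lambda>n. 1 / real n ^ 2)"
  using inverse_power_summable[of 2, where 'a = real] by (simp add: inverse_eq_divide)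

lemma summable_dilog:
  assumes "\<bar>t\<bar> \<le> 1"
  shows "summable (\<lambda>n. (1 / real n ^ 2) * t ^ n)"
proof (rule summable_comparison_test')
  show "summable (\<lambda>n. 1 / real n ^ 2)" by (rule summable_one_over_square)
  show "norm ((1 / real n ^ 2) * t ^ n) \<le> 1 / real n ^ 2" for n
    using assms power_le_one[of "\<bar>t\<bar>" n] by (simp add: abs_mult power_abs divide_right_mono)
qed

lemma dilog_0 [simp]: "dilog 0 = 0"
  unfolding dilog_def by (subst suminf_cong[of _ "\<lambda>_. 0"]) (auto simp: power_0_left)

lemma dilog_1: "dilog 1 = pi ^ 2 / 6"
proof -
  have "(\<lambda>n. 1 / real (Suc n) ^ 2) sums (pi ^ 2 / 6)"
    using inverse_squares_sums by (simp add: add_ac)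
  hence "(\<lambda>n. 1 / real n ^ 2) sums (pi ^ 2 / 6)"
    by (subst (asm) sums_Suc_iff) auto
  thus ?thesis unfolding dilog_def by (simp add: sums_iff)
qed

lemma zeta_2: "zeta 2 = pi ^ 2 / 6"
proof -
  have "(\<lambda>n. 1 / real (Suc n) powr 2) sums (pi ^ 2 / 6)"
    using inverse_squares_sums by (simp add: add_ac powr_numeral)
  thus ?thesis unfolding zeta_def by (simp add: sums_iff)
qed

text \<open>This is \<open>- ln (1 - t) / t\<close>, kept as a power series so that 0 is no
  exception and that positivity and monotonicity can be read off the coefficients.\<close>

definition dilog_deriv :: "real \<Rightarrow> real" where
  "dilog_deriv t = (\<Sum>n. (1 / real (Suc n)) * t ^ n)"

lemma summable_dilog_deriv:
  assumes "\<bar>t\<bar> < 1"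
  shows "summable (\<lambda>n. (1 / real (Suc n)) * t ^ n)"
proof (rule summable_comparison_test')
  show "summable (\<lambda>n. \<bar>t\<bar> ^ n)" using assms by (intro summable_geometric) auto
  show "norm ((1 / real (Suc n)) * t ^ n) \<le> \<bar>t\<bar> ^ n" for n
    by (simp add: abs_mult power_abs divide_le_eq mult_le_cancel_left1)
qed

lemma has_real_derivative_dilog:
  assumes "\<bar>t\<bar> < 1"
  shows "(dilog has_real_derivative dilog_deriv t) (at t)"
proof -
  have "((\<lambda>x. \<Sum>n. (1 / real n ^ 2) * x ^ n) has_real_derivative
           (\<Sum>n. diffs (\<lambda>n. 1 / real n ^ 2) n * t ^ n)) (at t)"
    by (rule termdiffs_strong[of _ 1]) (use assms summable_one_over_square in auto)
  moreover have "diffs (\<lambda>n. 1 / real n ^ 2) = (\<lambda>n. 1 / real (Suc n))"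
    by (rule ext) (simp add: diffs_def power2_eq_square divide_simps)
  ultimately show ?thesis by (simp add: dilog_def[abs_def] dilog_deriv_def)
qed

lemma dilog_deriv_nonneg: "0 \<le> t \<Longrightarrow> t < 1 \<Longrightarrow> dilog_deriv t \<ge> 0"
  unfolding dilog_deriv_def by (intro suminf_nonneg summable_dilog_deriv) auto

lemma dilog_deriv_mono: "0 \<le> s \<Longrightarrow> s \<le> t \<Longrightarrow> t < 1 \<Longrightarrow> dilog_deriv s \<le> dilog_deriv t"
  unfolding dilog_deriv_def
  by (intro suminf_le summable_dilog_deriv mult_left_mono power_mono) auto

lemma dilog_deriv_conv_ln:
  assumes "0 \<le> t" "t < 1"
  shows "t * dilog_deriv t = - ln (1 - t)"
proof (cases "t = 0")
  case False
  have "ln (1 - t) = (\<Sum>n. (-1) ^ n * (1 / real (n + 1)) * (1 - t - 1) ^ Suc n)"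
    using assms False by (intro ln_series) auto
  also have "(\<lambda>n. (-1) ^ n * (1 / real (n + 1)) * (1 - t - 1) ^ Suc n)
      = (\<lambda>n. (- t) * ((1 / real (Suc n)) * t ^ n))"
  proof
    fix n
    have "(-1) ^ n * (1 / real (n + 1)) * (1 - t - 1) ^ Suc n 
        = (-1) ^ n * (1 / real (n + 1)) * ((-1) ^ n * t ^ n * (- t))"
      by (simp add: power_mult_distrib [symmetric])
    also have "\<dots> = ((-1) ^ n * (-1) ^ n) * ((- t) * ((1 / real (Suc n)) * t ^ n))"
      by (simp add: mult_ac)
    also have "(-1) ^ n * (-1) ^ n = (1 :: real)"
      by (simp add: power_mult_distrib [symmetric])
    finally show "(-1) ^ n * (1 / real (n + 1)) * (1 - t - 1) ^ Suc n = (- t) * ((1 / real (Suc n)) * t ^ n)"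
      by simp
  qed
  also have "(\<Sum>n. (- t) * ((1 / real (Suc n)) * t ^ n)) = (- t) * dilog_deriv t"
    unfolding dilog_deriv_def using assms by (intro suminf_mult summable_dilog_deriv) auto
  finally show ?thesis by simp
qed auto

lemma sum_inverse_squares_tail:
  assumes "J \<ge> 1"
  shows "(\<Sum>n\<in>{J<..M}. 1 / real n ^ 2) \<le> 1 / real J"
proof (cases "J \<le> M")
  case True
  have "(\<Sum>n\<in>{J<..M}. 1 / real n ^ 2) \<le> 1 / real J - 1 / real M"
    using True
  proof (induction M rule: dec_induct)
    case (step M)
    have "{J<..Suc M} = insert (Suc M) {J<..M}" using step by auto
    moreover have "1 / real (Suc M) ^ 2 \<le> 1 / real M - 1 / real (Suc M)"
    proof -
      have "1 / real M - 1 / real (Suc M) = 1 / (real M * real (Suc M))"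
        using step assms by (simp add: field_simps)
      moreover have "real M * real (Suc M) \<le> real (Suc M) ^ 2" 
        unfolding power2_eq_square by (intro mult_right_mono) auto
      ultimately show ?thesis using step assms by (simp add: frac_le)
    qed
    ultimately show ?case using step.IH by simp
  qed auto
  also have "\<dots> \<le> 1 / real J" by simp
  finally show ?thesis .
qed auto

text \<open>Split the series at \<open>n \<approx> 1 / (1 - t)\<close>: below, \<open>1 - t ^ n \<le> n * (1 - t)\<close>.\<close>
lemma dilog_near_1:
  assumes "0 \<le> t" "t < 1"
  shows "pi ^ 2 / 6 - dilog t \<le> (1 - t) * (3 - ln (1 - t))"
proof -
  define e where "e = 1 - t"
  have e: "e > 0" "e \<le> 1" using assms by (auto simp: e_def)
  define J where "J = nat \<lceil>1 / e\<rceil>"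
  have "1 / e \<ge> 1" using e by simp
  hence "real J = of_int \<lceil>1 / e\<rceil>" unfolding J_def by (intro of_nat_nat) linarith
  hence J: "real J \<ge> 1 / e" "real J \<le> 1 / e + 1" by linarith+
  hence "J \<ge> 1" using \<open>1 / e \<ge> 1\<close> by linarith
  have "pi ^ 2 / 6 - dilog t = (\<Sum>n. (1 / real n ^ 2) * (1 - t ^ n))"
    unfolding dilog_1 [symmetric] dilog_def
    by (subst suminf_diff) (use assms summable_dilog[of t] summable_dilog[of 1] in \<open>auto simp: algebra_simps diff_divide_distrib\<close>)
  also have "\<dots> \<le> e * (3 - ln e)"
  proof (rule suminf_le_const)
    have "summable (\<lambda>n. (1 / real n ^ 2) * 1 ^ n - (1 / real n ^ 2) * t ^ n)"
      using assms by (intro summable_diff summable_dilog) auto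
    thus "summable (\<lambda>n. (1 / real n ^ 2) * (1 - t ^ n))" by (simp add: algebra_simps diff_divide_distrib)
    fix M
    have "(\<Sum>n<M. (1 / real n ^ 2) * (1 - t ^ n)) = (\<Sum>n\<in>{1..<M}. (1 / real n ^ 2) * (1 - t ^ n))"
      by (rule sum.mono_neutral_right) auto
    also have "\<dots> \<le> (\<Sum>n\<in>{1..J} \<union> {J<..M}. (1 / real n ^ 2) * (1 - t ^ n))"
      using assms by (intro sum_mono2) (auto intro!: power_le_one divide_nonneg_nonneg)
    also have "\<dots> = (\<Sum>n\<in>{1..J}. (1 / real n ^ 2) * (1 - t ^ n)) + (\<Sum>n\<in>{J<..M}. (1 / real n ^ 2) * (1 - t ^ n))"
      by (rule sum.union_disjoint) auto
    also have "\<dots> \<le> (\<Sum>n\<in>{1..J}. e / real n) + (\<Sum>n\<in>{J<..M}. 1 / real n ^ 2)"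
    proof (intro add_mono sum_mono)
      fix n assume n: "n \<in> {1..J}"
      have "1 + real n * (t - 1) \<le> (1 + (t - 1)) ^ n" using assms by (intro Bernoulli_inequality) auto
      hence "1 - t ^ n \<le> real n * e" by (simp add: e_def algebra_simps)
      hence "(1 / real n ^ 2) * (1 - t ^ n) \<le> (1 / real n ^ 2) * (real n * e)" by (intro mult_left_mono) auto
      thus "(1 / real n ^ 2) * (1 - t ^ n) \<le> e / real n" using n by (simp add: power2_eq_square)
    next
      fix n :: nat
      show "(1 / real n ^ 2) * (1 - t ^ n) \<le> 1 / real n ^ 2"
        using assms by (simp add: divide_right_mono)
    qed
    \<comment> \<open>Origin of the 3: the harmonic sum contributes 1, the bound
      \<open>J <= 2 / e\<close> contributes \<open>ln 2 < 1\<close>, and the tail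
      \<open>1 / J <= e\<close> contributes the last 1.\<close>
    also have "(\<Sum>n\<in>{1..J}. e / real n) = e * harm J"
      by (simp add: harm_def sum_distrib_left divide_inverse)
    also have "harm J \<le> 1 + ln (real J)"
    proof -
      have "harm (Suc (J - 1)) - ln (real (Suc (J - 1))) \<le> harm (Suc 0) - ln (real (Suc 0))"
        using decseqD[OF decseq_harm_diff_ln, of 0 "J - 1"] by simp
      thus ?thesis using \<open>J \<ge> 1\<close> by (simp add: harm_def)
    qed
    also have "ln (real J) \<le> ln (1 / e * 2)"
    proof (subst ln_le_cancel_iff)
      show "real J \<le> 1 / e * 2" using J \<open>1 / e \<ge> 1\<close> by simp
    qed (use e \<open>J \<ge> 1\<close> in auto)
    also have "ln (1 / e * 2) \<le> 1 - ln e"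
      using e ln_2_less_1 by (simp add: ln_mult ln_div)
    also have "(\<Sum>n\<in>{J<..M}. 1 / real n ^ 2) \<le> 1 / real J"
      by (rule sum_inverse_squares_tail) fact
    also have "1 / real J \<le> e" using J(1) \<open>J \<ge> 1\<close> e by (simp add: field_simps)
    finally show "(\<Sum>n<M. (1 / real n ^ 2) * (1 - t ^ n)) \<le> e * (3 - ln e)" 
      using e by (simp add: algebra_simps)
  qed
  finally show ?thesis by (simp add: e_def)
qed

section \<open>Convolution squares of weights\<close>

definition pairs_upto :: "real \<Rightarrow> (nat \<times> nat) set" where
  "pairs_upto x = {(u, v). 0 < u \<and> 0 < v \<and> real u * real v \<le> x}"

lemma pairs_upto_subset: "pairs_upto x \<subseteq> upto_real x \<times> upto_real x"
proof (clarsimp simp: pairs_upto_def upto_real_def)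
  fix u v :: nat assume uv: "0 < u" "0 < v" "real u * real v \<le> x"
  have "real u * 1 \<le> real u * real v" "1 * real v \<le> real u * real v"
    using uv by (intro mult_mono; simp)+
  thus "real u \<le> x \<and> real v \<le> x" using uv by linarith
qed

lemma finite_pairs_upto [simp, intro]: "finite (pairs_upto x)"
  by (rule finite_subset[OF pairs_upto_subset]) auto

lemma sum_pairs_upto:
  "(\<Sum>(u, v)\<in>pairs_upto x. g u v) = (\<Sum>u\<in>upto_real x. \<Sum>v\<in>upto_real (x / real u). g u v)"
proof -
  have "(\<Sum>u\<in>upto_real x. \<Sum>v\<in>upto_real (x / real u). g u v)
      = (\<Sum>(u, v)\<in>Sigma (upto_real x) (\<lambda>u. upto_real (x / real u)). g u v)"
    by (rule sum.Sigma) auto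
  also have "Sigma (upto_real x) (\<lambda>u. upto_real (x / real u)) = pairs_upto x"
  proof (intro set_eqI iffI)
    fix p assume p: "p \<in> Sigma (upto_real x) (\<lambda>u. upto_real (x / real u))"
    obtain u v where [simp]: "p = (u, v)" by (cases p)
    show "p \<in> pairs_upto x" using p
      by (auto simp: pairs_upto_def upto_real_def pos_le_divide_eq mult.commute)
  next
    fix p assume p: "p \<in> pairs_upto x"
    obtain u v where [simp]: "p = (u, v)" by (cases p)
    show "p \<in> Sigma (upto_real x) (\<lambda>u. upto_real (x / real u))"
      using p pairs_upto_subset[of x]
      by (auto simp: pairs_upto_def upto_real_def pos_le_divide_eq mult.commute)
  qed
  finally show ?thesis by simp
qed

section \<open>Sums of powers against a weight\<close>

context log_weight
begin

lemma W_le_logsum: "W x \<le> (\<Sum>n\<in>upto_real x. w n * ln (real n)) / ln 2"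
  unfolding W_def sum_divide_distrib
proof (rule sum_mono)
  fix n assume n: "n \<in> upto_real x"
  show "w n \<le> w n * ln (real n) / ln 2"
  proof (cases "n \<le> 1")
    case False
    hence "ln 2 \<le> ln (real n)" by simp
    thus ?thesis using nonneg[of n] by (simp add: le_divide_eq mult_left_mono)
  qed (simp add: w_le_1)
qed

text \<open>Replacing \<open>u powr d\<close> by \<open>x powr d\<close> would lose a factor of
  order \<open>ln x * ln (ln x)\<close>. Instead, for \<open>u <= sqrt x\<close> the crude estimate
  leaves a power of \<open>x\<close> to spare, and for larger \<open>u\<close> the factor
  \<open>2 * ln u / ln x >= 1\<close> can be inserted, after which partial summation with
  \<open>exp (d * v)\<close> applies.\<close>

lemma power_sum_bound:
  fixes d :: real
  assumes d: "d > 0"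
  obtains C where "C \<ge> 0" "\<And>x. x \<ge> 2 \<Longrightarrow> (\<Sum>u\<in>upto_real x. w u * real u powr d) \<le> C * x powr d / ln x"
proof -
  define C1 where "C1 = (1 / 2 + (1 + K) / ln 2) / ln 2 * (16 / d\<^sup>2)"
  define C2 where "C2 = 2 * (1 / d + 2 + 2 * K)"
  have C: "C1 \<ge> 0" "C2 \<ge> 0" using d K_nonneg by (auto simp: C1_def C2_def)
  show ?thesis
  proof (rule that[of "C1 + C2"])
    show "C1 + C2 \<ge> 0" using C by simp
    fix x :: real assume x: "x \<ge> 2"
    have lx: "ln x > 0" "ln x \<ge> ln 2" using x by auto
    have small: "(\<Sum>u\<in>upto_real (sqrt x). w u * real u powr d) \<le> C1 * x powr d / ln x"
    proof -
      have sx: "sqrt x \<ge> 1" using x by simp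
      have "(\<Sum>u\<in>upto_real (sqrt x). w u * real u powr d) \<le> (\<Sum>u\<in>upto_real (sqrt x). w u * sqrt x powr d)"
        using d by (intro sum_mono mult_left_mono powr_mono2 nonneg) (auto simp: upto_real_def)
      also have "\<dots> = W (sqrt x) * sqrt x powr d" by (simp add: W_def sum_distrib_right)
      also have "\<dots> \<le> ((\<Sum>n\<in>upto_real (sqrt x). w n * ln (real n)) / ln 2) * sqrt x powr d"
        by (intro mult_right_mono W_le_logsum) auto
      also have "\<dots> \<le> ((ln (sqrt x) + (1 + K)) / ln 2) * sqrt x powr d"
        using log_sum_real[OF sx] by (intro mult_right_mono divide_right_mono) auto
      finally have 1: "(\<Sum>u\<in>upto_real (sqrt x). w u * real u powr d)
          \<le> ((ln (sqrt x) + (1 + K)) / ln 2) * sqrt x powr d" .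
      have "(1 + K) * (ln x / ln 2) \<ge> (1 + K) * 1"
        using K_nonneg lx by (intro mult_left_mono) auto
      hence "ln (sqrt x) + (1 + K) \<le> (1 / 2 + (1 + K) / ln 2) * ln x"
        using x by (simp add: ln_sqrt algebra_simps)
      hence "((ln (sqrt x) + (1 + K)) / ln 2) * sqrt x powr d
          \<le> ((1 / 2 + (1 + K) / ln 2) * ln x / ln 2) * sqrt x powr d"
        by (intro mult_right_mono divide_right_mono) auto
      also have "\<dots> = ((1 / 2 + (1 + K) / ln 2) / ln 2) * ((ln x)\<^sup>2 * sqrt x powr d) / ln x"
        using lx by (simp add: power2_eq_square)
      also have "\<dots> \<le> ((1 / 2 + (1 + K) / ln 2) / ln 2) * ((16 / d\<^sup>2) * x powr d) / ln x"
      proof (intro divide_right_mono mult_left_mono)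
        \<comment> \<open>The exponent \<open>d / 4\<close> is chosen so that the square consumes
          exactly the spare \<open>x powr (d / 2)\<close>; its reciprocal squared is
          \<open>16 / d^2\<close>.\<close>
        have "(ln x)\<^sup>2 \<le> (x powr (d / 4) / (d / 4))\<^sup>2"
          using x d lx by (intro power_mono ln_powr_bound) auto
        also have "\<dots> = (16 / d\<^sup>2) * x powr (d / 2)"
          by (simp add: power_divide power2_eq_square powr_add [symmetric])
        finally have "(ln x)\<^sup>2 * sqrt x powr d \<le> (16 / d\<^sup>2) * x powr (d / 2) * sqrt x powr d"
          by (intro mult_right_mono) auto
        also have "\<dots> = (16 / d\<^sup>2) * x powr d"
          using x by (simp add: powr_half_sqrt [symmetric] powr_powr powr_add [symmetric])
        finally show "(ln x)\<^sup>2 * sqrt x powr d \<le> (16 / d\<^sup>2) * x powr d" .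
      qed (use lx K_nonneg in auto)
      also have "\<dots> = C1 * x powr d / ln x" by (simp add: C1_def)
      finally show ?thesis using 1 by linarith
    qed
    have large: "(\<Sum>u\<in>upto_real x - upto_real (sqrt x). w u * real u powr d) \<le> C2 * x powr d / ln x"
    proof -
      have "(\<Sum>u\<in>upto_real x - upto_real (sqrt x). w u * real u powr d)
          \<le> (\<Sum>u\<in>upto_real x - upto_real (sqrt x). 2 / ln x * (w u * ln (real u) * exp (d * ln (real u))))"
      proof (rule sum_mono)
        fix u assume u: "u \<in> upto_real x - upto_real (sqrt x)"
        hence "real u > sqrt x" by (auto simp: upto_real_def)
        hence "ln (real u) \<ge> ln (sqrt x)" using x u by (subst ln_le_cancel_iff) (auto simp: upto_real_def)
        hence "1 \<le> 2 / ln x * ln (real u)" using lx x by (simp add: ln_sqrt field_simps)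
        hence "(w u * real u powr d) * 1 \<le> (w u * real u powr d) * (2 / ln x * ln (real u))"
          by (intro mult_left_mono) (auto simp: nonneg)
        moreover have "real u powr d = exp (d * ln (real u))" using u by (auto simp: powr_def upto_real_def)
        ultimately show "w u * real u powr d \<le> 2 / ln x * (w u * ln (real u) * exp (d * ln (real u)))"
          by (simp add: mult_ac)
      qed
      also have "\<dots> \<le> (\<Sum>u\<in>upto_real x. 2 / ln x * (w u * ln (real u) * exp (d * ln (real u))))"
        using lx by (intro sum_mono2) (auto simp: nonneg upto_real_def)
      also have "\<dots> = 2 / ln x * (\<Sum>u\<in>upto_real x. w u * ln (real u) * exp (d * ln (real u)))"
        by (simp add: sum_distrib_left)
      also have "\<dots> \<le> 2 / ln x * ((1 / d + 2 + 2 * K) * x powr d)"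
      proof (rule mult_left_mono)
        have "\<bar>(\<Sum>u\<in>upto_real x. w u * ln (real u) * exp (d * ln (real u))) - (exp (d * ln x) / d - exp (d * 0) / d)\<bar>
                 \<le> (2 + 2 * K) * exp (d * ln x)"
          by (rule partial_summation_1) (use d x in \<open>auto intro!: mono_onI derivative_eq_intros\<close>)
        hence "(\<Sum>u\<in>upto_real x. w u * ln (real u) * exp (d * ln (real u)))
           \<le> exp (d * ln x) / d - 1 / d + (2 + 2 * K) * exp (d * ln x)" by simp
        also have "\<dots> \<le> (1 / d + 2 + 2 * K) * exp (d * ln x)"
          using d by (simp add: algebra_simps)
        also have "exp (d * ln x) = x powr d" using x by (simp add: powr_def)
        finally show "(\<Sum>u\<in>upto_real x. w u * ln (real u) * exp (d * ln (real u)))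
           \<le> (1 / d + 2 + 2 * K) * x powr d" .
      qed (use lx in auto)
      also have "\<dots> = C2 * x powr d / ln x" by (simp add: C2_def)
      finally show ?thesis .
    qed
    have "upto_real x = upto_real (sqrt x) \<union> (upto_real x - upto_real (sqrt x))"
    proof -
      have "sqrt x \<le> x" using x real_le_lsqrt[of x x] by (simp add: power2_eq_square)
      thus ?thesis using upto_real_mono by blast
    qed
    hence "upto_real (sqrt x) \<subseteq> upto_real x" by blast
    hence "(\<Sum>u\<in>upto_real x. w u * real u powr d) = (\<Sum>u\<in>upto_real (sqrt x). w u * real u powr d)
        + (\<Sum>u\<in>upto_real x - upto_real (sqrt x). w u * real u powr d)"
      by (subst add.commute, intro sum.subset_diff) auto
    thus "(\<Sum>u\<in>upto_real x. w u * real u powr d) \<le> (C1 + C2) * x powr d / ln x"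
      using small large by (simp add: add_divide_distrib algebra_simps)
  qed
qed

text \<open>By symmetry one of the two factors may be assumed to be at most \<open>sqrt x\<close>.\<close>
lemma pair_power_sum_bound:
  fixes d :: real
  assumes d: "d > 0"
  obtains C where "C \<ge> 0" "\<And>x. x \<ge> 2 \<Longrightarrow>
    (\<Sum>(u, v)\<in>pairs_upto x. w u * w v * (real u * real v) powr d) \<le> C * x powr d / ln x * W x"
proof -
  obtain C where C: "C \<ge> 0"
     "\<And>x. x \<ge> 2 \<Longrightarrow> (\<Sum>u\<in>upto_real x. w u * real u powr d) \<le> C * x powr d / ln x"
    by (rule power_sum_bound[OF d]) auto
  show ?thesis
  proof (rule that[of "4 * C"])
    show "4 * C \<ge> 0" using C by simp
    fix x :: real assume x: "x \<ge> 2"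
    have lx: "ln x > 0" using x by simp
    have sx: "sqrt x \<le> x" using x real_le_lsqrt[of x x] by (simp add: power2_eq_square)
    define G where "G = (\<lambda>(u, v). w u * w v * (real u * real v) powr d)"
    have G0: "G p \<ge> 0" for p by (auto simp: G_def nonneg split: prod.splits)
    define A where "A = Sigma (upto_real (sqrt x)) (\<lambda>u. upto_real (x / real u))"
    have finA: "finite A" by (auto simp: A_def)
    have sub: "pairs_upto x \<subseteq> A \<union> prod.swap ` A"
    proof safe
      fix u v assume uv: "(u, v) \<in> pairs_upto x" "(u, v) \<notin> prod.swap ` A"
      have pos: "0 < u" "0 < v" "real u * real v \<le> x" using uv by (auto simp: pairs_upto_def)
      have "(v, u) \<notin> A" using uv by force
      hence "real v > sqrt x" using pos by (auto simp: A_def upto_real_def field_simps)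
      have "real u \<le> sqrt x"
      proof (rule ccontr)
        assume "\<not> real u \<le> sqrt x"
        hence "sqrt x * sqrt x < real u * real v" using \<open>real v > sqrt x\<close> x pos
          by (intro mult_strict_mono) auto
        thus False using pos x by simp
      qed
      thus "(u, v) \<in> A" using pos by (auto simp: A_def upto_real_def field_simps)
    qed
    have "sum G A = (\<Sum>u\<in>upto_real (sqrt x). \<Sum>v\<in>upto_real (x / real u). G (u, v))"
      unfolding A_def by (subst sum.Sigma) auto
    also have "\<dots> = (\<Sum>u\<in>upto_real (sqrt x). w u * real u powr d * (\<Sum>v\<in>upto_real (x / real u). w v * real v powr d))"
      by (simp add: G_def sum_distrib_left powr_mult mult_ac)
    also have "\<dots> \<le> (\<Sum>u\<in>upto_real (sqrt x). w u * (2 * C * x powr d / ln x))"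
    proof (rule sum_mono)
      fix u assume u: "u \<in> upto_real (sqrt x)"
      hence u1: "real u > 0" "real u \<le> sqrt x" by (auto simp: upto_real_def)
      have xu: "x / real u \<ge> sqrt x"
      proof -
        have "sqrt x * real u \<le> sqrt x * sqrt x" using u1 x by (intro mult_left_mono) auto
        thus ?thesis using u1 x by (simp add: field_simps)
      qed
      \<comment> \<open>For \<open>u <= sqrt x\<close> one has
        \<open>ln (x / u) >= ln x / 2\<close>, and \<open>u powr d\<close> cancels against
        \<open>(x / u) powr d\<close>; below \<open>x / u = 2\<close> all inner weights vanish. The
        4 in the result is this 2 times the 2 for \<open>A\<close> and its mirror image.\<close>
      have "real u powr d * (\<Sum>v\<in>upto_real (x / real u). w v * real v powr d) \<le> 2 * C * x powr d / ln x"
      proof (cases "x / real u \<ge> 2")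
        case False
        hence "(\<Sum>v\<in>upto_real (x / real u). w v * real v powr d) = 0"
          by (intro sum.neutral) (auto simp: upto_real_def intro!: w_le_1)
        thus ?thesis using C lx by simp
      next
        case True
        have l: "ln (x / real u) \<ge> ln x / 2"
        proof -
          have "ln (sqrt x) \<le> ln (x / real u)" using xu x u1 by (subst ln_le_cancel_iff) auto
          thus ?thesis using x by (simp add: ln_sqrt)
        qed
        have "(\<Sum>v\<in>upto_real (x / real u). w v * real v powr d) \<le> C * (x / real u) powr d / ln (x / real u)"
          by (rule C(2)) fact
        also have "\<dots> \<le> C * (x / real u) powr d / (ln x / 2)"
          using l lx C by (intro divide_left_mono mult_nonneg_nonneg mult_pos_pos) auto
        finally have "real u powr d * (\<Sum>v\<in>upto_real (x / real u). w v * real v powr d)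
            \<le> real u powr d * (C * (x / real u) powr d / (ln x / 2))"
          by (intro mult_left_mono) auto
        also have "\<dots> = 2 * C * x powr d / ln x"
          using u1 x by (simp add: powr_divide)
        finally show ?thesis .
      qed
      thus "w u * real u powr d * (\<Sum>v\<in>upto_real (x / real u). w v * real v powr d) \<le> w u * (2 * C * x powr d / ln x)"
        unfolding mult.assoc by (intro mult_left_mono nonneg) (simp add: mult.assoc)
    qed
    also have "\<dots> = 2 * C * x powr d / ln x * W (sqrt x)"
      by (simp add: W_def sum_distrib_left sum_divide_distrib mult_ac)
    also have "\<dots> \<le> 2 * C * x powr d / ln x * W x"
      using C lx sx by (intro mult_left_mono W_mono) auto
    finally have A: "sum G A \<le> 2 * C * x powr d / ln x * W x" .
    have "sum G (pairs_upto x) \<le> sum G (A \<union> prod.swap ` A)"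
      using sub finA G0 by (intro sum_mono2) auto
    also have "\<dots> \<le> sum G A + sum G (prod.swap ` A)"
      using finA G0 sum.union_inter[of A "prod.swap ` A" G] sum_nonneg[of "A \<inter> prod.swap ` A" G] by simp
    also have "sum G (prod.swap ` A) = sum G A"
      by (subst sum.reindex) (auto simp: inj_on_def G_def mult_ac intro!: sum.cong)
    finally show "(\<Sum>(u, v)\<in>pairs_upto x. w u * w v * (real u * real v) powr d) \<le> 4 * C * x powr d / ln x * W x"
      using A by (simp add: G_def)
  qed
qed

text \<open>Compares the cut at \<open>x / 2\<close> with \<open>x\<close> itself. At
  \<open>x = 4\<close> the second bound is an equality, which fixes the threshold.\<close>

lemma ln_ln_diff:
  fixes x :: real
  assumes "x \<ge> 4"
  shows "ln (ln x) - ln (ln (x / 2)) \<in> {0..2 / ln x}" "ln (x / 2) \<ge> ln x / 2"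
proof -
  have "ln x \<ge> ln 4" using assms by simp
  also have "ln (4::real) = 2 * ln 2" using ln_realpow[of 2 2] by simp
  finally have l: "ln x \<ge> 2 * ln 2" .
  have l2: "ln (x / 2) = ln x - ln 2" using assms by (simp add: ln_div)
  show half: "ln (x / 2) \<ge> ln x / 2" using l l2 by simp
  have pos: "ln x > 0" "ln (x / 2) > 0" using assms by auto
  have "ln (ln x) - ln (ln (x / 2)) = ln (ln x / ln (x / 2))" using pos by (simp add: ln_div)
  also have "\<dots> \<le> ln x / ln (x / 2) - 1" using pos by (intro ln_le_minus_one) auto
  also have "\<dots> = ln 2 / ln (x / 2)" using pos l2 by (simp add: field_simps)
  also have "\<dots> \<le> 1 / (ln x / 2)" using pos half ln_2_less_1 by (intro frac_le) auto
  finally show "ln (ln x) - ln (ln (x / 2)) \<in> {0..2 / ln x}"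
    using pos l2 by simp
qed

end

section \<open>The convolution square of a weight\<close>

context log_weight
begin

lemma W_le:
  assumes "x \<ge> 2"
  shows "W x \<le> ln (ln x) + \<bar>D\<bar> + (8 + 8 * K) / ln 2"
proof -
  have "W x \<le> ln (ln x) + \<bar>D\<bar> + (8 + 8 * K) / ln x" using W_asymp[OF assms] by linarith
  also have "(8 + 8 * K) / ln x \<le> (8 + 8 * K) / ln 2"
    using assms K_nonneg by (intro divide_left_mono) auto
  finally show ?thesis by simp
qed

text \<open>
  The identity \<open>1 / (\<Lambda> - v) = (1 + v / (\<Lambda> - v)) / \<Lambda>\<close> with \<open>\<Lambda> = ln x\<close> supplies the factor
  \<open>v = ln u\<close> that partial summation needs.
\<close>
lemma sum_W_div_log:
  assumes x: "x \<ge> 4"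
  shows "(\<Sum>u\<in>upto_real (x / 2). w u / ln (x / real u)) \<le> (W x + ln (ln x) - ln (ln 2) + (2 + 2 * K) / ln 2) / ln x"
proof -
  define \<Lambda> where "\<Lambda> = ln x"
  have pos: "\<Lambda> > 0" using x by (simp add: \<Lambda>_def)
  have l2: "ln (x / 2) = \<Lambda> - ln 2" using x by (simp add: \<Lambda>_def ln_div)
  have lt: "v < \<Lambda>" if "v \<in> {0..ln (x / 2)}" for v using that l2 by (auto intro: le_less_trans)
  have "\<bar>(\<Sum>u\<in>upto_real (x / 2). w u * ln (real u) * (1 / (\<Lambda> - ln (real u)))) - (- ln (\<Lambda> - ln (x / 2)) - - ln (\<Lambda> - 0))\<bar>
      \<le> (2 + 2 * K) * (1 / (\<Lambda> - ln (x / 2)))"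
  proof (rule partial_summation_1)
    show "mono_on {0..ln (x / 2)} (\<lambda>v. 1 / (\<Lambda> - v))"
      using lt by (intro mono_onI divide_left_mono mult_pos_pos) auto
    show "((\<lambda>v. - ln (\<Lambda> - v)) has_real_derivative 1 / (\<Lambda> - v)) (at v)" if "v \<in> {0..ln (x / 2)}" for v
      using lt[OF that] by (auto intro!: derivative_eq_intros simp: field_simps)
    show "1 / (\<Lambda> - v) \<ge> 0" if "v \<in> {0..ln (x / 2)}" for v
      using lt[OF that] by auto
  qed (use x in auto)
  hence 1: "(\<Sum>u\<in>upto_real (x / 2). w u * ln (real u) / (\<Lambda> - ln (real u))) \<le> ln \<Lambda> - ln (ln 2) + (2 + 2 * K) / ln 2"
    by (simp add: l2)
  have "(\<Sum>u\<in>upto_real (x / 2). w u / ln (x / real u))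
      = (\<Sum>u\<in>upto_real (x / 2). (w u + w u * ln (real u) / (\<Lambda> - ln (real u))) / \<Lambda>)"
  proof (rule sum.cong)
    fix u assume u: "u \<in> upto_real (x / 2)"
    hence u1: "real u > 0" "real u \<le> x / 2" by (auto simp: upto_real_def)
    have "ln (real u) \<le> ln (x / 2)" using u1 x by (subst ln_le_cancel_iff) auto
    hence lu: "ln (real u) < \<Lambda>" using l2 by (auto intro: le_less_trans)
    have "ln (x / real u) = \<Lambda> - ln (real u)" using u1 x by (simp add: ln_div \<Lambda>_def)
    moreover have "w u / (\<Lambda> - ln (real u)) = (w u + w u * ln (real u) / (\<Lambda> - ln (real u))) / \<Lambda>"
      using lu pos by (simp add: divide_simps) (simp add: algebra_simps)
    ultimately show "w u / ln (x / real u) = (w u + w u * ln (real u) / (\<Lambda> - ln (real u))) / \<Lambda>" by simp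
  qed auto
  also have "\<dots> = (W (x / 2) + (\<Sum>u\<in>upto_real (x / 2). w u * ln (real u) / (\<Lambda> - ln (real u)))) / \<Lambda>"
    by (simp add: W_def sum.distrib sum_divide_distrib add_divide_distrib)
  also have "\<dots> \<le> (W x + (ln \<Lambda> - ln (ln 2) + (2 + 2 * K) / ln 2)) / \<Lambda>"
    using 1 x pos by (intro divide_right_mono add_mono W_mono) auto
  also have "W x + (ln \<Lambda> - ln (ln 2) + (2 + 2 * K) / ln 2) = W x + ln \<Lambda> - ln (ln 2) + (2 + 2 * K) / ln 2"
    by (simp only: add_diff_eq add.assoc)
  finally show ?thesis by (simp only: \<Lambda>_def)
qed

text \<open>With \<open>t = ln u / ln x\<close> the identity
  \<open>- ln (1 - t) = t * dilog_deriv t\<close> exhibits the factor \<open>ln u\<close> that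
  partial summation needs, and the antiderivative is \<open>dilog (v / ln x)\<close>. At the upper
  end its argument is \<open>1 - ln 2 / ln x\<close>, so that \<open>dilog_near_1\<close> compares
  the value with \<open>dilog 1\<close>.\<close>

lemma sum_W_ln_complement:
  assumes x: "x \<ge> 4"
  shows "\<bar>(\<Sum>u\<in>upto_real (x / 2). w u * ln (1 - ln (real u) / ln x)) + pi\<^sup>2 / 6\<bar>
      \<le> (4 + 4 * K) * (ln (ln x) - ln (ln 2)) / ln x + (3 + ln (ln x) - ln (ln 2)) / ln x"
proof -
  define \<Lambda> where "\<Lambda> = ln x"
  have pos: "\<Lambda> > 0" using x by (simp add: \<Lambda>_def)
  have l2: "ln (x / 2) = \<Lambda> - ln 2" using x by (simp add: \<Lambda>_def ln_div)
  have lt: "v / \<Lambda> < 1" if "v \<in> {0..ln (x / 2)}" for v using that l2 pos by (auto intro: le_less_trans)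
  define \<rho> where "\<rho> = ln (x / 2) / \<Lambda>"
  have rho: "\<rho> \<ge> 1 / 2" "\<rho> < 1" "1 - \<rho> = ln 2 / \<Lambda>"
  proof -
    show *: "1 - \<rho> = ln 2 / \<Lambda>"
      using pos by (simp add: \<rho>_def l2 diff_divide_distrib)
    have "ln 2 / \<Lambda> > 0" using pos by simp
    with * show "\<rho> < 1" by linarith
    show "\<rho> \<ge> 1 / 2"
      using ln_ln_diff(2)[OF x] pos unfolding \<rho>_def \<Lambda>_def [symmetric] by (simp add: pos_le_divide_eq)
  qed
  have ln1: "- ln (1 - \<rho>) = ln \<Lambda> - ln (ln 2)" unfolding rho(3) using pos by (simp add: ln_div)
  have nn: "ln \<Lambda> - ln (ln 2) \<ge> 0" 
    unfolding ln1 [symmetric] using rho by simp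
  define f where "f = (\<lambda>v. dilog_deriv (v / \<Lambda>) / \<Lambda>)"
  have "\<bar>(\<Sum>u\<in>upto_real (x / 2). w u * ln (real u) * f (ln (real u))) - (dilog (ln (x / 2) / \<Lambda>) - dilog (0 / \<Lambda>))\<bar>
      \<le> (2 + 2 * K) * f (ln (x / 2))"
  proof (rule partial_summation_1)
    show "mono_on {0..ln (x / 2)} f"
    proof (rule mono_onI)
      fix r t assume rt: "r \<in> {0..ln (x / 2)}" "t \<in> {0..ln (x / 2)}" "r \<le> t"
      have "dilog_deriv (r / \<Lambda>) \<le> dilog_deriv (t / \<Lambda>)"
        using rt lt[OF rt(2)] less_imp_le[OF pos]
        by (intro dilog_deriv_mono divide_right_mono divide_nonneg_nonneg) simp_all
      thus "f r \<le> f t" unfolding f_def using pos by (intro divide_right_mono) simp_all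
    qed
    show "((\<lambda>v. dilog (v / \<Lambda>)) has_real_derivative f v) (at v)" if "v \<in> {0..ln (x / 2)}" for v
    proof -
      have "((\<lambda>v. v / \<Lambda>) has_real_derivative 1 / \<Lambda>) (at v)"
        using pos by (auto intro!: derivative_eq_intros)
      moreover have "(dilog has_real_derivative dilog_deriv (v / \<Lambda>)) (at (v / \<Lambda>))"
        using lt[OF that] that pos by (intro has_real_derivative_dilog) auto
      ultimately show ?thesis unfolding f_def
        using DERIV_chain2 by fastforce
    qed
    show "f v \<ge> 0" if "v \<in> {0..ln (x / 2)}" for v
      unfolding f_def using lt[OF that] that pos by (intro divide_nonneg_nonneg dilog_deriv_nonneg) auto
  qed (use x in auto)
  hence 1: "\<bar>(\<Sum>u\<in>upto_real (x / 2). w u * ln (real u) * f (ln (real u))) - dilog \<rho>\<bar> \<le> (2 + 2 * K) * f (ln (x / 2))"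
    by (simp add: \<rho>_def)
  have "f (ln (x / 2)) = (- ln (1 - \<rho>)) / \<rho> / \<Lambda>"
  proof -
    have "dilog_deriv \<rho> = - ln (1 - \<rho>) / \<rho>"
      using dilog_deriv_conv_ln[of \<rho>] rho by (simp add: field_simps)
    thus ?thesis by (simp add: f_def \<rho>_def)
  qed
  also have "\<dots> = (ln \<Lambda> - ln (ln 2)) / (\<rho> * \<Lambda>)" by (simp add: ln1)
  also have "\<dots> \<le> (ln \<Lambda> - ln (ln 2)) / (1 / 2 * \<Lambda>)"
    using pos nn rho by (intro divide_left_mono mult_right_mono mult_pos_pos) auto
  finally have "(2 + 2 * K) * f (ln (x / 2)) \<le> (2 + 2 * K) * ((ln \<Lambda> - ln (ln 2)) / (1 / 2 * \<Lambda>))"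
    using K_nonneg by (intro mult_left_mono) auto
  also have "\<dots> = (4 + 4 * K) * (ln \<Lambda> - ln (ln 2)) / \<Lambda>" by (simp add: field_simps)
  finally have 2: "\<bar>(\<Sum>u\<in>upto_real (x / 2). w u * ln (real u) * f (ln (real u))) - dilog \<rho>\<bar> 
     \<le> (4 + 4 * K) * (ln \<Lambda> - ln (ln 2)) / \<Lambda>" using 1 by linarith
  have 3: "(\<Sum>u\<in>upto_real (x / 2). w u * ln (real u) * f (ln (real u)))
      = - (\<Sum>u\<in>upto_real (x / 2). w u * ln (1 - ln (real u) / \<Lambda>))"
    unfolding sum_negf [symmetric]
  proof (rule sum.cong)
    fix u assume u: "u \<in> upto_real (x / 2)"
    hence u1: "real u \<ge> 1" "real u \<le> x / 2" by (auto simp: upto_real_def)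
    have "ln (real u) \<le> ln (x / 2)" using u1 x by (subst ln_le_cancel_iff) auto
    hence "ln (real u) / \<Lambda> < 1" using u1 by (intro lt) auto
    hence "ln (real u) / \<Lambda> * dilog_deriv (ln (real u) / \<Lambda>) = - ln (1 - ln (real u) / \<Lambda>)"
      using u1 pos by (intro dilog_deriv_conv_ln) auto
    hence "w u * (ln (real u) / \<Lambda> * dilog_deriv (ln (real u) / \<Lambda>)) = w u * (- ln (1 - ln (real u) / \<Lambda>))"
      by (simp only:)
    thus "w u * ln (real u) * f (ln (real u)) = - (w u * ln (1 - ln (real u) / \<Lambda>))"
      by (simp add: f_def)
  qed auto
  have "dilog \<rho> \<le> dilog 1" unfolding dilog_def using rho
    by (intro suminf_le summable_dilog mult_left_mono power_mono) auto
  hence 4: "\<bar>pi\<^sup>2 / 6 - dilog \<rho>\<bar> \<le> (1 - \<rho>) * (3 - ln (1 - \<rho>))"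
    using dilog_near_1[of \<rho>] rho by (simp add: dilog_1)
  also have "(1 - \<rho>) * (3 - ln (1 - \<rho>)) \<le> (1 / \<Lambda>) * (3 - ln (1 - \<rho>))"
  proof (rule mult_right_mono)
    show "1 - \<rho> \<le> 1 / \<Lambda>"
      unfolding rho(3) using pos ln_2_less_1 by (intro divide_right_mono) simp_all
    show "0 \<le> 3 - ln (1 - \<rho>)" using nn ln1 by linarith
  qed
  also have "\<dots> = (3 + ln \<Lambda> - ln (ln 2)) / \<Lambda>" using ln1 by simp
  finally show ?thesis using 2 unfolding 3 \<Lambda>_def by linarith
qed

text \<open>Sum over \<open>v\<close> first, which gives \<open>W (x / u)\<close>, and insert
  \<open>W_asymp\<close> there. Since \<open>ln (ln (x / u))\<close> is
  \<open>ln (ln x) + ln (1 - ln u / ln x)\<close>, the constant part \<open>ln (ln x) + D\<close>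
  meets the weight sum again and becomes a square, while the logarithm produces the
  dilogarithm.\<close>

lemma pair_sum_asymp:
  obtains C where "C \<ge> 0" "\<And>x. x \<ge> 4 \<Longrightarrow>
    \<bar>(\<Sum>(u, v)\<in>pairs_upto x. w u * w v) - ((ln (ln x) + D)\<^sup>2 - pi\<^sup>2 / 6)\<bar> \<le> C * (1 + ln (ln x)) / ln x"
proof -
  define c0 where "c0 = \<bar>D\<bar> + (8 + 8 * K) / ln 2"
  define c1 where "c1 = - ln (ln 2 :: real)"
  have c1: "c1 \<ge> 0" using ln_2_less_1 by (simp add: c1_def)
  have c0: "c0 \<ge> 0" using K_nonneg by (simp add: c0_def)
  \<comment> \<open>\<open>A1\<close> pays for the error of \<open>W_asymp\<close> at
    \<open>x / u\<close>, \<open>A2\<close> for replacing \<open>W (x / 2)\<close> by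
    \<open>ln (ln x) + D\<close>, and \<open>A3\<close> for the dilogarithm sum.\<close>
  define A1 where "A1 = (8 + 8 * K) * (2 + c0 + c1 + (2 + 2 * K) / ln 2)"
  define A2 where "A2 = (1 + \<bar>D\<bar>) * (18 + 16 * K)"
  define A3 where "A3 = (4 + 4 * K) * (1 + c1) + (4 + c1)"
  show ?thesis
  proof (rule that[of "A1 + A2 + A3"])
    show "A1 + A2 + A3 \<ge> 0" using c0 c1 K_nonneg unfolding A1_def A2_def A3_def
      by (intro add_nonneg_nonneg mult_nonneg_nonneg divide_nonneg_nonneg) auto
    fix x :: real assume x: "x \<ge> 4"
    define \<Lambda> where "\<Lambda> = ln x"
    define L where "L = ln \<Lambda>"
    have "ln x \<ge> ln 4" using x by simp
    moreover have "ln (4::real) = 2 * ln 2" using ln_realpow[of 2 2] by simp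
    ultimately have \<Lambda>: "\<Lambda> \<ge> 4 / 3" using ln2_ge_two_thirds by (simp add: \<Lambda>_def)
    hence pos: "\<Lambda> > 0" and L: "L \<ge> 0" by (auto simp: L_def)
    have Wx: "W x \<le> L + c0" using W_le[of x] x by (simp add: L_def \<Lambda>_def c0_def)
    have up: "upto_real (x / 2) \<subseteq> upto_real x" using x by (intro upto_real_mono) auto
    have "(\<Sum>(u, v)\<in>pairs_upto x. w u * w v) = (\<Sum>u\<in>upto_real x. w u * W (x / real u))"
      unfolding sum_pairs_upto W_def by (simp add: sum_distrib_left)
    \<comment> \<open>For \<open>u > x / 2\<close> the argument \<open>x / u\<close> is below 2,
      where \<open>W\<close> vanishes; on the remaining range \<open>W_asymp\<close> is
      applicable.\<close>
    also have "\<dots> = (\<Sum>u\<in>upto_real (x / 2). w u * W (x / real u))"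
      using up by (intro sum.mono_neutral_right) (auto simp: upto_real_def field_simps intro!: W_eq_0)
    finally have S: "(\<Sum>(u, v)\<in>pairs_upto x. w u * w v) = (\<Sum>u\<in>upto_real (x / 2). w u * W (x / real u))" .
    have "\<bar>(\<Sum>u\<in>upto_real (x / 2). w u * W (x / real u)) - (\<Sum>u\<in>upto_real (x / 2). w u * (L + D + ln (1 - ln (real u) / \<Lambda>)))\<bar>
        \<le> (\<Sum>u\<in>upto_real (x / 2). (8 + 8 * K) * (w u / ln (x / real u)))"
      unfolding sum_subtractf [symmetric]
    proof (rule order.trans[OF sum_abs sum_mono])
      fix u assume u: "u \<in> upto_real (x / 2)"
      hence u1: "real u > 0" "real u \<le> x / 2" by (auto simp: upto_real_def)
      hence xu: "x / real u \<ge> 2" by (simp add: field_simps)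
      have "ln (x / real u) > 0" using xu by simp
      moreover have "ln (x / real u) = \<Lambda> * (1 - ln (real u) / \<Lambda>)"
        using u1 x pos by (simp add: ln_div \<Lambda>_def field_simps)
      ultimately have "ln (ln (x / real u)) = L + ln (1 - ln (real u) / \<Lambda>)"
        using pos by (simp add: ln_mult L_def zero_less_mult_iff)
      hence "\<bar>W (x / real u) - (L + D + ln (1 - ln (real u) / \<Lambda>))\<bar> \<le> (8 + 8 * K) / ln (x / real u)"
        using W_asymp[OF xu] by (simp add: algebra_simps)
      hence "w u * \<bar>W (x / real u) - (L + D + ln (1 - ln (real u) / \<Lambda>))\<bar> \<le> w u * ((8 + 8 * K) / ln (x / real u))"
        by (intro mult_left_mono nonneg)
      thus "\<bar>w u * W (x / real u) - w u * (L + D + ln (1 - ln (real u) / \<Lambda>))\<bar> \<le> (8 + 8 * K) * (w u / ln (x / real u))"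
        unfolding right_diff_distrib [symmetric] abs_mult using nonneg[of u] by (simp add: mult_ac)
    qed
    also have "\<dots> = (8 + 8 * K) * (\<Sum>u\<in>upto_real (x / 2). w u / ln (x / real u))"
      by (simp add: sum_distrib_left)
    also have "\<dots> \<le> (8 + 8 * K) * ((W x + L - ln (ln 2) + (2 + 2 * K) / ln 2) / \<Lambda>)"
      using sum_W_div_log[OF x] K_nonneg by (intro mult_left_mono) (auto simp: L_def \<Lambda>_def)
    also have "\<dots> \<le> (8 + 8 * K) * (((2 + c0 + c1 + (2 + 2 * K) / ln 2) * (1 + L)) / \<Lambda>)"
    proof (intro mult_left_mono divide_right_mono)
      define r where "r = (2 + 2 * K) / ln (2 :: real)"
      have "r \<ge> 0" using K_nonneg by (simp add: r_def)
      hence "(c0 + c1 + r) * L \<ge> 0" using c0 c1 L by simp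
      hence "W x + L + c1 + r \<le> (2 + c0 + c1 + r) * (1 + L)"
        using Wx by (simp add: algebra_simps)
      thus "W x + L - ln (ln 2) + (2 + 2 * K) / ln 2 \<le> (2 + c0 + c1 + (2 + 2 * K) / ln 2) * (1 + L)"
        by (simp add: c1_def r_def)
    qed (use pos K_nonneg in auto)
    also have "\<dots> = A1 * (1 + L) / \<Lambda>" by (simp add: A1_def)
    finally have e1: "\<bar>(\<Sum>(u, v)\<in>pairs_upto x. w u * w v) - (\<Sum>u\<in>upto_real (x / 2). w u * (L + D + ln (1 - ln (real u) / \<Lambda>)))\<bar>
        \<le> A1 * (1 + L) / \<Lambda>" unfolding S .
    have e2: "(\<Sum>u\<in>upto_real (x / 2). w u * (L + D + ln (1 - ln (real u) / \<Lambda>)))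
       = (L + D) * W (x / 2) + (\<Sum>u\<in>upto_real (x / 2). w u * ln (1 - ln (real u) / \<Lambda>))"
      by (simp add: W_def algebra_simps sum.distrib sum_distrib_left)
    have "\<bar>W (x / 2) - (L + D)\<bar> \<le> (18 + 16 * K) / \<Lambda>"
    proof -
      have "\<bar>W (x / 2) - ln (ln (x / 2)) - D\<bar> \<le> (8 + 8 * K) / ln (x / 2)"
        using x by (intro W_asymp) auto
      also have "\<dots> \<le> (8 + 8 * K) / (\<Lambda> / 2)"
        using ln_ln_diff[OF x] pos K_nonneg unfolding \<Lambda>_def [symmetric]
        by (intro divide_left_mono mult_pos_pos) auto
      finally have a: "\<bar>W (x / 2) - ln (ln (x / 2)) - D\<bar> \<le> (16 + 16 * K) / \<Lambda>"
        by (simp add: field_simps)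
      have b: "L - ln (ln (x / 2)) \<in> {0..2 / \<Lambda>}"
        using ln_ln_diff(1)[OF x] by (simp add: L_def \<Lambda>_def)
      have "(18 + 16 * K) / \<Lambda> = (16 + 16 * K) / \<Lambda> + 2 / \<Lambda>"
        by (simp add: add_divide_distrib [symmetric])
      thus ?thesis using a b by auto
    qed
    hence "\<bar>L + D\<bar> * \<bar>W (x / 2) - (L + D)\<bar> \<le> ((1 + \<bar>D\<bar>) * (1 + L)) * ((18 + 16 * K) / \<Lambda>)"
    proof (intro mult_mono)
      have "\<bar>L + D\<bar> \<le> L + \<bar>D\<bar>" using L by linarith
      moreover have "\<bar>D\<bar> * L \<ge> 0" using L by simp
      ultimately show "\<bar>L + D\<bar> \<le> (1 + \<bar>D\<bar>) * (1 + L)" by (simp add: algebra_simps)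
    qed (use L in auto)
    also have "\<dots> = A2 * (1 + L) / \<Lambda>" by (simp add: A2_def)
    finally have e3: "\<bar>(L + D) * W (x / 2) - (L + D)\<^sup>2\<bar> \<le> A2 * (1 + L) / \<Lambda>"
      by (simp add: abs_mult [symmetric] algebra_simps power2_eq_square)
    have "\<bar>(\<Sum>u\<in>upto_real (x / 2). w u * ln (1 - ln (real u) / \<Lambda>)) + pi\<^sup>2 / 6\<bar>
       \<le> ((4 + 4 * K) * (L + c1) + (3 + L + c1)) / \<Lambda>"
      using sum_W_ln_complement[OF x] by (simp add: \<Lambda>_def L_def c1_def add_divide_distrib)
    also have "\<dots> \<le> (A3 * (1 + L)) / \<Lambda>"
    proof (rule divide_right_mono)
      have "(4 + 4 * K) * (L + c1) \<le> (4 + 4 * K) * ((1 + c1) * (1 + L))"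
        using K_nonneg c1 L mult_nonneg_nonneg[OF c1 L] by (intro mult_left_mono) (auto simp: algebra_simps)
      moreover have "3 + L + c1 \<le> (4 + c1) * (1 + L)"
        using c1 L mult_nonneg_nonneg[OF c1 L] by (simp add: algebra_simps)
      ultimately show "(4 + 4 * K) * (L + c1) + (3 + L + c1) \<le> A3 * (1 + L)"
        unfolding A3_def by (simp add: algebra_simps)
    qed (use pos in auto)
    finally have e4: "\<bar>(\<Sum>u\<in>upto_real (x / 2). w u * ln (1 - ln (real u) / \<Lambda>)) + pi\<^sup>2 / 6\<bar> \<le> A3 * (1 + L) / \<Lambda>" .
    have "\<bar>(\<Sum>(u, v)\<in>pairs_upto x. w u * w v) - ((L + D)\<^sup>2 - pi\<^sup>2 / 6)\<bar>
        \<le> A1 * (1 + L) / \<Lambda> + A2 * (1 + L) / \<Lambda> + A3 * (1 + L) / \<Lambda>"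
      using e1 e3 e4 unfolding e2 by linarith
    also have "\<dots> = (A1 + A2 + A3) * (1 + L) / \<Lambda>" by (simp add: add_divide_distrib algebra_simps)
    finally show "\<bar>(\<Sum>(u, v)\<in>pairs_upto x. w u * w v) - ((ln (ln x) + D)\<^sup>2 - pi\<^sup>2 / 6)\<bar>
        \<le> (A1 + A2 + A3) * (1 + ln (ln x)) / ln x" by (simp add: L_def \<Lambda>_def)
  qed
qed

end

section \<open>Euler products\<close>

text \<open>An unconditional sum may be evaluated along any convenient exhaustion by finite sets,
  for instance by the prime powers up to \<open>M ^ h\<close>.\<close>

lemma has_sum_tendsto_exhaustion:
  assumes "(f has_sum S) A" "\<And>N. finite (X N)" "\<And>N. X N \<subseteq> A" "\<And>x. x \<in> A \<Longrightarrow> eventually (\<lambda>N. x \<in> X N) F"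
  shows "((\<lambda>N. sum f (X N)) \<longlongrightarrow> S) F"
proof -
  have "filterlim X (finite_subsets_at_top A) F"
    unfolding filterlim_finite_subsets_at_top
  proof (intro allI impI)
    fix Y assume Y: "finite Y \<and> Y \<subseteq> A"
    hence "eventually (\<lambda>N. \<forall>x\<in>Y. x \<in> X N) F"
      using assms(4) by (intro eventually_ball_finite) auto
    thus "eventually (\<lambda>N. finite (X N) \<and> Y \<subseteq> X N \<and> X N \<subseteq> A) F"
      by eventually_elim (use assms(2,3) in auto)
  qed
  thus ?thesis using assms(1) unfolding has_sum_def by (rule filterlim_compose[rotated])
qed

lemma sums_infsum_nat:
  fixes f :: "nat \<Rightarrow> real"
  assumes "f summable_on A"
  shows "(\<lambda>n. if n \<in> A then f n else 0) sums infsum f A"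
proof -
  have "(f has_sum infsum f A) A" using assms by simp
  moreover have "(f has_sum infsum f A) A \<longleftrightarrow> ((\<lambda>n. if n \<in> A then f n else 0) has_sum infsum f A) UNIV"
    by (rule has_sum_cong_neutral) auto
  ultimately have "((\<lambda>n. if n \<in> A then f n else 0) has_sum infsum f A) UNIV" by simp
  thus ?thesis by (rule has_sum_imp_sums)
qed

definition coprime_part :: "nat set \<Rightarrow> nat set" where
  "coprime_part S = {n. 0 < n \<and> (\<forall>p\<in>S. \<not> p dvd n)}"

text \<open>Write \<open>n = q ^ k * m\<close> with \<open>q\<close> not dividing \<open>m\<close>;
  summability over the pairs lets the double sum factor. Multiplicativity is asked for coprime
  arguments only because \<open>gap\<close> is not completely multiplicative.\<close>

lemma infsum_coprime_part_insert:
  fixes f :: "nat \<Rightarrow> real"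
  assumes mult: "\<And>m n. coprime m n \<Longrightarrow> f (m * n) = f m * f n"
    and sum: "f summable_on {0<..}"
    and q: "prime q" "q \<notin> S" and S: "\<And>p. p \<in> S \<Longrightarrow> prime p"
  shows "infsum f (coprime_part S) = (\<Sum>\<^sub>\<infinity>k. f (q ^ k)) * infsum f (coprime_part (insert q S))"
proof -
  let ?R = "coprime_part (insert q S)"
  have q0: "q > 0" using q by (simp add: prime_gt_0_nat)
  have bij: "bij_betw (\<lambda>(k, m). q ^ k * m) (UNIV \<times> ?R) (coprime_part S)"
  proof (rule bij_betwI[of _ _ _ "\<lambda>n. (multiplicity q n, n div q ^ multiplicity q n)"])
    show "(\<lambda>(k, m). q ^ k * m) \<in> UNIV \<times> ?R \<rightarrow> coprime_part S"
    proof (clarsimp simp: coprime_part_def q0)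
      fix k m p assume "0 < m" "p \<in> S" "p dvd q ^ k * m" "\<forall>p\<in>S. \<not> p dvd m"
      hence "p dvd q ^ k" using S by (meson prime_dvd_multD)
      hence "p dvd q" using S \<open>p \<in> S\<close> prime_dvd_power by blast
      hence "p = q" using S \<open>p \<in> S\<close> q by (simp add: primes_dvd_imp_eq)
      thus False using q \<open>p \<in> S\<close> by simp
    qed
    show "(\<lambda>n. (multiplicity q n, n div q ^ multiplicity q n)) \<in> coprime_part S \<rightarrow> UNIV \<times> ?R"
    proof (clarsimp simp: coprime_part_def, safe)
      fix n assume n: "0 < n" "\<forall>p\<in>S. \<not> p dvd n"
      have d: "q ^ multiplicity q n dvd n" by (rule multiplicity_dvd)
      show "0 < n div q ^ multiplicity q n"
        using d n q0 by (simp add: div_greater_zero_iff dvd_imp_le)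
      show False if "q dvd n div q ^ multiplicity q n"
        using that n q multiplicity_decompose[of n q] prime_gt_1_nat[of q] by auto
      show False if "p \<in> S" "p dvd n div q ^ multiplicity q n" for p
      proof -
        have "n = (n div q ^ multiplicity q n) * q ^ multiplicity q n"
          using d by (rule dvd_div_mult_self [symmetric])
        hence "n div q ^ multiplicity q n dvd n" by (rule dvdI)
        thus False using that n by (blast intro: dvd_trans)
      qed
    qed
    show "(multiplicity q ((\<lambda>(k, m). q ^ k * m) x), (\<lambda>(k, m). q ^ k * m) x div q ^ multiplicity q ((\<lambda>(k, m). q ^ k * m) x)) = x"
      if "x \<in> UNIV \<times> ?R" for x
    proof -
      obtain k m where x: "x = (k, m)" by (cases x)
      have m: "m > 0" "\<not> q dvd m" using that by (auto simp: x coprime_part_def)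
      have "multiplicity q (q ^ k * m) = k"
        using q m by (simp add: prime_elem_multiplicity_mult_distrib not_dvd_imp_multiplicity_0)
      thus ?thesis using q0 by (simp add: x)
    qed
    show "(\<lambda>(k, m). q ^ k * m) (multiplicity q y, y div q ^ multiplicity q y) = y" for y
      by (simp add: multiplicity_dvd)
  qed
  have cop: "coprime (q ^ k) m" if "m \<in> ?R" for k m
    using that q by (auto simp: coprime_part_def intro!: prime_imp_coprime coprime_power_left_iff[THEN iffD2])
  have sum': "f summable_on coprime_part S"
    by (rule summable_on_subset[OF sum]) (auto simp: coprime_part_def)
  hence "(\<lambda>(k, m). f (q ^ k * m)) summable_on (UNIV \<times> ?R)"
    using summable_on_reindex_bij_betw[OF bij, of f] by (simp add: case_prod_unfold)
  moreover have "(\<lambda>(k, m). f (q ^ k * m)) summable_on (UNIV \<times> ?R)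
      \<longleftrightarrow> (\<lambda>(k, m). f (q ^ k) * f m) summable_on (UNIV \<times> ?R)"
    by (rule summable_on_cong) (auto simp: mult[OF cop])
  ultimately have summ: "(\<lambda>(k, m). f (q ^ k) * f m) summable_on (UNIV \<times> ?R)" by blast
  have "infsum f (coprime_part S) = infsum (\<lambda>(k, m). f (q ^ k * m)) (UNIV \<times> ?R)"
    using infsum_reindex_bij_betw[OF bij, of f] by (simp add: case_prod_unfold)
  also have "\<dots> = infsum (\<lambda>(k, m). f (q ^ k) * f m) (UNIV \<times> ?R)"
    by (rule infsum_cong) (auto simp: mult[OF cop])
  also have "\<dots> = (\<Sum>\<^sub>\<infinity>k. \<Sum>\<^sub>\<infinity>m\<in>?R. f (q ^ k) * f m)"
    by (rule infsum_Sigma'_banach [symmetric]) (rule summ)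
  also have "\<dots> = (\<Sum>\<^sub>\<infinity>k. f (q ^ k)) * infsum f ?R"
    by (simp add: infsum_cmult_left' infsum_cmult_right')
  finally show ?thesis .
qed

lemma infsum_coprime_part_finite:
  fixes f :: "nat \<Rightarrow> real"
  assumes mult: "\<And>m n. coprime m n \<Longrightarrow> f (m * n) = f m * f n"
    and sum: "f summable_on {0<..}"
    and S: "finite S" "\<And>p. p \<in> S \<Longrightarrow> prime p"
  shows "infsum f {0<..} = (\<Prod>p\<in>S. \<Sum>\<^sub>\<infinity>k. f (p ^ k)) * infsum f (coprime_part S)"
  using S
proof (induction S rule: finite_induct)
  case empty
  have "coprime_part {} = {0<..}" by (auto simp: coprime_part_def)
  thus ?case by simp
next
  case (insert q S)
  have "infsum f {0<..} = (\<Prod>p\<in>S. \<Sum>\<^sub>\<infinity>k. f (p ^ k)) * infsum f (coprime_part S)"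
    using insert by auto
  also have "infsum f (coprime_part S) = (\<Sum>\<^sub>\<infinity>k. f (q ^ k)) * infsum f (coprime_part (insert q S))"
    using insert by (intro infsum_coprime_part_insert mult sum) auto
  finally show ?case using insert by (simp add: mult_ac)
qed

lemma infsum_tail_tendsto_0:
  fixes f :: "nat \<Rightarrow> real"
  assumes "f summable_on {0<..}"
  shows "(\<lambda>N. infsum f {N<..}) \<longlonglongrightarrow> 0"
proof -
  define S where "S = infsum f {0<..}"
  have "S - sum f {1..N} = infsum f {N<..}" for N
  proof -
    have "infsum f ({1..N} \<union> {N<..}) = infsum f {1..N} + infsum f {N<..}"
    proof (rule infsum_Un_disjoint)
      show "f summable_on {N<..}" by (rule summable_on_subset[OF assms]) auto
    qed auto
    moreover have "{1..N} \<union> {N<..} = {0<..}" by auto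
    ultimately show ?thesis unfolding S_def by (simp only: infsum_finite finite_atLeastAtMost)
  qed
  moreover have "(\<lambda>N. sum f {1..N}) \<longlonglongrightarrow> S"
  proof (rule has_sum_tendsto_exhaustion)
    show "(f has_sum S) {0<..}" unfolding S_def using assms by (rule has_sum_infsum)
    show "\<forall>\<^sub>F N in sequentially. x \<in> {1..N}" if "x \<in> {0<..}" for x
      using eventually_ge_at_top[of x] by eventually_elim (use that in auto)
  qed auto
  hence "(\<lambda>N. S - sum f {1..N}) \<longlonglongrightarrow> S - S"
    by (intro tendsto_intros)
  ultimately show ?thesis by simp
qed

text \<open>A number without prime factors up to \<open>N\<close> is 1 or larger than
  \<open>N\<close>, so what remains besides \<open>f 1\<close> is bounded by a tail of the
  absolutely convergent series.\<close>

lemma infsum_coprime_part_primes_upto: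
  fixes f :: "nat \<Rightarrow> real"
  assumes "f summable_on {0<..}"
  shows "(\<lambda>N. infsum f (coprime_part (primes_upto N))) \<longlonglongrightarrow> f 1"
proof -
  have abs: "(\<lambda>n. norm (f n)) summable_on {0<..}"
    using assms summable_on_iff_abs_summable_on_real by blast
  have "norm (infsum f (coprime_part (primes_upto N)) - f 1) \<le> infsum (\<lambda>n. norm (f n)) {N<..}" for N
  proof -
    define T where "T = coprime_part (primes_upto N) - {1}"
    have 1: "coprime_part (primes_upto N) = {1} \<union> T"
      by (auto simp: coprime_part_def primes_upto_def T_def)
    have T: "T \<subseteq> {N<..}"
    proof
      fix n assume n: "n \<in> T"
      hence "n \<noteq> 1" "n > 0" by (auto simp: coprime_part_def T_def)
      then obtain p where p: "prime p" "p dvd n" using prime_factor_nat by blast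
      hence "p > N" using n by (auto simp: coprime_part_def primes_upto_def not_le T_def)
      moreover have "p \<le> n" using p \<open>n > 0\<close> by (intro dvd_imp_le)
      ultimately show "n \<in> {N<..}" by simp
    qed
    have T0: "T \<subseteq> {0<..}" using T by auto
    have "1 \<notin> T" by (simp add: T_def)
    have "infsum f ({1} \<union> T) = infsum f {1} + infsum f T"
    proof (rule infsum_Un_disjoint)
      show "f summable_on T" by (rule summable_on_subset[OF assms T0])
      show "{1} \<inter> T = {}" using \<open>1 \<notin> T\<close> by blast
    qed (rule summable_on_finite, rule finite.insertI, rule finite.emptyI)
    hence eq: "infsum f (coprime_part (primes_upto N)) - f 1 = infsum f T" using 1 by simp
    have "norm (infsum f T) \<le> infsum (\<lambda>n. norm (f n)) T"
      by (rule norm_infsum_bound) (rule summable_on_subset[OF abs T0])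
    moreover have "infsum (\<lambda>n. norm (f n)) T \<le> infsum (\<lambda>n. norm (f n)) {N<..}"
    proof (rule infsum_mono2)
      show "(\<lambda>n. norm (f n)) summable_on {N<..}" by (rule summable_on_subset[OF abs]) auto
      show "(\<lambda>n. norm (f n)) summable_on T" by (rule summable_on_subset[OF abs T0])
      show "T \<subseteq> {N<..}" by (rule T)
      show "0 \<le> norm (f x)" for x by (rule norm_ge_zero)
    qed
    ultimately show ?thesis unfolding eq by (rule order.trans)
  qed
  hence ev: "\<forall>\<^sub>F N in sequentially. norm (infsum f (coprime_part (primes_upto N)) - f 1) \<le> infsum (\<lambda>n. norm (f n)) {N<..}"
    by simp
  have lim: "(\<lambda>N. infsum (\<lambda>n. norm (f n)) {N<..}) \<longlonglongrightarrow> 0"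
    by (rule infsum_tail_tendsto_0) (rule abs)
  have "(\<lambda>N. infsum f (coprime_part (primes_upto N)) - f 1) \<longlonglongrightarrow> 0"
    by (rule Lim_null_comparison[OF ev lim])
  thus ?thesis by (simp add: LIM_zero_iff)
qed

text \<open>The finite product times the sum over the numbers coprime to these primes is the full
  sum, and that second factor tends to \<open>f 1 = 1\<close>. Since it is eventually positive, one
  can divide by it.\<close>

lemma euler_product_tendsto:
  fixes f :: "nat \<Rightarrow> real"
  assumes mult: "\<And>m n. coprime m n \<Longrightarrow> f (m * n) = f m * f n"
    and sum: "f summable_on {0<..}" and "f 1 = 1"
  shows "(\<lambda>N. \<Prod>p\<in>primes_upto N. \<Sum>\<^sub>\<infinity>k. f (p ^ k)) \<longlonglongrightarrow> infsum f {0<..}"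
proof -
  define r where "r = (\<lambda>N. infsum f (coprime_part (primes_upto N)))"
  have r: "r \<longlonglongrightarrow> 1" unfolding r_def using infsum_coprime_part_primes_upto[OF sum] assms(3) by simp
  have "(\<lambda>N. infsum f {0<..} / r N) \<longlonglongrightarrow> infsum f {0<..} / 1"
    by (intro tendsto_intros r) auto
  moreover have "\<forall>\<^sub>F N in sequentially. r N > 0" by (rule order_tendstoD[OF r]) auto
  hence "\<forall>\<^sub>F N in sequentially. infsum f {0<..} / r N = (\<Prod>p\<in>primes_upto N. \<Sum>\<^sub>\<infinity>k. f (p ^ k))"
  proof eventually_elim
    case (elim N)
    have "infsum f {0<..} = (\<Prod>p\<in>primes_upto N. \<Sum>\<^sub>\<infinity>k. f (p ^ k)) * r N"
      unfolding r_def by (rule infsum_coprime_part_finite) (auto simp: mult sum primes_upto_def)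
    thus ?case using elim by simp
  qed
  ultimately show ?thesis by (simp add: filterlim_cong)
qed

lemma infsum_geometric:
  fixes t :: real
  assumes "0 \<le> t" "t < 1"
  shows "(\<Sum>\<^sub>\<infinity>k. t ^ k) = 1 / (1 - t)" "(\<lambda>k. t ^ k) summable_on UNIV"
proof -
  have s: "summable (\<lambda>k. t ^ k)" using assms by (intro summable_geometric) auto
  show 1: "(\<lambda>k. t ^ k) summable_on UNIV"
    using s assms by (subst summable_on_UNIV_nonneg_real_iff) auto
  have "(\<lambda>k. t ^ k) sums (\<Sum>\<^sub>\<infinity>k. t ^ k)" using sums_infsum_nat[OF 1] by simp
  moreover have "(\<lambda>k. t ^ k) sums (1 / (1 - t))" using assms by (intro geometric_sums) auto
  ultimately show "(\<Sum>\<^sub>\<infinity>k. t ^ k) = 1 / (1 - t)" by (rule sums_unique2)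
qed

section \<open>The constant in Mertens' second theorem\<close>

text \<open>Abel's theorem for Dirichlet series as \<open>s\<close> decreases to 0. After summation
  by parts the deviations \<open>C n - l\<close> are averaged with the nonnegative weights
  \<open>\<delta> s n\<close>. Those with \<open>n > N0\<close> are at most \<open>e / 4\<close>;
  those with \<open>n <= N0\<close> are bounded by \<open>B\<close>, and their total weight
  \<open>1 - (N0 + 1) powr - s\<close> vanishes in the limit.\<close>

lemma abelian_dirichlet_series:
  fixes c :: "nat \<Rightarrow> real" and A :: "real \<Rightarrow> real"
  assumes C: "(\<lambda>N. \<Sum>n\<in>{1..N}. c n) \<longlonglongrightarrow> l"
    and A: "\<And>s. s > 0 \<Longrightarrow> (\<lambda>N. \<Sum>n\<in>{1..N}. c n * real n powr - s) \<longlonglongrightarrow> A s"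
  shows "(A \<longlongrightarrow> l) (at_right 0)"
proof (rule tendstoI)
  fix e :: real assume e: "e > 0"
  define C where "C = (\<lambda>N. \<Sum>n\<in>{1..N}. c n)"
  define \<delta> where "\<delta> = (\<lambda>s n. real n powr - s - real (Suc n) powr - s)"
  have Cl: "C \<longlonglongrightarrow> l" unfolding C_def by (rule C)
  have "Bseq (\<lambda>n. C n - l)"
    by (intro convergent_imp_Bseq convergentI[of _ "l - l"] tendsto_intros Cl)
  then obtain B where B: "B > 0" "\<And>n. \<bar>C n - l\<bar> \<le> B" by (auto simp: Bseq_def)
  have "\<forall>\<^sub>F n in sequentially. dist (C n) l < e / 4" using Cl e by (intro tendstoD) auto
  then obtain N0 where N0: "\<And>n. n \<ge> N0 \<Longrightarrow> \<bar>C n - l\<bar> \<le> e / 4"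
    by (auto simp: eventually_at_top_linorder dist_real_def intro: less_imp_le)
  have tel: "(\<Sum>n\<in>{1..N}. \<delta> s n) = 1 - real (Suc N) powr - s" for s N
    by (induction N) (auto simp: \<delta>_def)
  have \<delta>: "\<delta> s n \<ge> 0" if "s > 0" "n \<ge> 1" for s n
    using that unfolding \<delta>_def by (auto intro: powr_mono2')
  \<comment> \<open>The limit \<open>l\<close> can be subtracted inside because, by
    \<open>tel\<close>, the weights \<open>\<delta> s n\<close> and the last power sum to 1.\<close>
  have eq: "(\<Sum>n\<in>{1..N}. c n * real n powr - s) - l
     = (C N - l) * real (Suc N) powr - s + (\<Sum>n\<in>{1..N}. (C n - l) * \<delta> s n)" for s N
    by (induction N) (auto simp: C_def \<delta>_def algebra_simps)
  have bound: "\<bar>A s - l\<bar> \<le> e / 2 + B * (1 - real (Suc N0) powr - s)" if s: "s > 0" for s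
  proof (rule tendsto_upperbound)
    show "(\<lambda>N. \<bar>(\<Sum>n\<in>{1..N}. c n * real n powr - s) - l\<bar>) \<longlonglongrightarrow> \<bar>A s - l\<bar>"
      by (intro tendsto_intros A s)
    show "\<forall>\<^sub>F N in sequentially. \<bar>(\<Sum>n\<in>{1..N}. c n * real n powr - s) - l\<bar> \<le> e / 2 + B * (1 - real (Suc N0) powr - s)"
      using eventually_ge_at_top[of N0]
    proof eventually_elim
      case (elim N)
      have "\<bar>(C N - l) * real (Suc N) powr - s\<bar> \<le> e / 4 * 1"
        unfolding abs_mult using N0[OF elim] e powr_mono2'[of "- s" 1 "real (Suc N)"] s by (intro mult_mono) simp_all
      moreover have "\<bar>\<Sum>n\<in>{1..N}. (C n - l) * \<delta> s n\<bar> \<le> B * (1 - real (Suc N0) powr - s) + e / 4"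
      proof -
        have "\<bar>\<Sum>n\<in>{1..N}. (C n - l) * \<delta> s n\<bar> \<le> (\<Sum>n\<in>{1..N}. \<bar>C n - l\<bar> * \<delta> s n)"
          by (rule order.trans[OF sum_abs]) (auto intro!: sum_mono simp: abs_mult \<delta> s)
        also have "\<dots> \<le> (\<Sum>n\<in>{1..N}. (if n \<le> N0 then B * \<delta> s n else 0) + e / 4 * \<delta> s n)"
        proof (rule sum_mono)
          fix n assume n: "n \<in> {1..N}"
          have d: "\<delta> s n \<ge> 0" using n s by (intro \<delta>) auto
          have "\<bar>C n - l\<bar> * \<delta> s n \<le> B * \<delta> s n" using B(2)[of n] d by (rule mult_right_mono)
          moreover have "\<bar>C n - l\<bar> * \<delta> s n \<le> e / 4 * \<delta> s n" if "\<not> n \<le> N0"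
            using N0[of n] that d by (intro mult_right_mono) auto
          moreover have "e / 4 * \<delta> s n \<ge> 0" using d e by simp
          ultimately show "\<bar>C n - l\<bar> * \<delta> s n \<le> (if n \<le> N0 then B * \<delta> s n else 0) + e / 4 * \<delta> s n"
            by auto
        qed
        also have "\<dots> = (\<Sum>n\<in>{1..N}. if n \<le> N0 then B * \<delta> s n else 0) + e / 4 * (\<Sum>n\<in>{1..N}. \<delta> s n)"
          by (simp only: sum.distrib sum_distrib_left)
        also have "(\<Sum>n\<in>{1..N}. if n \<le> N0 then B * \<delta> s n else 0) = B * (\<Sum>n\<in>{1..N0}. \<delta> s n)"
        proof -
          have "(\<Sum>n\<in>{1..N}. if n \<le> N0 then B * \<delta> s n else 0) = (\<Sum>n\<in>{1..N0}. B * \<delta> s n)"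
            using elim by (intro sum.mono_neutral_cong_right) auto
          thus ?thesis by (simp only: sum_distrib_left)
        qed
        also have "(\<Sum>n\<in>{1..N0}. \<delta> s n) = 1 - real (Suc N0) powr - s" by (rule tel)
        also have "(\<Sum>n\<in>{1..N}. \<delta> s n) = 1 - real (Suc N) powr - s" by (rule tel)
        finally have "\<bar>\<Sum>n\<in>{1..N}. (C n - l) * \<delta> s n\<bar> 
            \<le> B * (1 - real (Suc N0) powr - s) + e / 4 * (1 - real (Suc N) powr - s)" .
        moreover have "e / 4 * (1 - real (Suc N) powr - s) \<le> e / 4 * 1"
          using e by (intro mult_left_mono) auto
        ultimately show ?thesis by linarith
      qed
      ultimately show ?case unfolding eq by linarith
    qed
  qed auto
  have "((\<lambda>s. B * (1 - real (Suc N0) powr - s)) \<longlongrightarrow> B * (1 - real (Suc N0) powr - 0)) (at_right 0)"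
    by (intro tendsto_intros) auto
  hence "((\<lambda>s. B * (1 - real (Suc N0) powr - s)) \<longlongrightarrow> 0) (at_right 0)" by simp
  hence "\<forall>\<^sub>F s in at_right 0. B * (1 - real (Suc N0) powr - s) < e / 2"
    using e by (intro order_tendstoD) auto
  moreover have "\<forall>\<^sub>F s in at_right 0. s > (0::real)" by (simp add: eventually_at_right_less)
  ultimately show "\<forall>\<^sub>F s in at_right 0. dist (A s) l < e"
  proof eventually_elim
    case (elim s)
    thus ?case using bound[of s] by (simp add: dist_real_def)
  qed
qed

section \<open>The zeta function at 1 + s, near its pole s = 0\<close>

definition zeta_sum :: "real \<Rightarrow> real" where
  "zeta_sum s = (\<Sum>\<^sub>\<infinity>n\<in>{0<..}. real n powr - (1 + s))"

lemma summable_zeta_sum: "s > 0 \<Longrightarrow> (\<lambda>n::nat. real n powr - (1 + s)) summable_on {0<..}"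
  by (rule summable_on_nat_comparison[of "\<lambda>n. real n powr - (1 + s)"])
     (auto simp: summable_real_powr_iff)

text \<open>The integral test in telescoping form: \<open>\<phi>\<close> samples a primitive of
  \<open>- (x powr - (1 + s))\<close>, and by the mean value theorem
  \<open>\<phi> n - \<phi> (Suc n)\<close> lies between two consecutive terms of the series.\<close>

lemma zeta_sum_bounds:
  assumes s: "s > 0"
  shows "zeta_sum s \<in> {1 / s..1 + 1 / s}"
proof -
  define a where "a = (\<lambda>n. real (Suc n) powr - (1 + s))"
  define \<phi> where "\<phi> = (\<lambda>n. real (Suc n) powr - s / s)"
  have "(\<lambda>n. if n \<in> {0<..} then real n powr - (1 + s) else 0) sums zeta_sum s"
    unfolding zeta_sum_def by (intro sums_infsum_nat summable_zeta_sum s)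
  also have "(\<lambda>n. if n \<in> {0<..} then real n powr - (1 + s) else 0) = (\<lambda>n. real n powr - (1 + s))" by auto
  finally have a: "a sums zeta_sum s" unfolding a_def by (subst sums_Suc_iff) auto
  have diff: "\<phi> n - \<phi> (Suc n) \<in> {a (Suc n)..a n}" for n
  proof -
    have "((\<lambda>x. x powr - s / s) has_real_derivative - (x powr - (1 + s))) (at x)" if "x > 0" for x
      using that s by (auto intro!: derivative_eq_intros simp: powr_diff powr_minus powr_add field_simps)
    then obtain z where z: "real (Suc n) < z" "z < real (Suc (Suc n))"
      "\<phi> (Suc n) - \<phi> n = (real (Suc (Suc n)) - real (Suc n)) * - (z powr - (1 + s))"
      using MVT2[of "real (Suc n)" "real (Suc (Suc n))" "\<lambda>x. x powr - s / s" "\<lambda>x. - (x powr - (1 + s))"]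
      unfolding \<phi>_def by auto
    hence "\<phi> n - \<phi> (Suc n) = z powr - (1 + s)" by simp
    moreover have "z powr - (1 + s) \<le> a n" "z powr - (1 + s) \<ge> a (Suc n)"
      unfolding a_def using z s by (intro powr_mono2'; simp)+
    ultimately show ?thesis by simp
  qed
  have "\<phi> \<longlonglongrightarrow> 0" unfolding \<phi>_def using s by real_asymp
  hence t: "(\<lambda>n. \<phi> n - \<phi> (Suc n)) sums (\<phi> 0 - 0)" by (rule telescope_sums')
  have \<phi>0: "\<phi> 0 = 1 / s" by (simp add: \<phi>_def)
  have "\<phi> 0 - 0 \<le> zeta_sum s" using diff by (intro sums_le[OF _ t a]) auto
  moreover have "(\<lambda>n. a (Suc n)) sums (zeta_sum s - a 0)" using a by (subst sums_Suc_iff) auto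
  hence "zeta_sum s - a 0 \<le> \<phi> 0 - 0" using diff by (intro sums_le[OF _ _ t]) auto
  moreover have "a 0 = 1" by (simp add: a_def)
  ultimately show ?thesis using \<phi>0 by simp
qed

lemma ln_zeta_sum_asymp: "((\<lambda>s. ln (zeta_sum s * s)) \<longlongrightarrow> 0) (at_right 0)"
proof -
  have "((\<lambda>s. zeta_sum s * s) \<longlongrightarrow> 1) (at_right 0)"
  proof (rule tendsto_sandwich)
    have pos: "\<forall>\<^sub>F s in at_right 0. s > (0::real)" by (simp add: eventually_at_right_less)
    show "\<forall>\<^sub>F s in at_right 0. 1 \<le> zeta_sum s * s" using pos
    proof eventually_elim
      case (elim s)
      thus ?case using zeta_sum_bounds[of s] by (simp add: field_simps)
    qed
    show "\<forall>\<^sub>F s in at_right 0. zeta_sum s * s \<le> 1 + s" using pos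
    proof eventually_elim
      case (elim s)
      hence "zeta_sum s * s \<le> (1 + 1 / s) * s" using zeta_sum_bounds[of s] by (intro mult_right_mono) auto
      also have "(1 + 1 / s) * s = 1 + s" using elim by (simp add: distrib_right)
      finally show ?case .
    qed
    show "((\<lambda>s. 1 + s) \<longlongrightarrow> (1::real)) (at_right 0)" by (auto intro!: tendsto_eq_intros)
  qed auto
  hence "((\<lambda>s. ln (zeta_sum s * s)) \<longlongrightarrow> ln 1) (at_right 0)" by (intro tendsto_ln) auto
  thus ?thesis by simp
qed

lemma powr_neg_le_half:
  assumes "prime p" "s \<ge> 0"
  shows "real p powr - (1 + s) \<le> 1 / real p" "real p powr - (1 + s) \<le> 1 / 2" "real p powr - (1 + s) > 0"
proof -
  have p: "real p \<ge> 2" using prime_ge_2_nat[OF assms(1)] by simp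
  have "real p powr - (1 + s) \<le> real p powr - 1" using p assms by (intro powr_mono) auto
  also have "real p powr - 1 = 1 / real p" using p by (simp add: powr_minus_divide)
  finally show 1: "real p powr - (1 + s) \<le> 1 / real p" .
  also have "\<dots> \<le> 1 / 2" using p by (intro divide_left_mono) auto
  finally show "real p powr - (1 + s) \<le> 1 / 2" .
  show "real p powr - (1 + s) > 0" using p by simp
qed

lemma ln_zeta_sum_euler:
  assumes s: "s > 0"
  shows "(\<lambda>N. \<Sum>p\<in>primes_upto N. - ln (1 - real p powr - (1 + s))) \<longlonglongrightarrow> ln (zeta_sum s)"
proof -
  let ?f = "\<lambda>n::nat. real n powr - (1 + s)"
  have lim: "(\<lambda>N. \<Prod>p\<in>primes_upto N. \<Sum>\<^sub>\<infinity>k. ?f (p ^ k)) \<longlonglongrightarrow> infsum ?f {0<..}"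
  proof (rule euler_product_tendsto)
    show "?f summable_on {0<..}" by (rule summable_zeta_sum) fact
  qed (simp_all add: powr_mult)
  have "zeta_sum s > 0" using zeta_sum_bounds[OF s] s by (auto intro: less_le_trans[of _ "1 / s"])
  hence "(\<lambda>N. ln (\<Prod>p\<in>primes_upto N. \<Sum>\<^sub>\<infinity>k. ?f (p ^ k))) \<longlonglongrightarrow> ln (zeta_sum s)"
    using lim by (intro tendsto_ln) (auto simp: zeta_sum_def)
  also have "(\<lambda>N. ln (\<Prod>p\<in>primes_upto N. \<Sum>\<^sub>\<infinity>k. ?f (p ^ k))) = (\<lambda>N. \<Sum>p\<in>primes_upto N. - ln (1 - ?f p))"
  proof
    fix N
    have eq: "(\<Sum>\<^sub>\<infinity>k. ?f (p ^ k)) = 1 / (1 - ?f p)" if "prime p" for p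
    proof -
      have "(\<lambda>k. ?f (p ^ k)) = (\<lambda>k. ?f p ^ k)"
        using prime_gt_0_nat[OF that] by (auto simp: powr_realpow [symmetric] powr_powr mult_ac)
      thus ?thesis using powr_neg_le_half[of p s] that s by (simp add: infsum_geometric)
    qed
    have lt1: "?f p < 1" if "p \<in> primes_upto N" for p
      using powr_neg_le_half(2)[of p s] that s by (simp add: primes_upto_def)
    have "(\<Prod>p\<in>primes_upto N. \<Sum>\<^sub>\<infinity>k. ?f (p ^ k)) = (\<Prod>p\<in>primes_upto N. 1 / (1 - ?f p))"
      by (intro prod.cong eq) (auto simp: primes_upto_def)
    also have "ln \<dots> = (\<Sum>p\<in>primes_upto N. ln (1 / (1 - ?f p)))"
    proof (rule ln_prod)
      fix p assume "p \<in> primes_upto N"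
      thus "1 / (1 - ?f p) \<noteq> 0" using lt1[of p] by simp
    qed auto
    also have "\<dots> = (\<Sum>p\<in>primes_upto N. - ln (1 - ?f p))"
    proof (rule sum.cong)
      fix p assume "p \<in> primes_upto N"
      hence "1 - ?f p > 0" using lt1 by simp
      thus "ln (1 / (1 - ?f p)) = - ln (1 - ?f p)" by (simp only: ln_div) simp
    qed auto
    finally show "ln (\<Prod>p\<in>primes_upto N. \<Sum>\<^sub>\<infinity>k. ?f (p ^ k)) = (\<Sum>p\<in>primes_upto N. - ln (1 - ?f p))" .
  qed
  finally show ?thesis .
qed

lemma sum_primes_upto_conv:
  "(\<Sum>p\<in>primes_upto N. g p) = (\<Sum>n\<le>N. if prime n then g n else 0)"
  by (rule sum.mono_neutral_cong_left) (auto simp: primes_upto_def)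

text \<open>The discrepancy between the prime series of \<open>p powr - (1 + s)\<close> and the
  logarithm of the Euler product. At \<open>s = 0\<close> it is the summand in
  \<open>mertens_B1\<close>.\<close>

definition prime_corr :: "real \<Rightarrow> nat \<Rightarrow> real" where
  "prime_corr s n = (if prime n then ln (1 - real n powr - (1 + s)) + real n powr - (1 + s) else 0)"

lemma prime_corr_bound:
  assumes "s \<ge> 0"
  shows "\<bar>prime_corr s n\<bar> \<le> 2 * (1 / real n ^ 2)"
proof (cases "prime n")
  case True
  define t where "t = real n powr - (1 + s)"
  have t: "t \<le> 1 / real n" "t \<le> 1 / 2" "t > 0" unfolding t_def using powr_neg_le_half[OF True assms] by auto
  have "\<bar>ln (1 + (- t)) - (- t)\<bar> \<le> 2 * (- t)\<^sup>2" using t by (intro abs_ln_one_plus_x_minus_x_bound) auto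
  also have "(- t)\<^sup>2 \<le> (1 / real n)\<^sup>2" using t unfolding power2_minus by (intro power_mono) auto
  finally show ?thesis using True by (simp add: prime_corr_def t_def power_divide)
qed (simp add: prime_corr_def)

lemma summable_prime_corr: "s \<ge> 0 \<Longrightarrow> summable (prime_corr s)"
  by (rule summable_comparison_test'[OF summable_mult[OF summable_one_over_square, of 2]])
     (simp only: real_norm_def prime_corr_bound)

text \<open>The terms are dominated by \<open>2 / n^2\<close> uniformly in \<open>s >= 0\<close>, so
  Tannery's theorem permits the passage to \<open>s = 0\<close> inside the series.\<close>

lemma prime_corr_tendsto:
  "((\<lambda>s. suminf (prime_corr s)) \<longlongrightarrow> mertens_B1 - euler_mascheroni) (at_right 0)"
proof -
  have "(\<lambda>p. ln (1 - 1 / real p) + 1 / real p) summable_on {p. prime p}"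
  proof (rule summable_on_nat_comparison)
    show "summable (\<lambda>n. 2 * (1 / real n ^ 2))" by (intro summable_mult summable_one_over_square)
    show "\<bar>ln (1 - 1 / real n) + 1 / real n\<bar> \<le> 2 * (1 / real n ^ 2)" if "n \<in> {p. prime p}" for n
      using prime_corr_bound[of 0 n] that by (simp add: prime_corr_def powr_minus_divide)
  qed auto
  from sums_infsum_nat[OF this]
  have "(\<lambda>n. if n \<in> {p. prime p} then ln (1 - 1 / real n) + 1 / real n else 0) sums (mertens_B1 - euler_mascheroni)"
    by (simp add: mertens_B1_def)
  also have "(\<lambda>n. if n \<in> {p. prime p} then ln (1 - 1 / real n) + 1 / real n else 0) = prime_corr 0"
    by (rule ext) (simp add: prime_corr_def powr_minus_divide)
  finally have "suminf (prime_corr 0) = mertens_B1 - euler_mascheroni" by (rule sums_unique [symmetric])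
  moreover have "((\<lambda>s. \<Sum>n. prime_corr s n) \<longlongrightarrow> (\<Sum>n. prime_corr 0 n)) (at_right 0)"
  proof (rule tannerys_theorem[THEN conjunct2, THEN conjunct2])
    show "((\<lambda>s. prime_corr s k) \<longlongrightarrow> prime_corr 0 k) (at_right 0)" for k
    proof (cases "prime k")
      case True
      have "((\<lambda>s. ln (1 - real k powr - (1 + s)) + real k powr - (1 + s)) \<longlongrightarrow>
              ln (1 - real k powr - (1 + 0)) + real k powr - (1 + 0)) (at_right 0)"
        using powr_neg_le_half(2)[OF True, of 0] prime_gt_0_nat[OF True] by (intro tendsto_intros) auto
      thus ?thesis using True by (simp add: prime_corr_def)
    qed (simp add: prime_corr_def)
    have "\<forall>\<^sub>F s in at_right 0. s > (0::real)" by (simp add: eventually_at_right_less)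
    hence "\<forall>\<^sub>F (k, s) in sequentially \<times>\<^sub>F at_right 0. s > (0::real)"
      by (subst eventually_prod2) auto
    thus "\<forall>\<^sub>F (k, s) in sequentially \<times>\<^sub>F at_right 0. norm (prime_corr s k) \<le> 2 * (1 / real k ^ 2)"
      by eventually_elim (auto intro!: prime_corr_bound[simplified])
    show "summable (\<lambda>n. 2 * (1 / real n ^ 2))" by (intro summable_mult summable_one_over_square)
  qed auto
  ultimately show ?thesis by simp
qed

definition prime_weight :: "nat \<Rightarrow> real" where
  "prime_weight n = (if prime n then 1 / real n else 0)"

lemma log_weight_prime_weight: obtains K where "log_weight prime_weight K"
proof -
  obtain K where K: "\<And>n. n \<ge> 1 \<Longrightarrow> \<bar>(\<Sum>p\<in>primes_upto n. ln (real p) / real p) - ln (real n)\<bar> \<le> K"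
    by (rule Mertens_first) auto
  have "(\<Sum>k\<in>{1..n}. prime_weight k * ln (real k)) = (\<Sum>p\<in>primes_upto n. ln (real p) / real p)" for n
    by (rule sum.mono_neutral_cong_right)
       (auto simp: primes_upto_def prime_weight_def Suc_le_eq prime_gt_0_nat)
  hence "log_weight prime_weight K"
    using K by unfold_locales (auto simp: prime_weight_def le_Suc_eq)
  thus ?thesis by (rule that)
qed

text \<open>
  The powers of two are the comparison sequence that brings in Euler's constant: the weight of
  \<open>2 ^ k\<close> is \<open>1 / k\<close>, so its partial sums are harmonic numbers and its Dirichlet series is a logarithm.
\<close>
definition power2_weight :: "nat \<Rightarrow> real" where
  "power2_weight n = (if n \<in> (\<lambda>k. 2 ^ k) ` {1..} then ln 2 / ln (real n) else 0)"

lemma sum_power2_weight: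
  assumes "N \<ge> 1"
  shows "(\<Sum>n\<in>{1..N}. power2_weight n * real n powr - s) = (\<Sum>k\<in>{1..nat \<lfloor>log 2 (real N)\<rfloor>}. (2 powr - s) ^ k / real k)"
proof -
  define m where "m = nat \<lfloor>log 2 (real N)\<rfloor>"
  have le: "2 ^ k \<le> N \<longleftrightarrow> k \<le> m" for k :: nat
  proof -
    have "k \<le> m \<longleftrightarrow> real k \<le> log 2 (real N)" using assms by (simp add: m_def le_nat_iff le_floor_iff)
    also have "\<dots> \<longleftrightarrow> 2 powr real k \<le> real N" using assms by (subst le_log_iff) auto
    also have "\<dots> \<longleftrightarrow> real (2 ^ k) \<le> real N" by (simp add: powr_realpow)
    finally show ?thesis by linarith
  qed
  have "(\<Sum>n\<in>{1..N}. power2_weight n * real n powr - s) = (\<Sum>n\<in>(\<lambda>k. 2 ^ k) ` {1..m}. ln 2 / ln (real n) * real n powr - s)"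
    by (rule sum.mono_neutral_cong_right) (auto simp: power2_weight_def le)
  also have "\<dots> = (\<Sum>k\<in>{1..m}. ln 2 / ln (real (2 ^ k)) * real (2 ^ k) powr - s)"
    by (subst sum.reindex) (auto simp: inj_on_def)
  also have "\<dots> = (\<Sum>k\<in>{1..m}. (2 powr - s) ^ k / real k)"
  proof (rule sum.cong)
    fix k assume "k \<in> {1..m}"
    have "real (2 ^ k) powr - s = (2 powr - s) ^ k"
      by (simp add: powr_realpow [symmetric] powr_powr mult_ac)
    thus "ln 2 / ln (real (2 ^ k)) * real (2 ^ k) powr - s = (2 powr - s) ^ k / real k"
      by (simp add: ln_realpow)
  qed auto
  finally show ?thesis by (simp add: m_def)
qed

lemma filterlim_nat_floor_log: "filterlim (\<lambda>N. nat \<lfloor>log 2 (real N)\<rfloor>) sequentially sequentially"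
proof -
  have "filterlim (\<lambda>N. log 2 (real N)) at_top sequentially" by real_asymp
  thus ?thesis
    by (intro filterlim_compose[OF filterlim_nat_sequentially] filterlim_compose[OF filterlim_floor_sequentially])
qed

lemma sum_power2_weight_tendsto:
  assumes "s > 0"
  shows "(\<lambda>N. \<Sum>n\<in>{1..N}. power2_weight n * real n powr - s) \<longlonglongrightarrow> - ln (1 - 2 powr - s)"
proof -
  define t where "t = (2 :: real) powr - s"
  have t: "0 \<le> t" "t < 1" using assms powr_less_mono[of "-s" 0 "2::real"] by (auto simp: t_def)
  have "(\<lambda>m. t * (\<Sum>n<m. (1 / real (Suc n)) * t ^ n)) \<longlonglongrightarrow> t * dilog_deriv t"
    unfolding dilog_deriv_def using t by (intro tendsto_intros summable_LIMSEQ summable_dilog_deriv) auto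
  also have "(\<lambda>m. t * (\<Sum>n<m. (1 / real (Suc n)) * t ^ n)) = (\<lambda>m. \<Sum>k\<in>{1..m}. t ^ k / real k)"
  proof
    fix m show "t * (\<Sum>n<m. (1 / real (Suc n)) * t ^ n) = (\<Sum>k\<in>{1..m}. t ^ k / real k)"
      by (induction m) (auto simp: algebra_simps)
  qed
  also have "t * dilog_deriv t = - ln (1 - t)" by (rule dilog_deriv_conv_ln) (rule t)+
  finally have "(\<lambda>N. \<Sum>k\<in>{1..nat \<lfloor>log 2 (real N)\<rfloor>}. t ^ k / real k) \<longlonglongrightarrow> - ln (1 - t)"
    by (rule filterlim_compose[OF _ filterlim_nat_floor_log])
  moreover have "\<forall>\<^sub>F N in sequentially. (\<Sum>n\<in>{1..N}. power2_weight n * real n powr - s) = (\<Sum>k\<in>{1..nat \<lfloor>log 2 (real N)\<rfloor>}. t ^ k / real k)"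
    using eventually_ge_at_top[of 1] by eventually_elim (simp only: sum_power2_weight t_def)
  ultimately show ?thesis unfolding t_def by (simp add: filterlim_cong)
qed

text \<open>The sum is the harmonic number of the integer part of \<open>log 2 N\<close>, whose
  logarithm is \<open>ln (ln N) - ln (ln 2)\<close> up to a null sequence.\<close>

lemma sum_power2_weight_harm:
  "(\<lambda>N. (\<Sum>n\<in>{1..N}. power2_weight n) - ln (ln (real N))) \<longlonglongrightarrow> euler_mascheroni - ln (ln 2)"
proof -
  have "(\<lambda>m. harm m - ln (real m)) \<longlonglongrightarrow> (euler_mascheroni :: real)"
    using euler_mascheroni_LIMSEQ by simp
  hence 1: "(\<lambda>N. harm (nat \<lfloor>log 2 (real N)\<rfloor>) - ln (real (nat \<lfloor>log 2 (real N)\<rfloor>))) \<longlonglongrightarrow> (euler_mascheroni :: real)"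
    by (rule filterlim_compose[OF _ filterlim_nat_floor_log])
  have 2: "(\<lambda>N. ln (real (nat \<lfloor>log 2 (real N)\<rfloor>)) - ln (ln (real N))) \<longlonglongrightarrow> - ln (ln 2)"
  proof (rule tendsto_sandwich)
    have ev: "\<forall>\<^sub>F N in sequentially. N \<ge> (8 :: nat)" by (rule eventually_ge_at_top)
    have *: "real (nat \<lfloor>log 2 (real N)\<rfloor>) \<in> {log 2 (real N) - 1..log 2 (real N)}" "log 2 (real N) \<ge> 3" if "N \<ge> 8" for N
    proof -
      have "log 2 (real N) \<ge> log 2 (2 ^ 3)" using that by (subst log_le_cancel_iff) auto
      also have "log 2 (2 ^ 3) = 3" by (subst log_nat_power) auto
      finally show **: "log 2 (real N) \<ge> 3" .
      hence "real (nat \<lfloor>log 2 (real N)\<rfloor>) = of_int \<lfloor>log 2 (real N)\<rfloor>" by (intro of_nat_nat) linarith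
      thus "real (nat \<lfloor>log 2 (real N)\<rfloor>) \<in> {log 2 (real N) - 1..log 2 (real N)}"
        using floor_correct[of "log 2 (real N)"] by simp
    qed
    show "\<forall>\<^sub>F N in sequentially. ln (log 2 (real N) - 1) - ln (ln (real N)) \<le> ln (real (nat \<lfloor>log 2 (real N)\<rfloor>)) - ln (ln (real N))"
      using ev
    proof eventually_elim
      case (elim N)
      show ?case using *[OF elim] by (intro diff_right_mono, subst ln_le_cancel_iff) auto
    qed
    show "\<forall>\<^sub>F N in sequentially. ln (real (nat \<lfloor>log 2 (real N)\<rfloor>)) - ln (ln (real N)) \<le> ln (log 2 (real N)) - ln (ln (real N))"
      using ev
    proof eventually_elim
      case (elim N)
      show ?case using *[OF elim] by (intro diff_right_mono, subst ln_le_cancel_iff) auto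
    qed
    have inv: "ln (inverse (ln 2)) = - ln (ln (2::real))" by (rule ln_inverse)
    show "(\<lambda>N. ln (log 2 (real N) - 1) - ln (ln (real N))) \<longlonglongrightarrow> - ln (ln 2)"
      unfolding log_def inv [symmetric] by real_asymp
    show "(\<lambda>N. ln (log 2 (real N)) - ln (ln (real N))) \<longlonglongrightarrow> - ln (ln 2)"
      unfolding log_def inv [symmetric] by real_asymp
  qed
  have "(\<lambda>N. harm (nat \<lfloor>log 2 (real N)\<rfloor>) - ln (ln (real N))) \<longlonglongrightarrow> euler_mascheroni + - ln (ln 2)"
    using tendsto_add[OF 1 2] by simp
  moreover have "\<forall>\<^sub>F N in sequentially. harm (nat \<lfloor>log 2 (real N)\<rfloor>) - ln (ln (real N)) = (\<Sum>n\<in>{1..N}. power2_weight n) - ln (ln (real N))"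
    using eventually_ge_at_top[of 1]
  proof eventually_elim
    case (elim N)
    have "(\<Sum>n\<in>{1..N}. power2_weight n) = (\<Sum>n\<in>{1..N}. power2_weight n * real n powr - 0)"
      by (rule sum.cong) auto
    also have "\<dots> = harm (nat \<lfloor>log 2 (real N)\<rfloor>)"
      unfolding sum_power2_weight[OF elim] harm_def by (simp add: inverse_eq_divide)
    finally show ?case by simp
  qed
  ultimately have "(\<lambda>N. (\<Sum>n\<in>{1..N}. power2_weight n) - ln (ln (real N))) \<longlonglongrightarrow> euler_mascheroni + - ln (ln 2)"
    by (rule Lim_transform_eventually)
  thus ?thesis by simp
qed

text \<open>The partial sums of both weights grow like \<open>ln (ln N)\<close>, so those of the
  difference \<open>c\<close> converge, and \<open>abelian_dirichlet_series\<close> equates their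
  limit with that of the Dirichlet series at 0. In this series the singular parts
  \<open>ln (1 / s)\<close> and \<open>ln s\<close> cancel, leaving
  \<open>mertens_B1 - euler_mascheroni + ln (ln 2)\<close>; the partial sums give
  \<open>D - euler_mascheroni + ln (ln 2)\<close>.\<close>

theorem Mertens_second_constant: "log_weight.D prime_weight = mertens_B1"
proof -
  obtain K where "log_weight prime_weight K" by (rule log_weight_prime_weight)
  then interpret log_weight prime_weight K .
  define c where "c = (\<lambda>n. prime_weight n - power2_weight n)"
  have "(\<lambda>N. (W (real N) - ln (ln (real N))) - ((\<Sum>n\<in>{1..N}. power2_weight n) - ln (ln (real N))))
       \<longlonglongrightarrow> D - (euler_mascheroni - ln (ln 2))"
    by (intro tendsto_diff W_tendsto sum_power2_weight_harm)
  also have "(\<lambda>N. (W (real N) - ln (ln (real N))) - ((\<Sum>n\<in>{1..N}. power2_weight n) - ln (ln (real N))))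
      = (\<lambda>N. \<Sum>n\<in>{1..N}. c n)"
    by (simp add: W_def upto_real_of_nat c_def sum_subtractf)
  finally have C: "(\<lambda>N. \<Sum>n\<in>{1..N}. c n) \<longlonglongrightarrow> D - (euler_mascheroni - ln (ln 2))" .
  define A where "A = (\<lambda>s. ln (zeta_sum s) + suminf (prime_corr s) + ln (1 - 2 powr - s))"
  have A: "(\<lambda>N. \<Sum>n\<in>{1..N}. c n * real n powr - s) \<longlonglongrightarrow> A s" if s: "s > 0" for s
  proof -
    have "(\<lambda>N. \<Sum>n\<le>N. prime_corr s n) \<longlonglongrightarrow> suminf (prime_corr s)"
      using s by (intro summable_LIMSEQ' summable_prime_corr) auto
    hence "(\<lambda>N. (\<Sum>p\<in>primes_upto N. - ln (1 - real p powr - (1 + s))) + (\<Sum>n\<le>N. prime_corr s n)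
             - (\<Sum>n\<in>{1..N}. power2_weight n * real n powr - s)) \<longlonglongrightarrow> 
           ln (zeta_sum s) + suminf (prime_corr s) - (- ln (1 - 2 powr - s))"
      by (intro tendsto_diff tendsto_add ln_zeta_sum_euler sum_power2_weight_tendsto s)
    moreover have "(\<Sum>p\<in>primes_upto N. - ln (1 - real p powr - (1 + s))) + (\<Sum>n\<le>N. prime_corr s n)
             = (\<Sum>n\<in>{1..N}. prime_weight n * real n powr - s)" for N
    proof -
      have "(\<Sum>p\<in>primes_upto N. - ln (1 - real p powr - (1 + s))) + (\<Sum>n\<le>N. prime_corr s n)
          = (\<Sum>n\<le>N. prime_weight n * real n powr - s)"
        unfolding sum_primes_upto_conv sum.distrib [symmetric]
        by (rule sum.cong) (auto simp: prime_corr_def prime_weight_def powr_diff powr_minus field_simps prime_gt_0_nat)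
      also have "\<dots> = (\<Sum>n\<in>{1..N}. prime_weight n * real n powr - s)"
        by (rule sum.mono_neutral_right) (auto simp: not_le)
      finally show ?thesis .
    qed
    ultimately show ?thesis by (simp add: A_def c_def left_diff_distrib sum_subtractf)
  qed
  have lim1: "(A \<longlongrightarrow> D - (euler_mascheroni - ln (ln 2))) (at_right 0)"
    by (rule abelian_dirichlet_series[OF C A])
  have "((\<lambda>s. ln ((1 - 2 powr - s) / s)) \<longlongrightarrow> ln (ln 2)) (at_right (0::real))"
    by real_asymp
  hence "((\<lambda>s. ln (zeta_sum s * s) + suminf (prime_corr s) + ln ((1 - 2 powr - s) / s))
       \<longlongrightarrow> 0 + (mertens_B1 - euler_mascheroni) + ln (ln 2)) (at_right 0)"
    by (intro tendsto_add ln_zeta_sum_asymp prime_corr_tendsto)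
  moreover have "\<forall>\<^sub>F s in at_right 0. ln (zeta_sum s * s) + suminf (prime_corr s) + ln ((1 - 2 powr - s) / s) = A s"
  proof -
    have "\<forall>\<^sub>F s in at_right 0. s > (0::real)" by (simp add: eventually_at_right_less)
    thus ?thesis
    proof eventually_elim
      case (elim s)
      have "zeta_sum s > 0" using zeta_sum_bounds[OF elim] elim by (auto intro: less_le_trans[of _ "1 / s"])
      moreover have "2 powr - s < (1::real)" using elim powr_less_mono[of "-s" 0 "2::real"] by simp
      ultimately show ?case using elim by (simp add: A_def ln_mult ln_div)
    qed
  qed
  ultimately have "(A \<longlongrightarrow> 0 + (mertens_B1 - euler_mascheroni) + ln (ln 2)) (at_right 0)"
    by (rule Lim_transform_eventually)
  hence "D - (euler_mascheroni - ln (ln 2)) = 0 + (mertens_B1 - euler_mascheroni) + ln (ln 2)"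
    using lim1 by (intro tendsto_unique[OF _ lim1]) auto
  thus ?thesis by simp
qed

section \<open>Numbers with all exponents strictly between h and 2h\<close>

locale hfull =
  fixes h :: nat
  assumes h_ge_2: "h \<ge> 2"
begin

text \<open>The exponents 0 and \<open>h + r\<close> with \<open>0 < r < h\<close> represent each
  residue class modulo \<open>h\<close> exactly once. Exponents \<open>h\<close> and
  \<open>2 * h\<close> are excluded since a multiple of \<open>h\<close> goes entirely into the
  factor \<open>a ^ h\<close>.\<close>

definition gap_full :: "nat \<Rightarrow> bool" where
  "gap_full b \<longleftrightarrow> b > 0 \<and> (\<forall>p. prime p \<longrightarrow> multiplicity p b = 0 \<or> h < multiplicity p b \<and> multiplicity p b < 2 * h)"

definition gap :: "real \<Rightarrow> nat \<Rightarrow> real" where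
  "gap s b = (if gap_full b then real b powr - s else 0)"

lemma gap_nonneg: "gap s b \<ge> 0"
  by (simp add: gap_def)

lemma gap_1: "gap s 1 = 1"
  using h_ge_2 by (simp add: gap_def gap_full_def)

lemma gap_full_mult:
  assumes "coprime m n"
  shows "gap_full (m * n) \<longleftrightarrow> gap_full m \<and> gap_full n"
proof (cases "m = 0 \<or> n = 0")
  case False
  hence "multiplicity p (m * n) = multiplicity p m + multiplicity p n" if "prime p" for p
    using that by (intro prime_elem_multiplicity_mult_distrib) auto
  moreover have "multiplicity p m = 0 \<or> multiplicity p n = 0" if "prime p" for p
    using assms that by (meson coprime_common_divisor not_dvd_imp_multiplicity_0 not_prime_unit)
  ultimately show ?thesis using False unfolding gap_full_def
    by (metis add.right_neutral add_0 mult_pos_pos gr0I)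
qed (auto simp: gap_full_def)

lemma gap_mult: "coprime m n \<Longrightarrow> gap s (m * n) = gap s m * gap s n"
  by (simp add: gap_def gap_full_mult powr_mult)

lemma gap_full_prime_power:
  assumes "prime p"
  shows "gap_full (p ^ k) \<longleftrightarrow> k = 0 \<or> h < k \<and> k < 2 * h"
proof -
  have "multiplicity q (p ^ k) = (if q = p then k else 0)" if "prime q" for q
    using assms that by (auto simp: prime_multiplicity_other prime_elem_multiplicity_power_distrib)
  thus ?thesis using assms by (auto simp: gap_full_def prime_gt_0_nat)
qed

lemma gap_prime_power_sum:
  assumes "prime p"
  shows "(\<Sum>\<^sub>\<infinity>k. gap s (p ^ k)) = 1 + (\<Sum>k\<in>{h<..<2*h}. real p powr - (real k * s))"
proof -
  have "(\<Sum>\<^sub>\<infinity>k. gap s (p ^ k)) = (\<Sum>\<^sub>\<infinity>k\<in>insert 0 {h<..<2*h}. gap s (p ^ k))"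
    by (rule infsum_cong_neutral) (auto simp: gap_def gap_full_prime_power[OF assms])
  also have "\<dots> = (\<Sum>k\<in>insert 0 {h<..<2*h}. gap s (p ^ k))" by simp
  also have "\<dots> = 1 + (\<Sum>k\<in>{h<..<2*h}. gap s (p ^ k))" using gap_1[of s] by (subst sum.insert) auto
  also have "(\<Sum>k\<in>{h<..<2*h}. gap s (p ^ k)) = (\<Sum>k\<in>{h<..<2*h}. real p powr - (real k * s))"
    using prime_gt_0_nat[OF assms]
    by (intro sum.cong refl) (auto simp: gap_def gap_full_prime_power[OF assms] powr_realpow [symmetric] powr_powr)
  finally show ?thesis .
qed

text \<open>
  Restricted to numbers without prime factors above \<open>N\<close>, \<open>gap s\<close> has finite support, so that the Euler
  product applies before summability is known.
\<close>
lemma sum_gap_le: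
  assumes "finite X" "X \<subseteq> {1..N}"
  shows "sum (gap s) X \<le> (\<Prod>p\<in>primes_upto N. 1 + (\<Sum>k\<in>{h<..<2*h}. real p powr - (real k * s)))"
proof -
  define smooth where "smooth = (\<lambda>n. n > 0 \<and> (\<forall>p. prime p \<longrightarrow> p dvd n \<longrightarrow> p \<le> N))"
  define f where "f = (\<lambda>n. if smooth n then gap s n else 0)"
  have smooth_mult: "smooth (m * n) \<longleftrightarrow> smooth m \<and> smooth n" for m n
    by (auto simp: smooth_def prime_dvd_mult_iff)
  have mult: "f (m * n) = f m * f n" if "coprime m n" for m n
    using gap_mult[OF that, of s] by (simp add: f_def smooth_mult)
  \<comment> \<open>Finite support: the primes of such an \<open>n\<close> divide
    \<open>fact N\<close>, and its exponents stay below \<open>2 * h\<close>.\<close>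
  have "n \<in> {d. d dvd fact N ^ (2 * h)}" if "f n \<noteq> 0" for n
  proof -
    have n: "smooth n" "gap_full n" using that by (auto simp: f_def gap_def split: if_splits)
    have "n dvd fact N ^ (2 * h)"
    proof (rule multiplicity_le_imp_dvd)
      fix p :: nat assume p: "prime p"
      show "multiplicity p n \<le> multiplicity p (fact N ^ (2 * h))"
      proof (cases "p dvd n")
        case True
        hence "p \<le> N" using n p by (auto simp: smooth_def)
        hence "p dvd fact N" using p by (simp add: prime_dvd_fact_iff)
        hence "multiplicity p (fact N) \<ge> 1"
          using p by (intro multiplicity_geI) auto
        hence "2 * h * 1 \<le> 2 * h * multiplicity p (fact N)" by (intro mult_left_mono) auto
        moreover have "multiplicity p n \<le> 2 * h" using n p by (auto simp: gap_full_def intro: less_imp_le dest!: spec[of _ p])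
        ultimately have "multiplicity p n \<le> 2 * h * multiplicity p (fact N)" by linarith
        thus ?thesis using p by (simp add: prime_elem_multiplicity_power_distrib)
      qed (simp add: not_dvd_imp_multiplicity_0)
    qed (use n in \<open>auto simp: smooth_def\<close>)
    thus ?thesis by simp
  qed
  hence supp: "{n. f n \<noteq> 0} \<subseteq> {d. d dvd fact N ^ (2 * h)}" by blast
  have fin: "finite {n. f n \<noteq> 0}"
    by (rule finite_subset[OF supp]) simp
  have summ: "f summable_on A" for A
    using fin by (intro finite_nonzero_values_imp_summable_on) (rule finite_subset[rotated], auto)
  have f1: "f 1 = 1" using gap_1[of s] by (auto simp: f_def smooth_def)
  have "sum (gap s) X = sum f X"
  proof (rule sum.cong)
    fix n assume "n \<in> X"
    hence n: "n \<ge> 1" "n \<le> N" using assms by auto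
    hence "smooth n" unfolding smooth_def by (auto dest!: dvd_imp_le)
    thus "gap s n = f n" by (simp add: f_def)
  qed auto
  also have "\<dots> = infsum f X" using assms by simp
  also have "\<dots> \<le> infsum f {0<..}"
    using assms by (intro infsum_mono2 summ) (auto simp: f_def gap_nonneg)
  also have "\<dots> = (\<Prod>p\<in>primes_upto N. \<Sum>\<^sub>\<infinity>k. f (p ^ k)) * infsum f (coprime_part (primes_upto N))"
    by (rule infsum_coprime_part_finite) (auto simp: mult summ primes_upto_def)
  \<comment> \<open>Only 1 is coprime to all primes up to \<open>N\<close> and at the same time free
    of larger primes.\<close>
  also have "infsum f (coprime_part (primes_upto N)) = infsum f {1}"
  proof (rule infsum_cong_neutral)
    fix n assume n: "n \<in> coprime_part (primes_upto N) - {1}"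
    then obtain p where p: "prime p" "p dvd n" using prime_factor_nat[of n] by auto
    hence "\<not> p \<le> N" using n by (auto simp: coprime_part_def primes_upto_def)
    thus "f n = 0" using p by (auto simp: f_def smooth_def)
  qed (auto simp: coprime_part_def primes_upto_def)
  also have "infsum f {1} = 1" using f1 by simp
  also have "(\<Prod>p\<in>primes_upto N. \<Sum>\<^sub>\<infinity>k. f (p ^ k)) * 1 = (\<Prod>p\<in>primes_upto N. \<Sum>\<^sub>\<infinity>k. gap s (p ^ k))"
  proof -
    have "f (p ^ k) = gap s (p ^ k)" if "p \<in> primes_upto N" for p k
    proof -
      have "q \<le> N" if "prime q" "q dvd p ^ k" for q
        using that \<open>p \<in> primes_upto N\<close> prime_dvd_power[of q p k] primes_dvd_imp_eq[of q p]
        by (auto simp: primes_upto_def)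
      hence "smooth (p ^ k)" using that
        by (auto simp: smooth_def primes_upto_def prime_gt_0_nat)
      thus ?thesis by (simp add: f_def)
    qed
    thus ?thesis by simp
  qed
  also have "\<dots> = (\<Prod>p\<in>primes_upto N. 1 + (\<Sum>k\<in>{h<..<2*h}. real p powr - (real k * s)))"
    by (intro prod.cong refl gap_prime_power_sum) (auto simp: primes_upto_def)
  finally show ?thesis .
qed

text \<open>The smallest positive exponent is \<open>h + 1\<close>, so each Euler factor is at most
  \<open>1 + h * p powr - t <= exp (h * p powr - t)\<close> with \<open>t = (h + 1) * s > 1\<close>.
  The products, and hence all finite partial sums, are bounded uniformly in
  \<open>N\<close>.\<close>

lemma summable_gap:
  assumes "s > 1 / (real h + 1)"
  shows "gap s summable_on A"
proof -
  define t where "t = (real h + 1) * s"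
  have s0: "s > 0" using assms by (auto intro: less_trans[rotated])
  have t: "t > 1" using assms by (simp add: t_def field_simps)
  have summ: "summable (\<lambda>n. real h * real n powr - t)"
    using t by (intro summable_mult) (simp add: summable_real_powr_iff)
  have "gap s summable_on {0<..}"
  proof (rule nonneg_bdd_above_summable_on)
    show "bdd_above (sum (gap s) ` {F. F \<subseteq> {0<..} \<and> finite F})"
    proof (rule bdd_aboveI2)
      fix F assume F: "F \<in> {F. F \<subseteq> {0::nat<..} \<and> finite F}"
      define N where "N = Max (insert 1 F)"
      have "F \<subseteq> {1..N}" using F by (auto simp: N_def Suc_le_eq)
      hence "sum (gap s) F \<le> (\<Prod>p\<in>primes_upto N. 1 + (\<Sum>k\<in>{h<..<2*h}. real p powr - (real k * s)))"
        using F by (intro sum_gap_le) auto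
      also have "\<dots> \<le> (\<Prod>p\<in>primes_upto N. exp (real h * real p powr - t))"
      proof (rule prod_mono, intro conjI)
        fix p assume p: "p \<in> primes_upto N"
        have p1: "real p \<ge> 1" using p by (auto simp: primes_upto_def Suc_le_eq prime_gt_0_nat)
        show "0 \<le> 1 + (\<Sum>k\<in>{h<..<2*h}. real p powr - (real k * s))" by (intro add_nonneg_nonneg sum_nonneg) auto
        have "(\<Sum>k\<in>{h<..<2*h}. real p powr - (real k * s)) \<le> (\<Sum>k\<in>{h<..<2*h}. real p powr - t)"
        proof (intro sum_mono powr_mono p1)
          fix k assume "k \<in> {h<..<2*h}"
          hence "real h + 1 \<le> real k" by auto
          thus "- (real k * s) \<le> - t" unfolding t_def using s0 by (simp add: mult_right_mono)
        qed
        also have "\<dots> = real (h - 1) * real p powr - t" by simp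
        also have "\<dots> \<le> real h * real p powr - t" by (intro mult_right_mono) auto
        also have "1 + real h * real p powr - t \<le> exp (real h * real p powr - t)" by (rule exp_ge_add_one_self)
        finally show "1 + (\<Sum>k\<in>{h<..<2*h}. real p powr - (real k * s)) \<le> exp (real h * real p powr - t)" by simp
      qed
      also have "\<dots> = exp (\<Sum>p\<in>primes_upto N. real h * real p powr - t)" by (simp add: exp_sum)
      also have "\<dots> \<le> exp (\<Sum>n. real h * real n powr - t)"
        by (subst exp_le_cancel_iff, intro sum_le_suminf summ) auto
      finally show "sum (gap s) F \<le> exp (\<Sum>n. real h * real n powr - t)" .
    qed
  qed (auto simp: gap_nonneg)
  hence "gap s summable_on (A \<inter> {0<..})" by (rule summable_on_subset) auto
  moreover have "gap s summable_on A \<longleftrightarrow> gap s summable_on (A \<inter> {0<..})"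
    by (rule summable_on_cong_neutral) (auto simp: gap_def gap_full_def)
  ultimately show ?thesis by blast
qed

text \<open>
  Among the \<open>h\<close>-full numbers, \<open>coprime_density p\<close> is the proportion not divisible by \<open>p\<close> and
  \<open>divisor_ratio p\<close>, the sum of \<open>p powr - (k / h)\<close> over \<open>k \<ge> h\<close>, is the ratio of those divisible by \<open>p\<close>
  to those that are not.
\<close>
definition gamma_factor :: "nat \<Rightarrow> real" where
  "gamma_factor p = 1 + (real p - real p powr (1 / real h)) / ((real p)\<^sup>2 * (real p powr (1 / real h) - 1))"

definition divisor_ratio :: "nat \<Rightarrow> real" where
  "divisor_ratio p = 1 / (real p - real p powr (1 - 1 / real h))"

definition coprime_density :: "nat \<Rightarrow> real" where
  "coprime_density p = 1 / (1 + divisor_ratio p)"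

text \<open>In terms of \<open>v = p powr - (1 / h)\<close>, with \<open>v ^ h = 1 / p\<close>, the
  local factors below become rational functions of \<open>p\<close> and \<open>v\<close>.\<close>

lemma prime_root:
  assumes "prime p"
  defines "v \<equiv> real p powr - (1 / real h)"
  shows "0 < v" "v < 1" "v ^ h = 1 / real p" "real p powr (1 / real h) = 1 / v"
    "real p powr - (real k / real h) = v ^ k" "real p powr (1 - 1 / real h) = real p * v"
proof -
  have p: "real p > 1" using prime_gt_1_nat[OF assms(1)] by simp
  have h0: "real h > 0" using h_ge_2 by simp
  show 0: "0 < v" using p by (simp add: v_def)
  show "v < 1" unfolding v_def using p h0 by (simp add: powr_less_one)
  show *: "real p powr - (real k / real h) = v ^ k" for k
    unfolding v_def using p by (simp add: powr_realpow [symmetric] powr_powr)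
  have "v ^ h = real p powr - (real h / real h)" using *[of h] by simp
  thus "v ^ h = 1 / real p" using p h0 by (simp add: powr_minus_divide)
  show "real p powr (1 / real h) = 1 / v" unfolding v_def using p by (simp add: powr_minus_divide)
  show "real p powr (1 - 1 / real h) = real p * v"
    unfolding v_def using p by (simp add: powr_diff powr_minus_divide)
qed

text \<open>A geometric sum of \<open>v ^ k\<close> over \<open>h < k < 2 * h\<close>. This is where
  the shape of the factors of \<open>gamma0\<close> comes from.\<close>

lemma gamma_factor_eq:
  assumes "prime p"
  shows "(\<Sum>\<^sub>\<infinity>k. gap (1 / real h) (p ^ k)) = gamma_factor p"
proof -
  define v where "v = real p powr - (1 / real h)"
  note v = prime_root[OF assms, folded v_def]
  have p: "real p > 1" using prime_gt_1_nat[OF assms] by simp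
  have "{h<..<2*h} = {Suc h..2*h-1}" by auto
  hence "(\<Sum>k\<in>{h<..<2*h}. real p powr - (real k * (1 / real h))) = (\<Sum>k\<in>{Suc h..2*h-1}. v ^ k)"
    using v(5) by simp
  also have "(\<Sum>k\<in>{Suc h..2*h-1}. v ^ k) = (v ^ Suc h - v ^ (2 * h)) / (1 - v)"
  proof -
    have "\<not> 2 * h - 1 < Suc h" "Suc (2 * h - 1) = 2 * h" "v \<noteq> 1" using h_ge_2 v(2) by auto
    thus ?thesis by (simp only: sum_gp if_False)
  qed
  also have "\<dots> = (v / real p - 1 / (real p)\<^sup>2) / (1 - v)"
    using v(3) by (simp add: power_mult mult.commute[of 2] power_divide)
  also have "\<dots> = (real p - 1 / v) / ((real p)\<^sup>2 * (1 / v - 1))"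
    using v(1,2) p by (simp add: divide_simps power2_eq_square)
  finally show ?thesis unfolding gamma_factor_def using v(4) by (simp add: gap_prime_power_sum[OF assms])
qed

text \<open>The core is the fifth relation. The local factor of all \<open>h\<close>-full numbers at
  exponent \<open>1 / h\<close> is \<open>1 + divisor_ratio p\<close>; through
  \<open>a ^ h * b\<close> it is also the geometric series \<open>1 / (1 - 1 / p)\<close> for
  \<open>a\<close> times \<open>gamma_factor p\<close> for \<open>b\<close>.\<close>

lemma density_relations:
  assumes "prime p"
  shows "divisor_ratio p > 0" "gamma_factor p > 0" "coprime_density p > 0" "coprime_density p < 1" "1 - 1 / real p = coprime_density p * gamma_factor p"
    "divisor_ratio p = (1 / real p) / (1 - real p powr - (1 / real h))"
proof -
  define v where "v = real p powr - (1 / real h)"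
  note v = prime_root[OF assms, folded v_def]
  have p: "real p > 1" using prime_gt_1_nat[OF assms] by simp
  have b: "divisor_ratio p = 1 / (real p * (1 - v))" unfolding divisor_ratio_def v(6) by (simp add: algebra_simps)
  thus "divisor_ratio p = (1 / real p) / (1 - real p powr - (1 / real h))" by (simp add: v_def)
  show b0: "divisor_ratio p > 0" unfolding b using p v by simp
  thus "coprime_density p > 0" "coprime_density p < 1" by (auto simp: coprime_density_def)
  have "gamma_factor p = 1 + (real p - 1 / v) / ((real p)\<^sup>2 * (1 / v - 1))" unfolding gamma_factor_def v(4) ..
  also have "(real p - 1 / v) / ((real p)\<^sup>2 * (1 / v - 1)) = (v / real p - 1 / (real p)\<^sup>2) / (1 - v)"
    using v(1,2) p by (simp add: divide_simps power2_eq_square)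
  also have "1 + \<dots> = (1 - 1 / real p) * (1 + divisor_ratio p)"
    unfolding b using v(1,2) p by (simp add: divide_simps power2_eq_square) (simp add: algebra_simps)
  finally have g: "gamma_factor p = (1 - 1 / real p) * (1 + divisor_ratio p)" .
  thus "gamma_factor p > 0" using b0 p by simp
  show "1 - 1 / real p = coprime_density p * gamma_factor p" unfolding g coprime_density_def using b0 by simp
qed

definition gap_sum :: real where "gap_sum = infsum (gap (1 / real h)) {0<..}"

lemma inv_h_gt: "1 / real h > 1 / (real h + 1)"
  using h_ge_2 by (intro divide_strict_left_mono) auto

lemma gap_sum_pos: "gap_sum > 0"
proof -
  have "infsum (gap (1 / real h)) {1} \<le> gap_sum" unfolding gap_sum_def
    by (intro infsum_mono2 summable_gap inv_h_gt) (auto simp: gap_nonneg)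
  thus ?thesis using gap_1 by simp
qed

lemma gamma0_eq: "gamma0 h = gap_sum"
proof -
  let ?F = "\<lambda>p. if prime p then gamma_factor p else 1"
  have "(\<lambda>N. \<Prod>p\<in>primes_upto N. \<Sum>\<^sub>\<infinity>k. gap (1 / real h) (p ^ k)) \<longlonglongrightarrow> gap_sum"
    unfolding gap_sum_def by (intro euler_product_tendsto gap_mult summable_gap inv_h_gt gap_1)
  also have "(\<lambda>N. \<Prod>p\<in>primes_upto N. \<Sum>\<^sub>\<infinity>k. gap (1 / real h) (p ^ k)) = (\<lambda>N. \<Prod>p\<le>N. ?F p)"
  proof
    fix N
    show "(\<Prod>p\<in>primes_upto N. \<Sum>\<^sub>\<infinity>k. gap (1 / real h) (p ^ k)) = (\<Prod>p\<le>N. ?F p)"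
      by (rule prod.mono_neutral_cong_left) (auto simp: primes_upto_def gamma_factor_eq)
  qed
  \<comment> \<open>Convergence of an infinite product includes a nonzero limit, which is supplied
    by \<open>gap_sum_pos\<close>.\<close>
  finally have "?F has_prod gap_sum"
    using gap_sum_pos unfolding has_prod_def raw_has_prod_def add_0_right by auto
  hence "gap_sum = prodinf ?F" by (rule has_prod_unique)
  thus ?thesis unfolding gamma0_def gamma_factor_def by simp
qed

text \<open>This is the leading constant of \<open>hcount_asymp\<close>: the product over
  \<open>S\<close> is the density of admissible \<open>a\<close>, the sum runs over admissible
  \<open>b\<close>, and the local factors at \<open>S\<close> combine to
  \<open>coprime_density\<close>.\<close>

lemma infsum_gap_coprime_part:
  assumes "finite S" "\<And>p. p \<in> S \<Longrightarrow> prime p"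
  shows "(\<Prod>p\<in>S. 1 - 1 / real p) * infsum (gap (1 / real h)) (coprime_part S) = gap_sum * (\<Prod>p\<in>S. coprime_density p)"
proof -
  have "gap_sum = (\<Prod>p\<in>S. \<Sum>\<^sub>\<infinity>k. gap (1 / real h) (p ^ k)) * infsum (gap (1 / real h)) (coprime_part S)"
    unfolding gap_sum_def using assms by (intro infsum_coprime_part_finite gap_mult summable_gap inv_h_gt)
  also have "(\<Prod>p\<in>S. \<Sum>\<^sub>\<infinity>k. gap (1 / real h) (p ^ k)) = (\<Prod>p\<in>S. gamma_factor p)"
    using assms by (intro prod.cong refl gamma_factor_eq) auto
  finally have "gap_sum = (\<Prod>p\<in>S. gamma_factor p) * infsum (gap (1 / real h)) (coprime_part S)" .
  moreover have "(\<Prod>p\<in>S. 1 - 1 / real p) = (\<Prod>p\<in>S. coprime_density p) * (\<Prod>p\<in>S. gamma_factor p)"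
    unfolding prod.distrib [symmetric] using assms by (intro prod.cong refl density_relations) auto
  ultimately show ?thesis by simp
qed

end

section \<open>Counting h-full numbers coprime to given primes\<close>

text \<open>Legendre's sieve: adding a prime \<open>q\<close> subtracts the count at
  \<open>z / q\<close>, so each prime doubles the error. The growth is harmless, as the moments need
  at most two primes.\<close>

lemma card_coprime_part_upto:
  assumes "finite S" "\<And>p. p \<in> S \<Longrightarrow> prime p" "z \<ge> 0"
  shows "\<bar>real (card {a \<in> coprime_part S. real a \<le> z}) - z * (\<Prod>p\<in>S. 1 - 1 / real p)\<bar> \<le> 2 ^ card S"
  using assms
proof (induction S arbitrary: z rule: finite_induct)
  case empty
  have "{a \<in> coprime_part {}. real a \<le> z} = upto_real z" by (auto simp: coprime_part_def upto_real_def)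
  also have "card \<dots> = nat \<lfloor>z\<rfloor>" by (simp add: upto_real_eq)
  finally show ?case using empty by simp linarith
next
  case (insert q S)
  have q: "prime q" "real q > 1" using insert.prems prime_gt_1_nat[of q] by auto
  let ?A = "\<lambda>S z. {a \<in> coprime_part S. real a \<le> z}"
  have fin: "finite (?A T y)" for T y
    by (rule finite_subset[OF _ finite_upto_real[of y]]) (auto simp: coprime_part_def upto_real_def)
  have div: "p dvd q * a \<longleftrightarrow> p dvd a" if "p \<in> S" for p a
    using that q insert.hyps insert.prems by (metis insertCI prime_dvd_mult_iff primes_dvd_imp_eq)
  have le: "real c \<le> z / real q \<longleftrightarrow> real (q * c) \<le> z" for c
    using q by (simp add: field_simps)
  have "?A S z = ?A (insert q S) z \<union> (\<lambda>a. q * a) ` ?A S (z / real q)"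
  proof (intro set_eqI iffI)
    fix a assume a: "a \<in> ?A S z"
    show "a \<in> ?A (insert q S) z \<union> (\<lambda>a. q * a) ` ?A S (z / real q)"
    proof (cases "q dvd a")
      case True
      then obtain c where c: "a = q * c" by (elim dvdE)
      have "c \<in> ?A S (z / real q)" using a q unfolding c
        by (auto simp: coprime_part_def div le)
      thus ?thesis unfolding c by blast
    qed (use a in \<open>auto simp: coprime_part_def\<close>)
  next
    fix a assume "a \<in> ?A (insert q S) z \<union> (\<lambda>a. q * a) ` ?A S (z / real q)"
    thus "a \<in> ?A S z"
    proof
      assume "a \<in> (\<lambda>a. q * a) ` ?A S (z / real q)"
      then obtain c where c: "a = q * c" "c \<in> ?A S (z / real q)" by blast
      thus ?thesis using q by (auto simp: coprime_part_def div le)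
    qed (auto simp: coprime_part_def)
  qed
  moreover have "?A (insert q S) z \<inter> (\<lambda>a. q * a) ` ?A S (z / real q) = {}"
    by (auto simp: coprime_part_def)
  ultimately have "card (?A S z) = card (?A (insert q S) z) + card ((\<lambda>a. q * a) ` ?A S (z / real q))"
    using fin by (simp only: card_Un_disjoint finite_imageI)
  also have "card ((\<lambda>a. q * a) ` ?A S (z / real q)) = card (?A S (z / real q))"
    using q by (intro card_image) (auto simp: inj_on_def)
  finally have eq: "real (card (?A (insert q S) z)) = real (card (?A S z)) - real (card (?A S (z / real q)))"
    by simp
  define P where "P = (\<Prod>p\<in>S. 1 - 1 / real p)"
  have "\<bar>real (card (?A S z)) - z * P\<bar> \<le> 2 ^ card S"
    unfolding P_def using insert.prems by (intro insert.IH) auto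
  moreover have "\<bar>real (card (?A S (z / real q))) - (z / real q) * P\<bar> \<le> 2 ^ card S"
    unfolding P_def using insert.prems by (intro insert.IH) auto
  moreover have "\<bar>u - v - (u' - v')\<bar> \<le> e + e" if "\<bar>u - u'\<bar> \<le> e" "\<bar>v - v'\<bar> \<le> e" for u u' v v' e :: real
    using that by linarith
  ultimately have "\<bar>real (card (?A (insert q S) z)) - (z * P - (z / real q) * P)\<bar> \<le> 2 ^ card S + 2 ^ card S"
    unfolding eq by blast
  moreover have "z * P - (z / real q) * P = z * (\<Prod>p\<in>insert q S. 1 - 1 / real p)"
    using insert.hyps by (simp add: P_def algebra_simps)
  moreover have "card (insert q S) = Suc (card S)" using insert.hyps by simp
  ultimately show ?case by simp
qed

lemma powr_le_iff_base:
  fixes u v e :: real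
  assumes "0 \<le> u" "0 \<le> v" "0 < e"
  shows "u powr e \<le> v powr e \<longleftrightarrow> u \<le> v"
  using assms powr_mono2[of e u v] powr_less_mono2[of e v u] by (cases "u \<le> v") auto

context hfull
begin

text \<open>The total exponent of a prime modulo \<open>h\<close> determines its exponent in
  \<open>b\<close>, because the admissible exponents lie in distinct residue classes; the exponent
  in \<open>a\<close> follows.\<close>

lemma gap_full_decomposition_unique:
  assumes "a > 0" "a' > 0" "gap_full b" "gap_full b'" "a ^ h * b = a' ^ h * b'"
  shows "a = a' \<and> b = b'"
proof -
  have b: "b > 0" "b' > 0" using assms by (auto simp: gap_full_def)
  have mult: "multiplicity p a = multiplicity p a' \<and> multiplicity p b = multiplicity p b'" if p: "prime p" for p
  proof -
    let ?\<alpha> = "multiplicity p a" and ?\<alpha>' = "multiplicity p a'" and ?\<beta> = "multiplicity p b" and ?\<beta>' = "multiplicity p b'"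
    have "multiplicity p (a ^ h * b) = h * ?\<alpha> + ?\<beta>" "multiplicity p (a' ^ h * b') = h * ?\<alpha>' + ?\<beta>'"
      using p assms(1,2) b by (simp_all add: prime_elem_multiplicity_mult_distrib prime_elem_multiplicity_power_distrib)
    hence eq: "h * ?\<alpha> + ?\<beta> = h * ?\<alpha>' + ?\<beta>'" using assms(5) by simp
    have \<beta>: "?\<beta> = 0 \<or> h < ?\<beta> \<and> ?\<beta> < 2 * h" "?\<beta>' = 0 \<or> h < ?\<beta>' \<and> ?\<beta>' < 2 * h"
      using assms(3,4) p unfolding gap_full_def by blast+
    have m: "x mod h = (if x = 0 then 0 else x - h)" if "x = 0 \<or> h < x \<and> x < 2 * h" for x
    proof (cases "x = 0")
      case False
      hence "x mod h = (x - h) mod h" using that by (simp add: le_mod_geq)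
      moreover have "x - h < h" using False that by linarith
      ultimately show ?thesis using False by simp
    qed simp
    have "?\<beta> mod h = ?\<beta>' mod h" using arg_cong[OF eq, of "\<lambda>x. x mod h"] by simp
    hence "?\<beta> = ?\<beta>'" using m[OF \<beta>(1)] m[OF \<beta>(2)] \<beta> by (auto split: if_splits)
    thus ?thesis using eq h_ge_2 by simp
  qed
  have "a = a'" by (rule multiplicity_eq_nat[OF assms(1,2)]) (simp add: mult)
  moreover have "b = b'" by (rule multiplicity_eq_nat[OF b]) (simp add: mult)
  ultimately show ?thesis ..
qed

lemma gap_full_decomposition_exists:
  assumes n: "h_full h n"
  obtains a b where "a > 0" "gap_full b" "n = a ^ h * b" "a dvd n" "b dvd n"
proof -
  define e where "e = (\<lambda>p. multiplicity p n)"
  \<comment> \<open>If \<open>h\<close> does not divide the exponent, one copy of \<open>h\<close>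
    is moved from the power of \<open>a\<close> to the remainder, so that the exponent in
    \<open>b\<close> exceeds \<open>h\<close>. Being \<open>h\<close>-full guarantees that there is
    a copy to move.\<close>
  define \<beta> where "\<beta> = (\<lambda>p. if h dvd e p then 0 else h + e p mod h)"
  define \<alpha> where "\<alpha> = (\<lambda>p. if h dvd e p then e p div h else e p div h - 1)"
  define a where "a = (\<Prod>p\<in>prime_factors n. p ^ \<alpha> p)"
  define b where "b = (\<Prod>p\<in>prime_factors n. p ^ \<beta> p)"
  have n0: "n > 0" using n by (simp add: h_full_def)
  have e: "e p = 0 \<or> e p \<ge> h" if "prime p" for p
  proof (cases "p dvd n")
    case True
    hence "p \<in> prime_factors n" using that n0 by (intro prime_factorsI) auto
    thus ?thesis using n by (auto simp: h_full_def e_def)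
  qed (simp add: e_def not_dvd_imp_multiplicity_0)
  have e0: "e p = 0" if "prime p" "p \<notin> prime_factors n" for p
  proof -
    have "\<not> p dvd n" using that n0 by (auto intro: prime_factorsI)
    thus ?thesis by (simp add: e_def not_dvd_imp_multiplicity_0)
  qed
  have pos: "a > 0" "b > 0" unfolding a_def b_def by (auto intro!: prod_pos simp: prime_factors_gt_0_nat)
  have ma: "multiplicity p a = \<alpha> p" if "prime p" for p
  proof -
    have "multiplicity p a = (if p \<in> prime_factors n then \<alpha> p else 0)"
      unfolding a_def by (rule multiplicity_prod_prime_powers) (use that in auto)
    thus ?thesis using e0[OF that] by (simp add: \<alpha>_def)
  qed
  have mb: "multiplicity p b = \<beta> p" if "prime p" for p
  proof -
    have "multiplicity p b = (if p \<in> prime_factors n then \<beta> p else 0)"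
      unfolding b_def by (rule multiplicity_prod_prime_powers) (use that in auto)
    thus ?thesis using e0[OF that] by (simp add: \<beta>_def)
  qed
  have sum: "h * \<alpha> p + \<beta> p = e p" if "prime p" for p
  proof (cases "h dvd e p")
    case False
    hence "e p \<ge> h" using e[OF that] by auto
    hence "e p div h \<ge> 1" using h_ge_2 by (simp add: div_greater_zero_iff Suc_le_eq)
    hence "h * (e p div h - 1) + h = h * (e p div h)" by (simp add: diff_mult_distrib2)
    moreover have "h * (e p div h) + e p mod h = e p" by simp
    ultimately have "h * (e p div h - 1) + (h + e p mod h) = e p" by linarith
    thus ?thesis using False by (simp add: \<alpha>_def \<beta>_def)
  qed (simp add: \<alpha>_def \<beta>_def)
  have gap: "gap_full b"
    unfolding gap_full_def
  proof (intro conjI allI impI pos)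
    fix p :: nat assume p: "prime p"
    show "multiplicity p b = 0 \<or> h < multiplicity p b \<and> multiplicity p b < 2 * h"
    proof (cases "h dvd e p")
      case False
      hence "e p mod h > 0" "e p mod h < h" using h_ge_2 by (auto simp: dvd_eq_mod_eq_0)
      thus ?thesis using False by (simp add: mb[OF p] \<beta>_def)
    qed (simp add: mb[OF p] \<beta>_def)
  qed
  have eq: "n = a ^ h * b"
  proof (rule multiplicity_eq_nat)
    fix p :: nat assume p: "prime p"
    have "multiplicity p (a ^ h * b) = h * multiplicity p a + multiplicity p b"
      using p pos by (simp add: prime_elem_multiplicity_mult_distrib prime_elem_multiplicity_power_distrib)
    thus "multiplicity p n = multiplicity p (a ^ h * b)" using sum[OF p] ma[OF p] mb[OF p] by (simp add: e_def)
  qed (use n0 pos in auto)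
  have "a dvd a ^ h" using h_ge_2 by (intro dvd_power) auto
  hence "a dvd n" unfolding eq by (rule dvd_mult2)
  moreover have "b dvd n" unfolding eq by simp
  ultimately show ?thesis using that pos gap eq by blast
qed

lemma h_full_gap_product:
  assumes "a > 0" "gap_full b"
  shows "h_full h (a ^ h * b)"
  unfolding h_full_def
proof (intro conjI ballI)
  have b: "b > 0" using assms by (simp add: gap_full_def)
  show "0 < a ^ h * b" using assms b by simp
  fix p assume p: "p \<in> prime_factors (a ^ h * b)"
  hence pp: "prime p" by auto
  have "multiplicity p (a ^ h * b) = h * multiplicity p a + multiplicity p b"
    using pp assms b by (simp add: prime_elem_multiplicity_mult_distrib prime_elem_multiplicity_power_distrib)
  moreover have "multiplicity p (a ^ h * b) > 0" using p by (simp add: prime_factors_multiplicity)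
  moreover have "multiplicity p b = 0 \<or> h < multiplicity p b" using assms pp by (auto simp: gap_full_def)
  ultimately show "h \<le> multiplicity p (a ^ h * b)" by (cases "multiplicity p a") auto
qed

definition hcount :: "nat set \<Rightarrow> real \<Rightarrow> nat" where
  "hcount S y = card {n \<in> coprime_part S. h_full h n \<and> real n \<le> y}"

text \<open>Fixing \<open>b\<close> first leaves a range of consecutive integers for
  \<open>a\<close>, to which the sieve applies. A product \<open>a ^ h * b\<close> avoids the primes
  of \<open>S\<close> exactly when both \<open>a\<close> and \<open>b\<close> do.\<close>

lemma hcount_eq_sum:
  assumes S: "\<And>p. p \<in> S \<Longrightarrow> prime p" and "y \<ge> 0"
  shows "hcount S y = (\<Sum>b | b \<in> coprime_part S \<and> gap_full b \<and> real b \<le> y.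
            card {a \<in> coprime_part S. real a \<le> (y / real b) powr (1 / real h)})"
proof -
  let ?B = "{b. b \<in> coprime_part S \<and> gap_full b \<and> real b \<le> y}"
  let ?A = "\<lambda>b. {a \<in> coprime_part S. real a \<le> (y / real b) powr (1 / real h)}"
  have fin: "finite ?B"
    by (rule finite_subset[OF _ finite_upto_real[of y]]) (auto simp: coprime_part_def upto_real_def)
  have finA: "finite (?A b)" for b
    by (rule finite_subset[OF _ finite_upto_real[of "(y / real b) powr (1 / real h)"]])
       (auto simp: coprime_part_def upto_real_def)
  have iff: "real a \<le> (y / real b) powr (1 / real h) \<longleftrightarrow> real (a ^ h * b) \<le> y" if "a > 0" "b > 0" for a b :: nat
  proof -
    have h0: "real h > 0" using h_ge_2 by simp
    have "real (a ^ h * b) \<le> y \<longleftrightarrow> real a powr real h \<le> y / real b"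
      using that by (simp add: powr_realpow pos_le_divide_eq)
    also have "\<dots> \<longleftrightarrow> (real a powr real h) powr (1 / real h) \<le> (y / real b) powr (1 / real h)"
      using that h0 \<open>y \<ge> 0\<close> by (intro powr_le_iff_base[symmetric]) auto
    also have "(real a powr real h) powr (1 / real h) = real a" using h0 that by (simp add: powr_powr)
    finally show ?thesis by simp
  qed
  have "bij_betw (\<lambda>(b, a). a ^ h * b) (Sigma ?B ?A) {n \<in> coprime_part S. h_full h n \<and> real n \<le> y}"
    unfolding bij_betw_def
  proof
    show "inj_on (\<lambda>(b, a). a ^ h * b) (Sigma ?B ?A)"
      by (rule inj_onI) (use gap_full_decomposition_unique in \<open>auto simp: coprime_part_def\<close>)
    show "(\<lambda>(b, a). a ^ h * b) ` Sigma ?B ?A = {n \<in> coprime_part S. h_full h n \<and> real n \<le> y}"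
    proof (intro set_eqI iffI)
      fix n assume "n \<in> (\<lambda>(b, a). a ^ h * b) ` Sigma ?B ?A"
      then obtain a b where ab: "n = a ^ h * b" "b \<in> ?B" "a \<in> ?A b" by auto
      have pos: "a > 0" "b > 0" "gap_full b" using ab by (auto simp: coprime_part_def)
      have "\<not> p dvd n" if "p \<in> S" for p
        using ab(2,3) S[OF that] that prime_dvd_power[of p a h]
        unfolding ab(1) by (auto simp: coprime_part_def prime_dvd_mult_iff)
      moreover have "real n \<le> y" using ab pos iff by auto
      ultimately show "n \<in> {n \<in> coprime_part S. h_full h n \<and> real n \<le> y}"
        using h_full_gap_product[OF pos(1,3)] ab(1) pos by (auto simp: coprime_part_def)
    next
      fix n assume n: "n \<in> {n \<in> coprime_part S. h_full h n \<and> real n \<le> y}"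
      then obtain a b where ab: "a > 0" "gap_full b" "n = a ^ h * b" "a dvd n" "b dvd n"
        using gap_full_decomposition_exists by blast
      have b: "b > 0" using ab by (simp add: gap_full_def)
      have "a \<in> coprime_part S" "b \<in> coprime_part S"
        using n ab b by (auto simp: coprime_part_def intro: dvd_trans)
      moreover have "real b \<le> real n" using ab(5) n by (auto simp: coprime_part_def dest: dvd_imp_le)
      hence "real b \<le> y" using n by auto
      moreover have "real a \<le> (y / real b) powr (1 / real h)"
        using iff[OF ab(1) b] n unfolding ab(3) [symmetric] by simp
      ultimately have "(b, a) \<in> Sigma ?B ?A" using ab(2) by simp
      thus "n \<in> (\<lambda>(b, a). a ^ h * b) ` Sigma ?B ?A" using ab(3) by force
    qed
  qed
  hence "hcount S y = card (Sigma ?B ?A)" unfolding hcount_def by (rule bij_betw_same_card [symmetric])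
  also have "\<dots> = (\<Sum>b\<in>?B. card (?A b))" using fin finA by (intro card_SigmaI) auto
  finally show ?thesis .
qed

text \<open>Any exponent strictly between \<open>1 / (h + 1)\<close> and \<open>1 / h\<close> would do.\<close>
definition err_exponent :: real where "err_exponent = (1 / real h + 1 / (real h + 1)) / 2"

lemma err_exponent_bounds: "err_exponent > 1 / (real h + 1)" "err_exponent < 1 / real h" "err_exponent > 0"
proof -
  show *: "err_exponent > 1 / (real h + 1)" "err_exponent < 1 / real h" using inv_h_gt by (auto simp: err_exponent_def)
  have "1 / (real h + 1) > 0" by simp
  thus "err_exponent > 0" using *(1) by linarith
qed

text \<open>Sum the sieve estimate over \<open>b <= y\<close>. The sieve errors cost
  \<open>2 ^ card S\<close> for each such \<open>b\<close>, and completing the sum over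
  \<open>b\<close> to a full series costs its tail. Rankin's trick bounds both by the series at
  \<open>err_exponent\<close>, which yields the two summands of \<open>1 + 2 ^ card S\<close>;
  nothing else depends on \<open>S\<close>.\<close>

lemma hcount_asymp:
  assumes S: "finite S" "\<And>p. p \<in> S \<Longrightarrow> prime p" and y: "y > 0"
  shows "\<bar>real (hcount S y) - gap_sum * (\<Prod>p\<in>S. coprime_density p) * y powr (1 / real h)\<bar>
            \<le> (1 + 2 ^ card S) * infsum (gap err_exponent) {0<..} * y powr err_exponent"
proof -
  define P where "P = (\<Prod>p\<in>S. 1 - 1 / real p)"
  have P: "0 \<le> P" "P \<le> 1"
    unfolding P_def using S(2) by (auto intro!: prod_nonneg prod_le_1 simp: prime_gt_0_nat Suc_le_eq)
  define E where "E = infsum (gap err_exponent) {0<..}"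
  define B where "B = {b. b \<in> coprime_part S \<and> gap_full b \<and> real b \<le> y}"
  define T where "T = {b. b \<in> coprime_part S \<and> real b > y}"
  have fin: "finite B" unfolding B_def
    by (rule finite_subset[OF _ finite_upto_real[of y]]) (auto simp: coprime_part_def upto_real_def)
  have summs: "gap err_exponent summable_on A" "gap (1 / real h) summable_on A" for A
    using err_exponent_bounds inv_h_gt by (auto intro!: summable_gap)
  have B0: "b > 0" "real b \<le> y" "gap_full b" if "b \<in> B" for b
    using that by (auto simp: B_def coprime_part_def)
  have cardB: "real (card B) \<le> E * y powr err_exponent"
  proof -
    have "real (card B) = (\<Sum>b\<in>B. 1)" by simp
    \<comment> \<open>Rankin's trick: for \<open>b <= y\<close> the factor
      \<open>(y / b) powr err_exponent\<close> is at least 1.\<close>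
    also have "\<dots> \<le> (\<Sum>b\<in>B. gap err_exponent b * y powr err_exponent)"
    proof (rule sum_mono)
      fix b assume b: "b \<in> B"
      have "real b powr err_exponent \<le> y powr err_exponent" using B0[OF b] err_exponent_bounds by (intro powr_mono2) auto
      thus "1 \<le> gap err_exponent b * y powr err_exponent" using B0[OF b] by (simp add: gap_def powr_minus field_simps)
    qed
    also have "\<dots> = infsum (gap err_exponent) B * y powr err_exponent" using fin by (simp add: sum_distrib_right)
    also have "\<dots> \<le> E * y powr err_exponent" unfolding E_def
      using B0 by (intro mult_right_mono infsum_mono2 summs) (auto simp: gap_nonneg)
    finally show ?thesis .
  qed
  have tail: "infsum (gap (1 / real h)) T * y powr (1 / real h) \<le> E * y powr err_exponent"
  proof -
    \<comment> \<open>Rankin's trick in the other direction: for \<open>b > y\<close> the negative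
      power \<open>err_exponent - 1 / h\<close> of \<open>b\<close> is at most that of
      \<open>y\<close>.\<close>
    have "infsum (gap (1 / real h)) T \<le> infsum (\<lambda>b. y powr (err_exponent - 1 / real h) * gap err_exponent b) T"
    proof (intro infsum_mono summs summable_on_cmult_right)
      fix b assume b: "b \<in> T"
      have b0: "real b > 0" using b y by (auto simp: T_def)
      have "real b powr (err_exponent - 1 / real h) \<le> y powr (err_exponent - 1 / real h)"
        using b y err_exponent_bounds by (intro powr_mono2') (auto simp: T_def)
      hence "real b powr (err_exponent - 1 / real h) * real b powr - err_exponent \<le> y powr (err_exponent - 1 / real h) * real b powr - err_exponent"
        by (intro mult_right_mono) auto
      thus "gap (1 / real h) b \<le> y powr (err_exponent - 1 / real h) * gap err_exponent b"
        by (auto simp: gap_def powr_add [symmetric])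
    qed
    also have "\<dots> = y powr (err_exponent - 1 / real h) * infsum (gap err_exponent) T"
      by (rule infsum_cmult_right) (rule summs)
    also have "\<dots> \<le> y powr (err_exponent - 1 / real h) * E"
      unfolding E_def by (intro mult_left_mono infsum_mono2 summs) (auto simp: gap_nonneg T_def coprime_part_def)
    finally have "infsum (gap (1 / real h)) T * y powr (1 / real h) \<le> y powr (err_exponent - 1 / real h) * E * y powr (1 / real h)"
      by (intro mult_right_mono) auto
    also have "\<dots> = E * y powr err_exponent" using y by (simp add: powr_diff)
    finally show ?thesis .
  qed
  have "coprime_part S = {b \<in> coprime_part S. real b \<le> y} \<union> T" by (auto simp: T_def)
  hence "infsum (gap (1 / real h)) (coprime_part S) = infsum (gap (1 / real h)) {b \<in> coprime_part S. real b \<le> y} + infsum (gap (1 / real h)) T"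
    by (metis (no_types, lifting) T_def disjoint_iff infsum_Un_disjoint linorder_not_le mem_Collect_eq summs(2))
  also have "infsum (gap (1 / real h)) {b \<in> coprime_part S. real b \<le> y} = infsum (gap (1 / real h)) B"
    by (rule infsum_cong_neutral) (auto simp: B_def gap_def)
  also have "\<dots> = sum (gap (1 / real h)) B" using fin by simp
  finally have G: "P * infsum (gap (1 / real h)) (coprime_part S) = P * (sum (gap (1 / real h)) B + infsum (gap (1 / real h)) T)" by simp
  also have "P * infsum (gap (1 / real h)) (coprime_part S) = gap_sum * (\<Prod>p\<in>S. coprime_density p)"
    unfolding P_def by (rule infsum_gap_coprime_part[OF S])
  finally have G: "gap_sum * (\<Prod>p\<in>S. coprime_density p) * y powr (1 / real h) 
     = P * (sum (gap (1 / real h)) B * y powr (1 / real h)) + P * (infsum (gap (1 / real h)) T * y powr (1 / real h))"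
    by (simp add: algebra_simps)
  let ?z = "\<lambda>b. (y / real b) powr (1 / real h)"
  have "real (hcount S y) = (\<Sum>b\<in>B. real (card {a \<in> coprime_part S. real a \<le> ?z b}))"
    using S y by (subst hcount_eq_sum) (auto simp: B_def)
  moreover have "\<bar>(\<Sum>b\<in>B. real (card {a \<in> coprime_part S. real a \<le> ?z b})) - (\<Sum>b\<in>B. ?z b * P)\<bar> \<le> (\<Sum>b\<in>B. 2 ^ card S)"
    unfolding sum_subtractf [symmetric] P_def
    by (intro order.trans[OF sum_abs] sum_mono card_coprime_part_upto S) auto
  moreover have "(\<Sum>b\<in>B. 2 ^ card S) \<le> 2 ^ card S * (E * y powr err_exponent)"
    using cardB by (simp add: mult.commute)
  moreover have "(\<Sum>b\<in>B. ?z b * P) = P * (sum (gap (1 / real h)) B * y powr (1 / real h))"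
    unfolding sum_distrib_right sum_distrib_left
    using y by (intro sum.cong refl) (auto simp: gap_def powr_divide powr_minus_divide dest: B0)
  moreover have "P * (infsum (gap (1 / real h)) T * y powr (1 / real h)) \<in> {0..E * y powr err_exponent}"
  proof -
    have nn: "infsum (gap (1 / real h)) T * y powr (1 / real h) \<ge> 0"
      by (intro mult_nonneg_nonneg infsum_nonneg) (auto simp: gap_nonneg)
    have "P * (infsum (gap (1 / real h)) T * y powr (1 / real h)) \<le> 1 * (infsum (gap (1 / real h)) T * y powr (1 / real h))"
      using P(2) nn by (rule mult_right_mono)
    moreover have "P * (infsum (gap (1 / real h)) T * y powr (1 / real h)) \<ge> 0"
      using P(1) nn by (rule mult_nonneg_nonneg)
    ultimately show ?thesis using tail unfolding atLeastAtMost_iff by linarith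
  qed
  ultimately have "\<bar>real (hcount S y) - gap_sum * (\<Prod>p\<in>S. coprime_density p) * y powr (1 / real h)\<bar>
      \<le> 2 ^ card S * (E * y powr err_exponent) + E * y powr err_exponent"
    unfolding G atLeastAtMost_iff by linarith
  thus ?thesis by (simp add: E_def algebra_simps)
qed

end

section \<open>Prime powers with exponent at least h\<close>

lemma has_sum_geometric_from:
  fixes t :: real
  assumes "0 \<le> t" "t < 1"
  shows "((\<lambda>k. t ^ k) has_sum t ^ j / (1 - t)) {j..}"
proof -
  have "((\<lambda>k. t ^ k) has_sum 1 / (1 - t)) UNIV"
    using infsum_geometric[OF assms] by (simp add: has_sum_iff)
  hence "((\<lambda>k. t ^ j * t ^ k) has_sum t ^ j * (1 / (1 - t))) UNIV" by (rule has_sum_cmult_right)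
  moreover have "((\<lambda>k. t ^ j * t ^ k) has_sum t ^ j * (1 / (1 - t))) UNIV \<longleftrightarrow> ((\<lambda>k. t ^ k) has_sum t ^ j * (1 / (1 - t))) {j..}"
    by (rule has_sum_reindex_bij_witness[of _ "\<lambda>k. k - j" "\<lambda>k. k + j"]) (auto simp: power_add mult_ac)
  ultimately show ?thesis by simp
qed

lemma has_sum_Sigma_nonneg:
  fixes f :: "_ \<Rightarrow> real"
  assumes "\<And>x. x \<in> A \<Longrightarrow> ((\<lambda>y. f (x, y)) has_sum g x) (B x)" "(g has_sum S) A"
    "\<And>x y. x \<in> A \<Longrightarrow> y \<in> B x \<Longrightarrow> f (x, y) \<ge> 0"
  shows "(f has_sum S) (Sigma A B)"
proof -
  have g: "g summable_on A" using assms(2) by (rule has_sum_imp_summable)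
  have "f summable_on Sigma A B"
    by (rule summable_on_SigmaI[OF assms(1) g]) (use assms(3) in auto)
  with assms(1,2) show ?thesis by (rule has_sum_SigmaI)
qed

definition prime_powers_from :: "nat \<Rightarrow> nat set" where
  "prime_powers_from j = (\<lambda>(p, k). p ^ k) ` ({p. prime p} \<times> {j..})"

lemma prime_powers_fromE:
  assumes "n \<in> prime_powers_from j"
  obtains p k where "prime p" "j \<le> k" "n = p ^ k"
  using assms by (auto simp: prime_powers_from_def)

lemma prime_powers_fromI: "prime p \<Longrightarrow> j \<le> k \<Longrightarrow> p ^ k \<in> prime_powers_from j"
  by (auto simp: prime_powers_from_def)

lemma inj_on_prime_power:
  assumes "j \<ge> 1"
  shows "inj_on (\<lambda>(p :: nat, k). p ^ k) ({p. prime p} \<times> {j..})"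
proof (rule inj_onI, clarsimp)
  fix p q k l :: nat assume *: "prime p" "prime q" "j \<le> k" "j \<le> l" "p ^ k = q ^ l"
  have "aprimedivisor (p ^ k) = p" "aprimedivisor (q ^ l) = q"
    using * assms by (intro aprimedivisor_prime_power; simp)+
  hence "p = q" using *(5) by simp
  moreover have "k = l" using *(5) power_inject_exp[OF prime_gt_1_nat[OF *(2)], of k l] unfolding \<open>p = q\<close> by simp
  ultimately show "p = q \<and> k = l" by simp
qed

lemma prime_powr_less_1:
  assumes "prime p" "s > 0"
  shows "0 < real p powr - s" "real p powr - s < 1" "real p powr - s \<le> 2 powr - s"
    "1 / (1 - real p powr - s) \<le> 1 / (1 - 2 powr - s)"
proof -
  have p: "real p \<ge> 2" using prime_ge_2_nat[OF assms(1)] by simp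
  show "0 < real p powr - s" "real p powr - s < 1" using p assms by (auto simp: powr_less_one)
  show *: "real p powr - s \<le> 2 powr - s" using p assms by (intro powr_mono2') auto
  have "2 powr - s < (1::real)" using assms by (simp add: powr_less_one)
  thus "1 / (1 - real p powr - s) \<le> 1 / (1 - 2 powr - s)" using * by (intro divide_left_mono mult_pos_pos) auto
qed

lemma has_sum_prime_powers:
  assumes p: "prime p" and "s > 0"
  shows "((\<lambda>k. real (p ^ k) powr - s) has_sum (real p powr - s) ^ j / (1 - real p powr - s)) {j..}"
proof -
  have eq: "real (p ^ k) powr - s = (real p powr - s) ^ k" for k
    using prime_gt_0_nat[OF p] by (simp add: powr_realpow [symmetric] powr_powr mult_ac)
  show ?thesis unfolding eq by (rule has_sum_geometric_from) (use prime_powr_less_1[OF assms] in auto)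
qed

lemma prime_power_sum_bound:
  assumes p: "prime p" and s: "s > 0"
  shows "(real p powr - s) ^ j / (1 - real p powr - s) \<in> {0..1 / (1 - 2 powr - s) * real p powr - (real j * s)}"
proof -
  have eq: "(real p powr - s) ^ j = real p powr - (real j * s)"
    using prime_gt_0_nat[OF p] by (simp add: powr_realpow [symmetric] powr_powr mult_ac)
  have "real p powr - (real j * s) * (1 / (1 - real p powr - s)) \<le> real p powr - (real j * s) * (1 / (1 - 2 powr - s))"
    using prime_powr_less_1[OF assms] by (intro mult_left_mono) auto
  thus ?thesis unfolding eq using prime_powr_less_1[OF assms] by (simp add: mult.commute)
qed

lemma summable_on_primes_powr:
  assumes "t > 1"
  shows "(\<lambda>p::nat. C * real p powr - t) summable_on {p. prime p}"
  by (intro summable_on_cmult_right summable_on_nat_comparison[of "\<lambda>n. real n powr - t"])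
     (use assms in \<open>auto simp: summable_real_powr_iff\<close>)

lemma summable_on_prime_powers_from:
  assumes "s > 0" "j \<ge> 1" "real j * s > 1"
  shows "(\<lambda>n. real n powr - s) summable_on prime_powers_from j"
proof -
  have "(\<lambda>p::nat. (real p powr - s) ^ j / (1 - real p powr - s)) summable_on {p. prime p}"
    using prime_power_sum_bound assms
    by (intro summable_on_comparison_test[OF summable_on_primes_powr[OF assms(3), of "1 / (1 - 2 powr - s)"]]) auto
  hence "(\<lambda>x. real (case x of (p, k) \<Rightarrow> p ^ k) powr - s) summable_on ({p. prime p} \<times> {j..})"
    by (intro summable_on_SigmaI[where g = "\<lambda>p. (real p powr - s) ^ j / (1 - real p powr - s)"])
       (use has_sum_prime_powers assms in auto)
  thus ?thesis unfolding prime_powers_from_def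
    by (subst summable_on_reindex[OF inj_on_prime_power[OF assms(2)]]) (simp add: o_def)
qed

section \<open>The weight of exact prime powers\<close>

context hfull
begin

text \<open>For \<open>n = p ^ k\<close> this is the proportion of \<open>h\<close>-full numbers
  whose exact power of \<open>p\<close> is \<open>p ^ k\<close>: the cofactor ranges up to
  \<open>x / p ^ k\<close>, hence the power of \<open>n\<close>, and must be prime to
  \<open>p\<close>, hence the density.\<close>

definition h_weight :: "nat \<Rightarrow> real" where
  "h_weight n = (if n \<in> prime_powers_from h then coprime_density (aprimedivisor n) * real n powr - (1 / real h) else 0)"

text \<open>The value of \<open>p * divisor_ratio p\<close> at \<open>p = 2\<close>, which is its
  maximum over the primes.\<close>

definition ratio_bound :: real where "ratio_bound = 1 / (1 - 2 powr - (1 / real h))"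

lemma h_pos: "real h > 0" "h \<ge> 1" using h_ge_2 by auto

lemma ratio_bound_pos: "ratio_bound > 0"
proof -
  have "2 powr - (1 / real h) < (1::real)" using h_pos by (simp add: powr_less_one)
  thus ?thesis by (simp add: ratio_bound_def)
qed

lemma divisor_ratio_le: "prime p \<Longrightarrow> divisor_ratio p \<le> ratio_bound / real p"
proof -
  assume p: "prime p"
  have "(1 / real p) * (1 / (1 - real p powr - (1 / real h))) \<le> (1 / real p) * ratio_bound"
    unfolding ratio_bound_def using p h_pos by (intro mult_left_mono prime_powr_less_1) auto
  thus ?thesis using density_relations(6)[OF p] by (simp add: mult.commute)
qed

lemma coprime_density_bounds:
  assumes "prime p"
  shows "1 - coprime_density p \<in> {0..ratio_bound / real p}" "coprime_density p \<ge> 1 / (1 + ratio_bound)"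
proof -
  note b = density_relations[OF assms] divisor_ratio_le[OF assms]
  have "1 - coprime_density p = divisor_ratio p / (1 + divisor_ratio p)" using b(1) by (simp add: coprime_density_def field_simps)
  moreover have "divisor_ratio p / (1 + divisor_ratio p) \<le> divisor_ratio p / 1" using b(1) by (intro divide_left_mono) auto
  ultimately show "1 - coprime_density p \<in> {0..ratio_bound / real p}" using b by auto
  have "ratio_bound / real p \<le> ratio_bound / 1" using ratio_bound_pos prime_ge_1_nat[OF assms] by (intro divide_left_mono) auto
  hence "divisor_ratio p \<le> ratio_bound" using b by simp
  thus "coprime_density p \<ge> 1 / (1 + ratio_bound)" unfolding coprime_density_def using b(1) by (intro divide_left_mono mult_pos_pos) auto
qed

lemma aprimedivisor_prime_powers_from:
  assumes "n \<in> prime_powers_from h"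
  shows "prime (aprimedivisor n)" "n > 1"
proof -
  from assms obtain p k where pk: "prime p" "h \<le> k" "n = p ^ k" by (rule prime_powers_fromE)
  thus "prime (aprimedivisor n)" using h_pos by (simp add: aprimedivisor_prime_power)
  show "n > 1" unfolding pk(3) using pk h_pos by (intro one_less_power prime_gt_1_nat) auto
qed

lemma h_weight_nonneg: "h_weight n \<ge> 0"
  using density_relations(3)[OF aprimedivisor_prime_powers_from(1)[of n]] by (cases "n \<in> prime_powers_from h") (simp_all add: h_weight_def)

lemma h_weight_le: "h_weight n \<le> real n powr - (1 / real h)"
  using density_relations(3,4)[OF aprimedivisor_prime_powers_from(1)[of n]]
  by (cases "n \<in> prime_powers_from h") (simp_all add: h_weight_def mult_left_le_one_le)

lemma h_weight_prime_power:
  assumes "prime p" "k \<ge> h"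
  shows "h_weight (p ^ k) = coprime_density p * real (p ^ k) powr - (1 / real h)"
  using assms h_pos by (simp add: h_weight_def prime_powers_fromI aprimedivisor_prime_power)

lemma h_weight_prime_power_h: "prime p \<Longrightarrow> h_weight (p ^ h) = coprime_density p / real p"
  using h_weight_prime_power[of p h] h_pos prime_gt_0_nat[of p]
  by (simp add: powr_realpow [symmetric] powr_powr powr_minus_divide)

lemma has_sum_h_weight_prime:
  assumes "prime p" "j \<ge> h"
  shows "((\<lambda>k. h_weight (p ^ k)) has_sum coprime_density p * ((real p powr - (1 / real h)) ^ j / (1 - real p powr - (1 / real h)))) {j..}"
proof -
  have "((\<lambda>k. coprime_density p * real (p ^ k) powr - (1 / real h)) has_sum coprime_density p * ((real p powr - (1 / real h)) ^ j / (1 - real p powr - (1 / real h)))) {j..}"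
    using assms h_pos by (intro has_sum_cmult_right has_sum_prime_powers) auto
  thus ?thesis
    by (rule has_sum_cong[THEN iffD1, rotated]) (use assms h_weight_prime_power in auto)
qed

text \<open>The \<open>h\<close>-th powers carry all divergence, with weight
  \<open>coprime_density p / p\<close>, while the exponents above \<open>h\<close> form a convergent
  series.\<close>

lemma prime_powers_from_h_split: "prime_powers_from h = (\<lambda>p. p ^ h) ` {p. prime p} \<union> prime_powers_from (Suc h)" "(\<lambda>p. p ^ h) ` {p. prime p} \<inter> prime_powers_from (Suc h) = {}"
proof -
  have "({p. prime p} :: nat set) \<times> {h..} = {p. prime p} \<times> {h} \<union> {p. prime p} \<times> {Suc h..}" by auto
  hence "prime_powers_from h = (\<lambda>(p, k). p ^ k) ` ({p. prime p} \<times> {h}) \<union> prime_powers_from (Suc h)"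
    unfolding prime_powers_from_def by (simp add: image_Un)
  also have "(\<lambda>(p, k). p ^ k) ` ({p. prime p} \<times> {h}) = (\<lambda>p. p ^ h) ` ({p. prime p} :: nat set)" by force
  finally show "prime_powers_from h = (\<lambda>p. p ^ h) ` {p. prime p} \<union> prime_powers_from (Suc h)" .
  show "(\<lambda>p. p ^ h) ` {p. prime p} \<inter> prime_powers_from (Suc h) = {}"
  proof (rule ccontr)
    assume "(\<lambda>p. p ^ h) ` {p. prime p} \<inter> prime_powers_from (Suc h) \<noteq> {}"
    then obtain p n where p: "prime p" "n = p ^ h" "n \<in> prime_powers_from (Suc h)" by auto
    then obtain q k where q: "prime q" "Suc h \<le> k" "n = q ^ k" by (auto elim: prime_powers_fromE)
    have "(p, h) = (q, k)"
      by (rule inj_onD[OF inj_on_prime_power[OF h_pos(2)]]) (use p q in auto)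
    thus False using q by simp
  qed
qed

definition hroot :: "nat \<Rightarrow> nat" where "hroot N = nat \<lfloor>real N powr (1 / real h)\<rfloor>"

lemma le_hroot: "p \<le> hroot N \<longleftrightarrow> p ^ h \<le> N"
proof -
  have "p \<le> hroot N \<longleftrightarrow> real p \<le> real N powr (1 / real h)"
    by (simp add: hroot_def le_nat_iff le_floor_iff)
  also have "real p = (real (p ^ h)) powr (1 / real h)"
    using h_pos by (cases "p = 0") (simp_all add: powr_realpow [symmetric] powr_powr)
  also have "real (p ^ h) powr (1 / real h) \<le> real N powr (1 / real h) \<longleftrightarrow> real (p ^ h) \<le> real N"
    by (rule powr_le_iff_base) (use h_pos in auto)
  finally show ?thesis by simp
qed

lemma hroot_power: "hroot (M ^ h) = M"
proof (rule order.antisym)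
  have "hroot (M ^ h) ^ h \<le> M ^ h" using le_hroot by blast
  thus "hroot (M ^ h) \<le> M" using h_pos by (simp add: power_mono_iff)
qed (simp add: le_hroot)

lemma sum_h_weight_split:
  "(\<Sum>n\<in>{1..N}. h_weight n * g n) = (\<Sum>p\<in>primes_upto (hroot N). coprime_density p / real p * g (p ^ h))
      + (\<Sum>n\<in>{1..N} \<inter> prime_powers_from (Suc h). h_weight n * g n)"
proof -
  have "(\<Sum>n\<in>{1..N}. h_weight n * g n) = (\<Sum>n\<in>{1..N} \<inter> prime_powers_from h. h_weight n * g n)"
    by (rule sum.mono_neutral_right) (auto simp: h_weight_def)
  also have "{1..N} \<inter> prime_powers_from h = (\<lambda>p. p ^ h) ` primes_upto (hroot N) \<union> ({1..N} \<inter> prime_powers_from (Suc h))"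
    unfolding prime_powers_from_h_split(1) by (auto simp: primes_upto_def le_hroot Suc_le_eq prime_gt_0_nat)
  also have "(\<Sum>n\<in>\<dots>. h_weight n * g n) = (\<Sum>n\<in>(\<lambda>p. p ^ h) ` primes_upto (hroot N). h_weight n * g n) + (\<Sum>n\<in>{1..N} \<inter> prime_powers_from (Suc h). h_weight n * g n)"
    by (rule sum.union_disjoint) (use prime_powers_from_h_split(2) in \<open>auto simp: primes_upto_def\<close>)
  also have "(\<Sum>n\<in>(\<lambda>p. p ^ h) ` primes_upto (hroot N). h_weight n * g n) = (\<Sum>p\<in>primes_upto (hroot N). coprime_density p / real p * g (p ^ h))"
    using h_pos by (subst sum.reindex) (auto simp: inj_on_def primes_upto_def power_eq_iff_eq_base h_weight_prime_power_h intro!: sum.cong)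
  finally show ?thesis .
qed

lemma summable_prime_powers_from_Suc: "(\<lambda>n. real n powr - err_exponent) summable_on prime_powers_from (Suc h)"
proof (rule summable_on_prime_powers_from)
  have "(real h + 1) * err_exponent > (real h + 1) * (1 / (real h + 1))"
    using err_exponent_bounds by (intro mult_strict_left_mono) auto
  thus "1 < real (Suc h) * err_exponent" by (simp add: add.commute)
qed (use err_exponent_bounds in auto)

lemma summable_h_weight_Suc: "h_weight summable_on prime_powers_from (Suc h)"
proof (rule summable_on_comparison_test[OF summable_prime_powers_from_Suc])
  fix n assume "n \<in> prime_powers_from (Suc h)"
  hence "n > 1" using prime_powers_from_h_split(1) aprimedivisor_prime_powers_from by blast
  hence "real n powr - (1 / real h) \<le> real n powr - err_exponent" using err_exponent_bounds by (intro powr_mono) auto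
  thus "h_weight n \<le> real n powr - err_exponent" using h_weight_le[of n] by linarith
qed (rule h_weight_nonneg)

text \<open>\<open>ln (p ^ h)\<close> brings a factor \<open>h\<close>, but only primes up to the
  \<open>h\<close>-th root of \<open>N\<close> occur, so Mertens' theorem gives
  \<open>h * (ln N / h)\<close>. The bound \<open>K\<close> collects Mertens' error, the deviation
  of \<open>coprime_density p\<close> from 1, which is of order \<open>1 / p\<close>, the rounding
  of the root, and the exponents above \<open>h\<close>.\<close>

lemma log_weight_h_weight: obtains K where "log_weight h_weight K"
proof -
  obtain K0 where K0: "\<And>n. n \<ge> 1 \<Longrightarrow> \<bar>(\<Sum>p\<in>primes_upto n. ln (real p) / real p) - ln (real n)\<bar> \<le> K0"
    by (rule Mertens_first) auto
  define S where "S = (\<Sum>d. ln (real d) / (real d * (real d - 1)))"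
  define \<delta> where "\<delta> = 1 / real h - err_exponent"
  have \<delta>: "\<delta> > 0" using err_exponent_bounds by (simp add: \<delta>_def)
  define R where "R = infsum (\<lambda>n. real n powr - err_exponent) (prime_powers_from (Suc h)) / \<delta>"
  have "log_weight h_weight (real h * K0 + real h * ratio_bound * S + real h + R)"
  proof
    show "h_weight n \<ge> 0" for n by (rule h_weight_nonneg)
    show "h_weight n = 0" if "n \<le> 1" for n using that aprimedivisor_prime_powers_from(2)[of n] by (auto simp: h_weight_def)
    fix N :: nat assume N: "N \<ge> 1"
    define m where "m = hroot N"
    have m: "m \<ge> 1" using le_hroot[of 1 N] N by (simp add: m_def)
    have 1: "(\<Sum>n\<in>{1..N} \<inter> prime_powers_from (Suc h). h_weight n * ln (real n)) \<in> {0..R}"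
    proof -
      have "(\<Sum>n\<in>{1..N} \<inter> prime_powers_from (Suc h). h_weight n * ln (real n)) \<le> (\<Sum>n\<in>{1..N} \<inter> prime_powers_from (Suc h). real n powr - err_exponent / \<delta>)"
      proof (rule sum_mono)
        fix n assume n: "n \<in> {1..N} \<inter> prime_powers_from (Suc h)"
        have "ln (real n) \<le> real n powr \<delta> / \<delta>" using n \<delta> by (intro ln_powr_bound) auto
        hence "h_weight n * ln (real n) \<le> real n powr - (1 / real h) * (real n powr \<delta> / \<delta>)"
          using h_weight_le[of n] n by (intro mult_mono) auto
        also have "\<dots> = real n powr - err_exponent / \<delta>" by (simp add: powr_add [symmetric] \<delta>_def)
        finally show "h_weight n * ln (real n) \<le> real n powr - err_exponent / \<delta>" .
      qed
      also have "\<dots> = (\<Sum>n\<in>{1..N} \<inter> prime_powers_from (Suc h). real n powr - err_exponent) / \<delta>" by (simp add: sum_divide_distrib)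
      also have "\<dots> \<le> R" unfolding R_def using \<delta>
        by (intro divide_right_mono finite_sum_le_infsum summable_prime_powers_from_Suc) auto
      finally show ?thesis by (auto intro!: sum_nonneg mult_nonneg_nonneg h_weight_nonneg)
    qed
    define A where "A = (\<Sum>p\<in>primes_upto m. ln (real p) / real p)"
    define B where "B = (\<Sum>p\<in>primes_upto m. (1 - coprime_density p) * (ln (real p) / real p))"
    have 2: "(\<Sum>p\<in>primes_upto m. coprime_density p / real p * ln (real (p ^ h))) = real h * A - real h * B"
      unfolding A_def B_def sum_distrib_left sum_subtractf [symmetric]
      by (rule sum.cong) (auto simp: primes_upto_def prime_gt_0_nat ln_realpow field_simps)
    have 3: "B \<in> {0..ratio_bound * S}"
    proof -
      have "B \<le> (\<Sum>p\<in>primes_upto m. ratio_bound * (ln (real p) / (real p * (real p - 1))))"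
        unfolding B_def
      proof (rule sum_mono)
        fix p assume "p \<in> primes_upto m"
        hence p: "prime p" "real p \<ge> 2" using prime_ge_2_nat by (auto simp: primes_upto_def)
        have "(1 - coprime_density p) * (ln (real p) / real p) \<le> (ratio_bound / real p) * (ln (real p) / real p)"
          using coprime_density_bounds[OF p(1)] p by (intro mult_right_mono) auto
        also have "\<dots> = ratio_bound * (ln (real p) / (real p * real p))" by simp
        also have "\<dots> \<le> ratio_bound * (ln (real p) / (real p * (real p - 1)))"
          using ratio_bound_pos p by (intro mult_left_mono divide_left_mono mult_pos_pos) auto
        finally show "(1 - coprime_density p) * (ln (real p) / real p) \<le> ratio_bound * (ln (real p) / (real p * (real p - 1)))" .
      qed
      also have "\<dots> = ratio_bound * (\<Sum>p\<in>primes_upto m. ln (real p) / (real p * (real p - 1)))" by (simp add: sum_distrib_left)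
      also have "\<dots> \<le> ratio_bound * S" unfolding S_def using ratio_bound_pos
        by (intro mult_left_mono sum_le_suminf summable_ln_over_square ballI ln_over_square_nonneg) auto
      finally have "B \<le> ratio_bound * S" .
      moreover have "B \<ge> 0" unfolding B_def
        using coprime_density_bounds(1) by (intro sum_nonneg mult_nonneg_nonneg divide_nonneg_nonneg) (auto simp: primes_upto_def Suc_le_eq prime_gt_0_nat)
      ultimately show ?thesis by simp
    qed
    have 4: "real h * ln (real m) \<in> {ln (real N) - real h..ln (real N)}"
    proof -
      have "ln (real N powr (1 / real h)) - ln (real m) \<in> {0..1}"
        unfolding m_def hroot_def using N h_pos by (intro ln_floor_diff) (simp add: ge_one_powr_ge_zero)
      moreover have "ln (real N powr (1 / real h)) = ln (real N) / real h" using N by (simp add: ln_powr)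
      ultimately have "real h * (ln (real N) / real h - ln (real m)) \<le> real h * 1"
         "real h * (ln (real N) / real h - ln (real m)) \<ge> 0"
        using h_pos by (intro mult_left_mono mult_nonneg_nonneg; simp)+
      thus ?thesis using h_pos by (simp add: right_diff_distrib)
    qed
    have 5: "\<bar>real h * A - real h * ln (real m)\<bar> \<le> real h * K0"
      using K0[OF m] h_pos unfolding A_def right_diff_distrib [symmetric] abs_mult by (simp add: mult_left_mono)
    have 6: "real h * B \<in> {0..real h * ratio_bound * S}"
      using 3 h_pos mult_left_mono[of B "ratio_bound * S" "real h"] by (auto simp: mult.assoc)
    have "(\<Sum>k\<in>{1..N}. h_weight k * ln (real k)) = real h * A - real h * B + (\<Sum>n\<in>{1..N} \<inter> prime_powers_from (Suc h). h_weight n * ln (real n))"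
      unfolding sum_h_weight_split m_def [symmetric] 2 ..
    thus "\<bar>(\<Sum>k\<in>{1..N}. h_weight k * ln (real k)) - ln (real N)\<bar> \<le> real h * K0 + real h * ratio_bound * S + real h + R"
      using 1 4 5 6 unfolding atLeastAtMost_iff by linarith
  qed
  thus ?thesis by (rule that)
qed

text \<open>The proportion of \<open>h\<close>-full numbers divisible by \<open>p\<close>, that is,
  the total of \<open>h_weight (p ^ k)\<close> over \<open>k >= h\<close>.\<close>

definition divisor_density :: "nat \<Rightarrow> real" where
  "divisor_density p = 1 / (real p - real p powr (1 - 1 / real h) + 1)"

text \<open>The third and fourth relations identify the terms of the two series in
  \<open>D1\<close>; by the fifth, their difference is simply
  \<open>divisor_density p - 1 / p\<close>, the correction from the primes to the
  \<open>h\<close>-full numbers.\<close>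

lemma divisor_density_eqs:
  assumes "prime p"
  shows "divisor_density p = coprime_density p * divisor_ratio p" "divisor_density p \<in> {0..ratio_bound / real p}"
    "1 / (real p powr ((real h + 1) / real h - 1) * (real p - real p powr (1 - 1 / real h) + 1)) = real p powr - (1 / real h) * divisor_density p"
    "1 / (real p powr (2 * real h / real h - 1) * (real p - real p powr (1 - 1 / real h) + 1)) = divisor_density p / real p"
    "real p powr - (1 / real h) * divisor_density p - divisor_density p / real p = divisor_density p - 1 / real p"
proof -
  define d where "d = real p - real p powr (1 - 1 / real h)"
  have b: "divisor_ratio p = 1 / d" by (simp add: divisor_ratio_def d_def)
  have d: "d > 0" using density_relations(1)[OF assms] unfolding b by simp
  have p: "real p > 1" using prime_gt_1_nat[OF assms] by simp
  have a: "divisor_density p = 1 / (d + 1)" by (simp add: divisor_density_def d_def)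
  show eq: "divisor_density p = coprime_density p * divisor_ratio p" unfolding a b coprime_density_def using d by (simp add: field_simps)
  have "coprime_density p * divisor_ratio p \<le> 1 * divisor_ratio p" using density_relations[OF assms] by (intro mult_right_mono) auto
  thus "divisor_density p \<in> {0..ratio_bound / real p}" using divisor_ratio_le[OF assms] density_relations[OF assms] unfolding eq by auto
  have "(real h + 1) / real h - 1 = 1 / real h" using h_pos by (simp add: field_simps)
  thus "1 / (real p powr ((real h + 1) / real h - 1) * (real p - real p powr (1 - 1 / real h) + 1)) = real p powr - (1 / real h) * divisor_density p"
    unfolding divisor_density_def by (simp add: powr_minus_divide)
  have "2 * real h / real h - 1 = 1" using h_pos by simp
  thus "1 / (real p powr (2 * real h / real h - 1) * (real p - real p powr (1 - 1 / real h) + 1)) = divisor_density p / real p"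
    unfolding divisor_density_def using p by simp
  define v where "v = real p powr - (1 / real h)"
  note v = prime_root[OF assms, folded v_def]
  have "d = real p * (1 - v)" unfolding d_def v(6) by (simp add: algebra_simps)
  hence "v * (1 / (d + 1)) - (1 / (d + 1)) / real p = 1 / (d + 1) - 1 / real p"
    using d p by (simp add: divide_simps) (simp add: algebra_simps)
  thus "real p powr - (1 / real h) * divisor_density p - divisor_density p / real p = divisor_density p - 1 / real p"
    unfolding a v_def .
qed

lemma L_series_diff:
  "L_series h (real h + 1) - L_series h (2 * real h) = (\<Sum>\<^sub>\<infinity>p\<in>{p. prime p}. divisor_density p - 1 / real p)"
  "(\<lambda>p. divisor_density p - 1 / real p) summable_on {p. prime p}"
proof -
  have s1: "(\<lambda>p. real p powr - (1 / real h) * divisor_density p) summable_on {p. prime p}"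
  proof (rule summable_on_comparison_test[OF summable_on_primes_powr[of "1 + 1 / real h" ratio_bound]])
    fix p :: nat assume "p \<in> {p. prime p}"
    hence p: "prime p" "real p > 0" by (auto simp: prime_gt_0_nat)
    have "real p powr - (1 / real h) * divisor_density p \<le> real p powr - (1 / real h) * (ratio_bound / real p)"
      using divisor_density_eqs(2)[OF p(1)] by (intro mult_left_mono) auto
    also have "\<dots> = ratio_bound * real p powr - (1 + 1 / real h)" using p by (simp add: powr_diff powr_minus field_simps)
    finally show "real p powr - (1 / real h) * divisor_density p \<le> ratio_bound * real p powr - (1 + 1 / real h)" .
    show "0 \<le> real p powr - (1 / real h) * divisor_density p" using divisor_density_eqs(2)[OF p(1)] by simp
  qed (use h_pos in auto)
  have s2: "(\<lambda>p. divisor_density p / real p) summable_on {p. prime p}"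
  proof (rule summable_on_comparison_test[OF summable_on_primes_powr[of 2 ratio_bound]])
    fix p :: nat assume "p \<in> {p. prime p}"
    hence p: "prime p" "real p > 0" by (auto simp: prime_gt_0_nat)
    have "divisor_density p / real p \<le> ratio_bound / real p / real p"
      using divisor_density_eqs(2)[OF p(1)] p by (intro divide_right_mono) auto
    also have "\<dots> = ratio_bound * real p powr - 2" using p by (simp add: powr_minus powr_numeral power2_eq_square field_simps)
    finally show "divisor_density p / real p \<le> ratio_bound * real p powr - 2" .
    show "0 \<le> divisor_density p / real p" using divisor_density_eqs(2)[OF p(1)] by simp
  qed auto
  have 1: "L_series h (real h + 1) = (\<Sum>\<^sub>\<infinity>p\<in>{p. prime p}. real p powr - (1 / real h) * divisor_density p)"
    unfolding L_series_def by (rule infsum_cong) (use divisor_density_eqs(3) in auto)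
  have 2: "L_series h (2 * real h) = (\<Sum>\<^sub>\<infinity>p\<in>{p. prime p}. divisor_density p / real p)"
    unfolding L_series_def by (rule infsum_cong) (use divisor_density_eqs(4) in auto)
  have "((\<lambda>p. real p powr - (1 / real h) * divisor_density p - divisor_density p / real p) has_sum (L_series h (real h + 1) - L_series h (2 * real h))) {p. prime p}"
    using has_sum_add[OF has_sum_infsum[OF s1] has_sum_uminusI[OF has_sum_infsum[OF s2]]] unfolding 1 2 by simp
  hence "((\<lambda>p. divisor_density p - 1 / real p) has_sum (L_series h (real h + 1) - L_series h (2 * real h))) {p. prime p}"
    by (rule has_sum_cong[THEN iffD1, rotated]) (use divisor_density_eqs(5) in auto)
  thus "L_series h (real h + 1) - L_series h (2 * real h) = (\<Sum>\<^sub>\<infinity>p\<in>{p. prime p}. divisor_density p - 1 / real p)"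
    "(\<lambda>p. divisor_density p - 1 / real p) summable_on {p. prime p}"
    by (auto simp: has_sum_iff)
qed

text \<open>\<open>divisor_ratio p\<close> is the sum of \<open>p powr - (k / h)\<close> over
  \<open>k >= h\<close>; removing the term \<open>1 / p\<close> for \<open>k = h\<close> leaves the
  exponents above \<open>h\<close>.\<close>

lemma has_sum_h_weight_Suc:
  "(h_weight has_sum (\<Sum>\<^sub>\<infinity>p\<in>{p. prime p}. coprime_density p * (divisor_ratio p - 1 / real p))) (prime_powers_from (Suc h))"
proof -
  let ?g = "\<lambda>p. coprime_density p * ((real p powr - (1 / real h)) ^ Suc h / (1 - real p powr - (1 / real h)))"
  have "(h_weight \<circ> (\<lambda>(p, k). p ^ k)) summable_on ({p. prime p} \<times> {Suc h..})"
    using summable_h_weight_Suc unfolding prime_powers_from_def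
    by (subst (asm) summable_on_reindex[OF inj_on_prime_power]) auto
  then obtain T where T: "((h_weight \<circ> (\<lambda>(p, k). p ^ k)) has_sum T) ({p. prime p} \<times> {Suc h..})"
    by (auto simp: summable_on_def)
  have "(?g has_sum T) {p. prime p}"
  proof (rule has_sum_SigmaD[OF T])
    fix p :: nat assume "p \<in> {p. prime p}"
    thus "((\<lambda>k. (h_weight \<circ> (\<lambda>(p, k). p ^ k)) (p, k)) has_sum ?g p) {Suc h..}"
      using has_sum_h_weight_prime[of p "Suc h"] by (simp only: o_def case_prod_conv mem_Collect_eq le_SucI order_refl)
  qed
  hence "((\<lambda>p. coprime_density p * (divisor_ratio p - 1 / real p)) has_sum T) {p. prime p}"
  proof (rule has_sum_cong[THEN iffD1, rotated])
    fix p :: nat assume "p \<in> {p. prime p}"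
    hence p: "prime p" by simp
    define v where "v = real p powr - (1 / real h)"
    note v = prime_root[OF p, folded v_def]
    have "divisor_ratio p - 1 / real p = v ^ Suc h / (1 - v)"
    proof -
      have "divisor_ratio p - 1 / real p = (1 / real p - 1 / real p * (1 - v)) / (1 - v)"
      proof -
        have "1 / real p * (1 - v) / (1 - v) = 1 / real p" using v(2) by simp
        thus ?thesis unfolding density_relations(6)[OF p, folded v_def] diff_divide_distrib[of _ _ "1 - v"] by simp
      qed
      also have "1 / real p - 1 / real p * (1 - v) = v ^ Suc h"
        by (simp add: v(3) diff_divide_distrib)
      finally show ?thesis .
    qed
    thus "?g p = coprime_density p * (divisor_ratio p - 1 / real p)" by (simp add: v_def)
  qed
  hence "T = (\<Sum>\<^sub>\<infinity>p\<in>{p. prime p}. coprime_density p * (divisor_ratio p - 1 / real p))" by (simp add: has_sum_iff)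
  thus ?thesis using T unfolding prime_powers_from_def
    by (subst has_sum_reindex[OF inj_on_prime_power]) auto
qed

text \<open>Along \<open>N = M ^ h\<close> the root is exactly \<open>M\<close>, so the weight sum
  is the prime sum up to \<open>M\<close> plus two convergent series \<open>?U\<close> and
  \<open>?T\<close>. The term \<open>- ln h\<close> comes from
  \<open>ln (ln (M ^ h)) = ln h + ln (ln M)\<close>. As
  \<open>coprime_density p * divisor_ratio p\<close> is \<open>divisor_density p\<close>, the two
  series merge into the difference of the \<open>L_series\<close>.\<close>

theorem D_h_weight: "log_weight.D h_weight = D1 h"
proof -
  obtain K where "log_weight h_weight K" by (rule log_weight_h_weight)
  then interpret hw: log_weight h_weight K .
  obtain K' where "log_weight prime_weight K'" by (rule log_weight_prime_weight)
  then interpret pw: log_weight prime_weight K' .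
  let ?T = "\<Sum>\<^sub>\<infinity>p\<in>{p. prime p}. coprime_density p * (divisor_ratio p - 1 / real p)"
  let ?U = "\<Sum>\<^sub>\<infinity>p\<in>{p. prime p}. (coprime_density p - 1) / real p"
  have sU: "(\<lambda>p. (coprime_density p - 1) / real p) summable_on {p. prime p}"
  proof (rule summable_on_nat_comparison)
    show "summable (\<lambda>n. ratio_bound * (1 / real n ^ 2))" by (intro summable_mult summable_one_over_square)
    fix p :: nat assume "p \<in> {p. prime p}"
    hence p: "prime p" "real p > 0" by (auto simp: prime_gt_0_nat)
    have "\<bar>(coprime_density p - 1) / real p\<bar> = (1 - coprime_density p) / real p" using coprime_density_bounds(1)[OF p(1)] by auto
    also have "\<dots> \<le> ratio_bound / real p / real p" using coprime_density_bounds(1)[OF p(1)] p by (intro divide_right_mono) auto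
    finally show "\<bar>(coprime_density p - 1) / real p\<bar> \<le> ratio_bound * (1 / real p ^ 2)" by (simp add: power2_eq_square)
  qed (use ratio_bound_pos in auto)
  have lim1: "(\<lambda>M. \<Sum>p\<in>primes_upto M. (coprime_density p - 1) / real p) \<longlonglongrightarrow> ?U"
  proof (rule has_sum_tendsto_exhaustion)
    show "((\<lambda>p. (coprime_density p - 1) / real p) has_sum ?U) {p. prime p}" using sU by (rule has_sum_infsum)
    show "\<forall>\<^sub>F M in sequentially. p \<in> primes_upto M" if "p \<in> {p. prime p}" for p
      using eventually_ge_at_top[of p] by eventually_elim (use that in \<open>auto simp: primes_upto_def\<close>)
  qed (auto simp: primes_upto_def)
  have lim2: "(\<lambda>M. \<Sum>n\<in>{1..M ^ h} \<inter> prime_powers_from (Suc h). h_weight n) \<longlonglongrightarrow> ?T"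
  proof (rule has_sum_tendsto_exhaustion[OF has_sum_h_weight_Suc])
    fix n assume n: "n \<in> prime_powers_from (Suc h)"
    have "n > 1" using n prime_powers_from_h_split(1) aprimedivisor_prime_powers_from by blast
    show "\<forall>\<^sub>F M in sequentially. n \<in> {1..M ^ h} \<inter> prime_powers_from (Suc h)"
      using eventually_ge_at_top[of n]
    proof eventually_elim
      case (elim M)
      have "M \<le> M ^ h" using elim \<open>n > 1\<close> h_pos by (intro self_le_power) auto
      thus ?case using elim n \<open>n > 1\<close> by auto
    qed
  qed auto
  have Wq: "hw.W (real (M ^ h)) = (\<Sum>p\<in>primes_upto M. coprime_density p / real p) + (\<Sum>n\<in>{1..M ^ h} \<inter> prime_powers_from (Suc h). h_weight n)" for M
    unfolding hw.W_def upto_real_of_nat using sum_h_weight_split[of "\<lambda>_. 1" "M ^ h"] by (simp add: hroot_power)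
  have Wp: "pw.W (real M) = (\<Sum>p\<in>primes_upto M. 1 / real p)" for M
    unfolding pw.W_def upto_real_of_nat prime_weight_def
    by (rule sum.mono_neutral_cong_right) (auto simp: primes_upto_def Suc_le_eq prime_gt_0_nat)
  have sub: "filterlim (\<lambda>M. M ^ h) sequentially sequentially"
    using h_pos by (intro filterlim_subseq) (auto simp: strict_mono_def power_strict_mono)
  have lim3: "(\<lambda>M. hw.W (real (M ^ h)) - ln (ln (real (M ^ h)))) \<longlonglongrightarrow> hw.D"
    by (rule filterlim_compose[OF hw.W_tendsto sub])
  have lim4: "(\<lambda>M. (pw.W (real M) - ln (ln (real M))) - ln (real h) + (\<Sum>p\<in>primes_upto M. (coprime_density p - 1) / real p)
       + (\<Sum>n\<in>{1..M ^ h} \<inter> prime_powers_from (Suc h). h_weight n)) \<longlonglongrightarrow> mertens_B1 - ln (real h) + ?U + ?T"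
    using pw.W_tendsto unfolding Mertens_second_constant by (intro tendsto_intros lim1 lim2)
  have ev: "\<forall>\<^sub>F M in sequentially. (pw.W (real M) - ln (ln (real M))) - ln (real h) + (\<Sum>p\<in>primes_upto M. (coprime_density p - 1) / real p)
       + (\<Sum>n\<in>{1..M ^ h} \<inter> prime_powers_from (Suc h). h_weight n) = hw.W (real (M ^ h)) - ln (ln (real (M ^ h)))"
    using eventually_ge_at_top[of 2]
  proof eventually_elim
    case (elim M)
    have "ln (ln (real (M ^ h))) = ln (real h) + ln (ln (real M))"
      using elim h_pos by (simp add: ln_realpow ln_mult)
    thus ?case unfolding Wq Wp by (simp add: diff_divide_distrib sum_subtractf)
  qed
  have eq: "hw.D = mertens_B1 - ln (real h) + ?U + ?T"
    by (rule LIMSEQ_unique[OF lim3 Lim_transform_eventually[OF lim4 ev]])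
  have "?U + ?T = (\<Sum>\<^sub>\<infinity>p\<in>{p. prime p}. divisor_density p - 1 / real p)"
  proof -
    have "((\<lambda>p. (divisor_density p - 1 / real p) - (coprime_density p - 1) / real p) has_sum ((\<Sum>\<^sub>\<infinity>p\<in>{p. prime p}. divisor_density p - 1 / real p) - ?U)) {p. prime p}"
      using has_sum_add[OF has_sum_infsum[OF L_series_diff(2)] has_sum_uminusI[OF has_sum_infsum[OF sU]]] by simp
    hence "((\<lambda>p. coprime_density p * (divisor_ratio p - 1 / real p)) has_sum ((\<Sum>\<^sub>\<infinity>p\<in>{p. prime p}. divisor_density p - 1 / real p) - ?U)) {p. prime p}"
      by (rule has_sum_cong[THEN iffD1, rotated]) (auto simp: divisor_density_eqs(1) algebra_simps diff_divide_distrib)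
    thus ?thesis by (simp add: has_sum_iff)
  qed
  thus ?thesis unfolding eq D1_def L_series_diff(1) [symmetric] by simp
qed

end

section \<open>Sums over prime factors of h-full numbers\<close>

lemma has_sum_square_nonneg:
  fixes F :: "nat \<Rightarrow> real"
  assumes "(F has_sum s) A" "\<And>k. k \<in> A \<Longrightarrow> F k \<ge> 0"
  shows "((\<lambda>(k, l). F k * F l) has_sum s\<^sup>2) (A \<times> A)"
proof (rule has_sum_Sigma_nonneg)
  show "((\<lambda>l. case (k, l) of (k, l) \<Rightarrow> F k * F l) has_sum F k * s) A" for k
    using has_sum_cmult_right[OF assms(1), of "F k"] by simp
  show "((\<lambda>k. F k * s) has_sum s\<^sup>2) A"
    using has_sum_cmult_left[OF assms(1), of s] by (simp add: power2_eq_square)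
qed (use assms(2) in auto)

context log_weight
begin

text \<open>Weights vanish below 2, so for \<open>x < 4\<close> no pair contributes and it suffices
  that the main term is bounded; \<open>B\<close> is that bound times \<open>ln 4\<close>, to make
  up for the division by \<open>ln x\<close>. From \<open>exp 1\<close> on,
  \<open>1 + ln (ln x)\<close> is at least 1.\<close>

lemma pair_sum_asymp_exp:
  obtains C where "C \<ge> 0" "\<And>x. x \<ge> exp 1 \<Longrightarrow>
    \<bar>(\<Sum>(u, v)\<in>pairs_upto x. w u * w v) - ((ln (ln x) + D)\<^sup>2 - pi\<^sup>2 / 6)\<bar> \<le> C * (1 + ln (ln x)) / ln x"
proof -
  obtain C where C: "C \<ge> 0" "\<And>x. x \<ge> 4 \<Longrightarrow>
    \<bar>(\<Sum>(u, v)\<in>pairs_upto x. w u * w v) - ((ln (ln x) + D)\<^sup>2 - pi\<^sup>2 / 6)\<bar> \<le> C * (1 + ln (ln x)) / ln x"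
    by (rule pair_sum_asymp) auto
  define B where "B = ((1 + \<bar>D\<bar>)\<^sup>2 + pi\<^sup>2 / 6) * ln 4"
  have B: "B \<ge> 0" by (simp add: B_def)
  show ?thesis
  proof (rule that[of "C + B"])
    show "C + B \<ge> 0" using C B by simp
    fix x :: real assume x: "x \<ge> exp 1"
    hence "exp 1 \<le> x" "x > 0" by (auto intro: less_le_trans[OF exp_gt_zero])
    hence lx: "ln x \<ge> 1" by (simp add: ln_ge_iff)
    hence L: "ln (ln x) \<ge> 0" by simp
    show "\<bar>(\<Sum>(u, v)\<in>pairs_upto x. w u * w v) - ((ln (ln x) + D)\<^sup>2 - pi\<^sup>2 / 6)\<bar> \<le> (C + B) * (1 + ln (ln x)) / ln x"
    proof (cases "x \<ge> 4")
      case True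
      have "C * (1 + ln (ln x)) / ln x \<le> (C + B) * (1 + ln (ln x)) / ln x"
        using B lx L by (intro divide_right_mono mult_right_mono) auto
      thus ?thesis using C(2)[OF True] by linarith
    next
      case False
      have zero: "w u * w v = 0" if "(u, v) \<in> pairs_upto x" for u v
      proof (rule ccontr)
        assume "w u * w v \<noteq> 0"
        hence "u \<ge> 2" "v \<ge> 2" using w_le_1[of u] w_le_1[of v] by force+
        hence "real u * real v \<ge> 2 * 2" by (intro mult_mono) auto
        thus False using that False by (auto simp: pairs_upto_def)
      qed
      have "(\<Sum>(u, v)\<in>pairs_upto x. w u * w v) = 0"
        by (rule sum.neutral) (use zero in auto)
      moreover have "\<bar>(ln (ln x) + D)\<^sup>2 - pi\<^sup>2 / 6\<bar> \<le> (1 + \<bar>D\<bar>)\<^sup>2 + pi\<^sup>2 / 6"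
      proof -
        have "ln x \<le> ln 4" using False \<open>x > 0\<close> by simp
        also have "ln (4::real) = 2 * ln 2" using ln_realpow[of 2 2] by simp
        also have "\<dots> \<le> exp 1" using ln_2_less_1 exp_ge_add_one_self[of 1] by linarith
        finally have "ln (ln x) \<le> ln (exp 1)" using lx by (subst ln_le_cancel_iff) auto
        hence "ln (ln x) \<le> 1" by simp
        hence "\<bar>ln (ln x) + D\<bar> \<le> 1 + \<bar>D\<bar>" using L by linarith
        hence "\<bar>ln (ln x) + D\<bar>\<^sup>2 \<le> (1 + \<bar>D\<bar>)\<^sup>2" by (intro power_mono) auto
        thus ?thesis using zero_le_power2[of "ln (ln x) + D"] zero_le_power2[of pi] unfolding power2_abs by linarith
      qed
      moreover have "(1 + \<bar>D\<bar>)\<^sup>2 + pi\<^sup>2 / 6 \<le> (C + B) * (1 + ln (ln x)) / ln x"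
      proof -
        have "ln x \<le> ln 4" using False \<open>x > 0\<close> by simp
        hence "((1 + \<bar>D\<bar>)\<^sup>2 + pi\<^sup>2 / 6) * ln x \<le> B" unfolding B_def by (intro mult_left_mono) auto
        also have "B \<le> (C + B) * 1" using C by simp
        also have "\<dots> \<le> (C + B) * (1 + ln (ln x))" using C B L by (intro mult_left_mono) auto
        finally show ?thesis using lx by (simp add: pos_le_divide_eq)
      qed
      ultimately show ?thesis by simp
    qed
  qed
qed

end

section \<open>Pairs of powers of one prime\<close>

context hfull
begin

text \<open>The diagonal of the convolution square. A number has only one exact power of each prime,
  so these pairs must be taken out; their total weight is the series of squares in
  \<open>D2\<close>.\<close>

definition same_prime :: "(nat \<times> nat) set" where
  "same_prime = {(u, v). u \<in> prime_powers_from h \<and> v \<in> prime_powers_from h \<and> aprimedivisor u = aprimedivisor v}"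

lemma same_prime_bij: "bij_betw (\<lambda>(p, k, l). (p ^ k, p ^ l)) ({p. prime p} \<times> {h..} \<times> {h..}) same_prime"
  unfolding bij_betw_def
proof
  show "inj_on (\<lambda>(p :: nat, k, l). (p ^ k, p ^ l)) ({p. prime p} \<times> {h..} \<times> {h..})"
  proof (rule inj_onI, clarsimp)
    fix p q k l k' l' :: nat
    assume *: "prime p" "prime q" "h \<le> k" "h \<le> l" "h \<le> k'" "h \<le> l'" "p ^ k = q ^ k'" "p ^ l = q ^ l'"
    have "(p, k) = (q, k')" "(p, l) = (q, l')"
      by (rule inj_onD[OF inj_on_prime_power[OF h_pos(2)]]; use * in simp)+
    thus "p = q \<and> k = k' \<and> l = l'" by simp
  qed
  show "(\<lambda>(p, k, l). (p ^ k, p ^ l)) ` ({p. prime p} \<times> {h..} \<times> {h..}) = same_prime"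
  proof (intro set_eqI iffI)
    fix x assume "x \<in> (\<lambda>(p, k, l). (p ^ k, p ^ l)) ` ({p :: nat. prime p} \<times> {h..} \<times> {h..})"
    then obtain p k l where "prime p" "k \<ge> h" "l \<ge> h" "x = (p ^ k, p ^ l)" by auto
    thus "x \<in> same_prime" using h_pos by (simp add: same_prime_def prime_powers_fromI aprimedivisor_prime_power)
  next
    fix x assume "x \<in> same_prime"
    then obtain u v where x: "x = (u, v)" "u \<in> prime_powers_from h" "v \<in> prime_powers_from h" "aprimedivisor u = aprimedivisor v"
      by (auto simp: same_prime_def)
    obtain p k where p: "prime p" "h \<le> k" "u = p ^ k" using x(2) by (rule prime_powers_fromE)
    obtain q l where q: "prime q" "h \<le> l" "v = q ^ l" using x(3) by (rule prime_powers_fromE)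
    have "p = q" using x(4) p q h_pos by (simp add: aprimedivisor_prime_power)
    hence "x = (\<lambda>(p, k, l). (p ^ k, p ^ l)) (p, k, l)" using p q x by simp
    moreover have "(p, k, l) \<in> {p. prime p} \<times> {h..} \<times> {h..}" using p q by simp
    ultimately show "x \<in> (\<lambda>(p, k, l). (p ^ k, p ^ l)) ` ({p :: nat. prime p} \<times> {h..} \<times> {h..})" by blast
  qed
qed

lemma has_sum_same_prime:
  fixes F g :: "nat \<Rightarrow> real"
  assumes F: "\<And>p. prime p \<Longrightarrow> ((\<lambda>k. F (p ^ k)) has_sum g p) {h..}" "\<And>n. F n \<ge> 0"
    and g: "(\<lambda>p. (g p)\<^sup>2) summable_on {p. prime p}"
  shows "((\<lambda>(u, v). F u * F v) has_sum (\<Sum>\<^sub>\<infinity>p\<in>{p. prime p}. (g p)\<^sup>2)) same_prime"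
proof -
  have "((\<lambda>(p, k, l). F (p ^ k) * F (p ^ l)) has_sum (\<Sum>\<^sub>\<infinity>p\<in>{p. prime p}. (g p)\<^sup>2)) ({p. prime p} \<times> {h..} \<times> {h..})"
  proof (rule has_sum_Sigma_nonneg)
    show "((\<lambda>p. (g p)\<^sup>2) has_sum (\<Sum>\<^sub>\<infinity>p\<in>{p. prime p}. (g p)\<^sup>2)) {p. prime p}"
      using g by (rule has_sum_infsum)
    show "((\<lambda>y. case (p, y) of (p, k, l) \<Rightarrow> F (p ^ k) * F (p ^ l)) has_sum (g p)\<^sup>2) ({h..} \<times> {h..})" 
      if "p \<in> {p. prime p}" for p
      using has_sum_square_nonneg[OF F(1)[of p] F(2)] that by simp
  qed (auto simp: F(2))
  moreover have "((\<lambda>x. (\<lambda>(u, v). F u * F v) ((\<lambda>(p, k, l). (p ^ k, p ^ l)) x)) has_sum T) ({p. prime p} \<times> {h..} \<times> {h..})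
      \<longleftrightarrow> ((\<lambda>(u, v). F u * F v) has_sum T) same_prime" for T
    by (rule has_sum_reindex_bij_betw[OF same_prime_bij])
  moreover have "(\<lambda>x. (\<lambda>(u, v). F u * F v) ((\<lambda>(p, k, l). (p ^ k, p ^ l)) x)) = (\<lambda>(p, k, l). F (p ^ k) * F (p ^ l))"
    by (auto simp: fun_eq_iff)
  ultimately show ?thesis by simp
qed

definition same_prime_sum :: real where "same_prime_sum = (\<Sum>\<^sub>\<infinity>p\<in>{p. prime p}. (divisor_density p)\<^sup>2)"

lemma has_sum_same_prime_h_weight: "((\<lambda>(u, v). h_weight u * h_weight v) has_sum same_prime_sum) same_prime"
  unfolding same_prime_sum_def
proof (rule has_sum_same_prime)
  show "((\<lambda>k. h_weight (p ^ k)) has_sum divisor_density p) {h..}" if p: "prime p" for p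
  proof -
    have "(real p powr - (1 / real h)) ^ h / (1 - real p powr - (1 / real h)) = divisor_ratio p"
      using density_relations(6)[OF p] prime_root(3)[OF p] by simp
    thus ?thesis using has_sum_h_weight_prime[OF p order_refl] divisor_density_eqs(1)[OF p] by simp
  qed
  show "(\<lambda>p. (divisor_density p)\<^sup>2) summable_on {p. prime p}"
  proof (rule summable_on_nat_comparison)
    show "summable (\<lambda>n. ratio_bound\<^sup>2 * (1 / real n ^ 2))" by (intro summable_mult summable_one_over_square)
    fix p :: nat assume "p \<in> {p. prime p}"
    hence "(divisor_density p)\<^sup>2 \<le> (ratio_bound / real p)\<^sup>2" using divisor_density_eqs(2)[of p] by (intro power_mono) auto
    thus "\<bar>(divisor_density p)\<^sup>2\<bar> \<le> ratio_bound\<^sup>2 * (1 / real p ^ 2)" by (simp add: power_divide)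
  qed auto
qed (rule h_weight_nonneg)

text \<open>Over the powers of one prime the sum has order
  \<open>p powr - (h * err_exponent)\<close>, which alone is not summable over the primes because
  \<open>h * err_exponent < 1\<close>. Its square is, since
  \<open>h * err_exponent > h / (h + 1) >= 1 / 2\<close>.\<close>

lemma summable_same_prime: "(\<lambda>(u, v). real u powr - err_exponent * real v powr - err_exponent) summable_on same_prime"
proof (rule has_sum_imp_summable, rule has_sum_same_prime)
  show "((\<lambda>k. real (p ^ k) powr - err_exponent) has_sum (real p powr - err_exponent) ^ h / (1 - real p powr - err_exponent)) {h..}"
    if "prime p" for p by (rule has_sum_prime_powers) (use that err_exponent_bounds in auto)
  have "real h * err_exponent > real h * (1 / (real h + 1))" using err_exponent_bounds h_pos by (intro mult_strict_left_mono) auto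
  moreover have "real h * (1 / (real h + 1)) \<ge> 1 / 2" using h_ge_2 by (simp add: field_simps)
  ultimately have t: "2 * (real h * err_exponent) > 1" by linarith
  let ?C = "1 / (1 - 2 powr - err_exponent)"
  show "(\<lambda>p. ((real p powr - err_exponent) ^ h / (1 - real p powr - err_exponent))\<^sup>2) summable_on {p. prime p}"
  proof (rule summable_on_comparison_test[OF summable_on_primes_powr[OF t, of "?C\<^sup>2"]])
    fix p :: nat assume "p \<in> {p. prime p}"
    hence "((real p powr - err_exponent) ^ h / (1 - real p powr - err_exponent))\<^sup>2 \<le> (?C * real p powr - (real h * err_exponent))\<^sup>2"
      using prime_power_sum_bound[of p err_exponent h] err_exponent_bounds by (intro power_mono) auto
    also have "\<dots> = ?C\<^sup>2 * real p powr - (2 * (real h * err_exponent))"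
      unfolding power_mult_distrib by (simp add: power2_eq_square powr_add [symmetric])
    finally show "((real p powr - err_exponent) ^ h / (1 - real p powr - err_exponent))\<^sup>2 \<le> ?C\<^sup>2 * real p powr - (2 * (real h * err_exponent))" .
  qed auto
qed auto

definition exponent_gap :: real where "exponent_gap = 1 / real h - err_exponent"

lemma exponent_gap_pos: "exponent_gap > 0" using err_exponent_bounds by (simp add: exponent_gap_def)

lemma prime_powers_from_pos: "u \<in> prime_powers_from h \<Longrightarrow> u > 0"
  using aprimedivisor_prime_powers_from(2)[of u] by simp

text \<open>Outside \<open>pairs_upto x\<close> the product \<open>u * v\<close> exceeds
  \<open>x\<close>, so lowering the exponent from \<open>1 / h\<close> to
  \<open>err_exponent\<close> gains \<open>x powr - exponent_gap\<close>, far more than the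
  \<open>1 / ln x\<close> that is kept.\<close>

lemma same_prime_sum_asymp:
  obtains C where "C \<ge> 0" "\<And>x. x > 1 \<Longrightarrow>
    \<bar>(\<Sum>(u, v)\<in>pairs_upto x \<inter> same_prime. h_weight u * h_weight v) - same_prime_sum\<bar> \<le> C / ln x"
proof -
  define R where "R = (\<Sum>\<^sub>\<infinity>(u, v)\<in>same_prime. real u powr - err_exponent * real v powr - err_exponent)"
  have R: "R \<ge> 0" unfolding R_def by (rule infsum_nonneg) auto
  show ?thesis
  proof (rule that[of "R / exponent_gap"])
    show "R / exponent_gap \<ge> 0" using R exponent_gap_pos by simp
    fix x :: real assume x: "x > 1"
    have summ: "(\<lambda>(u, v). h_weight u * h_weight v) summable_on A" if "A \<subseteq> same_prime" for A
      using summable_on_subset[OF has_sum_imp_summable[OF has_sum_same_prime_h_weight] that] .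
    have summ': "(\<lambda>(u, v). real u powr - err_exponent * real v powr - err_exponent) summable_on A" if "A \<subseteq> same_prime" for A
      using summable_on_subset[OF summable_same_prime that] .
    define T where "T = same_prime - pairs_upto x"
    have T: "T \<subseteq> same_prime" by (auto simp: T_def)
    have "infsum (\<lambda>(u, v). h_weight u * h_weight v) (pairs_upto x \<inter> same_prime \<union> T)
        = infsum (\<lambda>(u, v). h_weight u * h_weight v) (pairs_upto x \<inter> same_prime) + infsum (\<lambda>(u, v). h_weight u * h_weight v) T"
      by (rule infsum_Un_disjoint) (use summ in \<open>auto simp: T_def\<close>)
    also have "pairs_upto x \<inter> same_prime \<union> T = same_prime" by (auto simp: T_def)
    also have "infsum (\<lambda>(u, v). h_weight u * h_weight v) same_prime = same_prime_sum"
      using has_sum_same_prime_h_weight by (rule infsumI)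
    finally have eq: "same_prime_sum = (\<Sum>(u, v)\<in>pairs_upto x \<inter> same_prime. h_weight u * h_weight v) + infsum (\<lambda>(u, v). h_weight u * h_weight v) T"
      by simp
    have "infsum (\<lambda>(u, v). h_weight u * h_weight v) T \<le> infsum (\<lambda>z. x powr - exponent_gap * (case z of (u, v) \<Rightarrow> real u powr - err_exponent * real v powr - err_exponent)) T"
    proof (rule infsum_mono)
      show "(\<lambda>(u, v). h_weight u * h_weight v) summable_on T" by (rule summ) (rule T)
      show "(\<lambda>z. x powr - exponent_gap * (case z of (u, v) \<Rightarrow> real u powr - err_exponent * real v powr - err_exponent)) summable_on T"
        by (intro summable_on_cmult_right summ' T)
      fix z assume z: "z \<in> T"
      obtain u v where [simp]: "z = (u, v)" by (cases z)
      have uv0: "u > 0" "v > 0" using z prime_powers_from_pos[of u] prime_powers_from_pos[of v] by (auto simp: T_def same_prime_def)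
      hence uv: "u > 0" "v > 0" "real u * real v > x" using z by (auto simp: T_def pairs_upto_def)
      have "h_weight u * h_weight v \<le> real u powr - (1 / real h) * real v powr - (1 / real h)"
        by (intro mult_mono h_weight_le h_weight_nonneg) auto
      also have "\<dots> = (real u * real v) powr - exponent_gap * (real u powr - err_exponent * real v powr - err_exponent)"
        by (simp add: powr_mult exponent_gap_def powr_diff powr_minus field_simps)
      also have "\<dots> \<le> x powr - exponent_gap * (real u powr - err_exponent * real v powr - err_exponent)"
        using uv x exponent_gap_pos by (intro mult_right_mono powr_mono2') auto
      finally show "(case z of (u, v) \<Rightarrow> h_weight u * h_weight v) \<le> x powr - exponent_gap * (case z of (u, v) \<Rightarrow> real u powr - err_exponent * real v powr - err_exponent)"
        by simp
    qed
    also have "\<dots> = x powr - exponent_gap * infsum (\<lambda>(u, v). real u powr - err_exponent * real v powr - err_exponent) T"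
      by (rule infsum_cmult_right) (use summ'[OF T] in auto)
    also have "\<dots> \<le> x powr - exponent_gap * R"
      unfolding R_def by (intro mult_left_mono infsum_mono2 summ' T) auto
    also have "\<dots> \<le> 1 / (exponent_gap * ln x) * R"
    proof (rule mult_right_mono)
      have "ln x \<le> x powr exponent_gap / exponent_gap" using x exponent_gap_pos by (intro ln_powr_bound) auto
      hence "exponent_gap * ln x \<le> x powr exponent_gap" using exponent_gap_pos by (simp add: field_simps)
      hence "1 / x powr exponent_gap \<le> 1 / (exponent_gap * ln x)" using exponent_gap_pos x by (intro divide_left_mono mult_pos_pos) auto
      thus "x powr - exponent_gap \<le> 1 / (exponent_gap * ln x)" by (simp add: powr_minus_divide)
    qed (rule R)
    finally have "infsum (\<lambda>(u, v). h_weight u * h_weight v) T \<le> R / exponent_gap / ln x" by simp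
    moreover have "infsum (\<lambda>(u, v). h_weight u * h_weight v) T \<ge> 0"
      by (rule infsum_nonneg) (auto intro!: mult_nonneg_nonneg h_weight_nonneg)
    ultimately show "\<bar>(\<Sum>(u, v)\<in>pairs_upto x \<inter> same_prime. h_weight u * h_weight v) - same_prime_sum\<bar> \<le> R / exponent_gap / ln x"
      unfolding eq by simp
  qed
qed

section \<open>Summation over exact prime power divisors\<close>

definition h_full_coprime :: "nat set \<Rightarrow> real \<Rightarrow> nat set" where
  "h_full_coprime S y = {n \<in> coprime_part S. h_full h n \<and> real n \<le> y}"

lemma finite_h_full_coprime [simp]: "finite (h_full_coprime S y)"
  by (rule finite_subset[OF _ finite_upto_real[of y]]) (auto simp: h_full_coprime_def coprime_part_def upto_real_def)

lemma h_full_mult_prime_power: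
  assumes p: "prime p" "k \<ge> h" and m: "m > 0" "\<not> p dvd m"
  shows "h_full h (p ^ k * m) \<longleftrightarrow> h_full h m" "multiplicity p (p ^ k * m) = k"
    "prime_factors (p ^ k * m) = insert p (prime_factors m)" "p \<notin> prime_factors m"
proof -
  have p0: "p ^ k > 0" using p by (simp add: prime_gt_0_nat)
  have mult: "multiplicity q (p ^ k * m) = (if q = p then k else multiplicity q m)" if "prime q" for q
    using that p m p0
    by (auto simp: prime_elem_multiplicity_mult_distrib prime_elem_multiplicity_power_distrib prime_multiplicity_other not_dvd_imp_multiplicity_0)
  show "multiplicity p (p ^ k * m) = k" using mult[OF p(1)] by simp
  show pf: "prime_factors (p ^ k * m) = insert p (prime_factors m)"
    using p h_pos unfolding prime_factors_multiplicity by (auto simp: mult split: if_splits)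
  show np: "p \<notin> prime_factors m" using m by auto
  show "h_full h (p ^ k * m) \<longleftrightarrow> h_full h m"
    unfolding h_full_def pf using p m p0 np mult by (auto simp: in_prime_factors_imp_prime)
qed

text \<open>Write \<open>n = u * m\<close> with \<open>u\<close> the exact power of \<open>p\<close> dividing \<open>n\<close>.\<close>
lemma sum_over_prime_factors:
  assumes S: "\<And>p. p \<in> S \<Longrightarrow> prime p"
  shows "(\<Sum>n\<in>h_full_coprime S y. \<Sum>p\<in>prime_factors n. F (n div p ^ multiplicity p n)) =
         (\<Sum>u\<in>{u \<in> upto_real y. u \<in> prime_powers_from h \<and> aprimedivisor u \<notin> S}. \<Sum>m\<in>h_full_coprime (insert (aprimedivisor u) S) (y / real u). F m)"
proof -
  let ?U = "{u \<in> upto_real y. u \<in> prime_powers_from h \<and> aprimedivisor u \<notin> S}"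
  let ?A = "Sigma (h_full_coprime S y) prime_factors"
  let ?B = "Sigma ?U (\<lambda>u. h_full_coprime (insert (aprimedivisor u) S) (y / real u))"
  have A: "p ^ multiplicity p n \<in> ?U \<and> n div p ^ multiplicity p n \<in> h_full_coprime (insert p S) (y / real (p ^ multiplicity p n))
     \<and> aprimedivisor (p ^ multiplicity p n) = p \<and> p ^ multiplicity p n * (n div p ^ multiplicity p n) = n"
    if "n \<in> h_full_coprime S y" "p \<in> prime_factors n" for n p
  proof -
    have n: "n > 0" "h_full h n" "real n \<le> y" "\<And>q. q \<in> S \<Longrightarrow> \<not> q dvd n"
      using that by (auto simp: h_full_coprime_def coprime_part_def)
    have p: "prime p" "p dvd n" using that by auto
    define k where "k = multiplicity p n"
    define m where "m = n div p ^ k"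
    have k: "k \<ge> h" using that n by (simp add: h_full_def k_def)
    have nm: "p ^ k * m = n" by (simp add: k_def m_def multiplicity_dvd)
    have m: "m > 0" using nm n by (auto intro: Nat.gr0I)
    have pm: "\<not> p dvd m" unfolding m_def k_def
      using multiplicity_decompose[of n p] n p prime_gt_1_nat[of p] by simp
    have u: "p ^ k \<in> prime_powers_from h" using p(1) k by (rule prime_powers_fromI)
    have ap: "aprimedivisor (p ^ k) = p" using p k h_pos by (simp add: aprimedivisor_prime_power)
    have dv: "m dvd n" "p ^ k dvd n" using nm by (metis dvd_triv_right, metis dvd_triv_left)
    have "real (p ^ k) \<le> real n" using dv n by (simp only: of_nat_le_iff dvd_imp_le)
    hence "real (p ^ k) \<le> y" using n(3) by linarith
    moreover have "aprimedivisor (p ^ k) \<notin> S" using ap n(4) p(2) by auto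
    ultimately have "p ^ k \<in> ?U" using u prime_powers_from_pos[OF u] by (simp add: upto_real_def)
    moreover have "m \<in> h_full_coprime (insert p S) (y / real (p ^ k))"
    proof -
      have "h_full h m" using h_full_mult_prime_power(1)[OF p(1) k m pm] n unfolding nm by simp
      moreover have "real m \<le> y / real (p ^ k)"
        using n(3) p unfolding nm [symmetric] by (simp add: pos_le_divide_eq prime_gt_0_nat mult.commute)
      moreover have "\<not> q dvd m" if "q \<in> S" for q using n(4)[OF that] dv by (meson dvd_trans)
      ultimately show ?thesis using m pm by (auto simp: h_full_coprime_def coprime_part_def)
    qed
    ultimately show ?thesis using ap nm unfolding k_def m_def by simp
  qed
  have B: "u * m \<in> h_full_coprime S y \<and> aprimedivisor u \<in> prime_factors (u * m) \<and> aprimedivisor u ^ multiplicity (aprimedivisor u) (u * m) = u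
      \<and> u * m div u = m"
    if um: "u \<in> ?U" "m \<in> h_full_coprime (insert (aprimedivisor u) S) (y / real u)" for u m
  proof -
    obtain p k where p: "prime p" "h \<le> k" "u = p ^ k" using um(1) by (auto elim: prime_powers_fromE)
    have ap: "aprimedivisor u = p" using p h_pos by (simp add: aprimedivisor_prime_power)
    have m: "m > 0" "\<not> p dvd m" "h_full h m" "real m \<le> y / real u" "\<And>q. q \<in> S \<Longrightarrow> \<not> q dvd m"
      using um(2) by (auto simp: h_full_coprime_def coprime_part_def ap)
    have u0: "u > 0" using p by (simp add: prime_gt_0_nat)
    note hm = h_full_mult_prime_power[OF p(1,2) m(1,2), folded p(3)]
    have "\<not> q dvd u * m" if q: "q \<in> S" for q
    proof
      assume "q dvd u * m"
      hence "q dvd p ^ k" using S[OF q] m(5)[OF q] p(3) by (simp add: prime_dvd_mult_iff)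
      hence "q = p" using S[OF q] p(1) prime_dvd_power[of q p k] primes_dvd_imp_eq[of q p] by blast
      thus False using q um(1) ap by simp
    qed
    moreover have "real (u * m) \<le> y" using m(4) u0 by (simp add: pos_le_divide_eq mult.commute)
    ultimately have "u * m \<in> h_full_coprime S y" using hm(1) m u0 by (simp add: h_full_coprime_def coprime_part_def)
    thus ?thesis using hm u0 unfolding ap by (simp add: p(3))
  qed
  have "(\<Sum>n\<in>h_full_coprime S y. \<Sum>p\<in>prime_factors n. F (n div p ^ multiplicity p n)) = (\<Sum>(n, p)\<in>?A. F (n div p ^ multiplicity p n))"
    by (rule sum.Sigma) auto
  also have "\<dots> = (\<Sum>(u, m)\<in>?B. F m)"
  proof (rule sum.reindex_bij_witness[of _ "\<lambda>(u, m). (u * m, aprimedivisor u)" "\<lambda>(n, p). (p ^ multiplicity p n, n div p ^ multiplicity p n)"])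
    fix z assume "z \<in> ?A"
    then obtain n p where z: "z = (n, p)" "n \<in> h_full_coprime S y" "p \<in> prime_factors n" by auto
    note A = A[OF z(2,3)]
    show "(case case z of (n, p) \<Rightarrow> (p ^ multiplicity p n, n div p ^ multiplicity p n) of (u, m) \<Rightarrow> (u * m, aprimedivisor u)) = z"
      using A unfolding z(1) prod.case by blast
    show "(case z of (n, p) \<Rightarrow> (p ^ multiplicity p n, n div p ^ multiplicity p n)) \<in> ?B"
      using A unfolding z(1) prod.case by (intro SigmaI) auto
    show "(case case z of (n, p) \<Rightarrow> (p ^ multiplicity p n, n div p ^ multiplicity p n) of (u, m) \<Rightarrow> F m) =
         (case z of (n, p) \<Rightarrow> F (n div p ^ multiplicity p n))"
      unfolding z(1) prod.case ..
  next
    fix z assume "z \<in> ?B"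
    then obtain u m where z: "z = (u, m)" "u \<in> ?U" "m \<in> h_full_coprime (insert (aprimedivisor u) S) (y / real u)" by auto
    note B = B[OF z(2,3)]
    show "(case case z of (u, m) \<Rightarrow> (u * m, aprimedivisor u) of (n, p) \<Rightarrow> (p ^ multiplicity p n, n div p ^ multiplicity p n)) = z"
      using B unfolding z(1) prod.case by metis
    show "(case z of (u, m) \<Rightarrow> (u * m, aprimedivisor u)) \<in> ?A"
      using B unfolding z(1) prod.case by (intro SigmaI) auto
  qed
  also have "\<dots> = (\<Sum>u\<in>?U. \<Sum>m\<in>h_full_coprime (insert (aprimedivisor u) S) (y / real u). F m)"
    by (rule sum.Sigma [symmetric]) auto
  finally show ?thesis .
qed

lemma sum_omega:
  assumes "\<And>p. p \<in> S \<Longrightarrow> prime p"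
  shows "(\<Sum>n\<in>h_full_coprime S y. real (omega n)) =
         (\<Sum>u\<in>{u \<in> upto_real y. u \<in> prime_powers_from h \<and> aprimedivisor u \<notin> S}. real (hcount (insert (aprimedivisor u) S) (y / real u)))"
  using sum_over_prime_factors[OF assms, where F = "\<lambda>_. 1 :: real" and y = y]
  by (simp add: omega_def hcount_def h_full_coprime_def)

lemma omega_div_prime_power:
  assumes "n \<in> h_full_coprime S y" "p \<in> prime_factors n"
  shows "real (omega (n div p ^ multiplicity p n)) = real (omega n) - 1"
proof -
  have n: "n > 0" "h_full h n" using assms by (auto simp: h_full_coprime_def coprime_part_def)
  have p: "prime p" "p dvd n" using assms by auto
  define k where "k = multiplicity p n"
  define m where "m = n div p ^ k"
  have k: "k \<ge> h" using assms n by (simp add: h_full_def k_def)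
  have nm: "p ^ k * m = n" by (simp add: k_def m_def multiplicity_dvd)
  have m: "m > 0" using nm n by (auto intro: Nat.gr0I)
  have pm: "\<not> p dvd m" unfolding m_def k_def
    using multiplicity_decompose[of n p] n p prime_gt_1_nat[of p] by simp
  note hm = h_full_mult_prime_power[OF p(1) k m pm, unfolded nm]
  have "omega n = Suc (omega m)" unfolding omega_def hm(3) using hm(4) by simp
  thus ?thesis by (simp add: m_def k_def)
qed

text \<open>Removing the exact power of one prime lowers \<open>omega\<close> by one, so summing
  \<open>omega\<close> of the cofactor over the primes of \<open>n\<close> gives
  \<open>omega * (omega - 1)\<close>. The cofactor avoids the first prime, and
  \<open>sum_omega\<close> with that prime in \<open>S\<close> makes the second one
  different.\<close>

lemma sum_omega_omega_minus_1:
  "(\<Sum>n\<in>h_full_coprime {} x. real (omega n) * (real (omega n) - 1)) =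
    (\<Sum>(u, v)\<in>pairs_upto x. if u \<in> prime_powers_from h \<and> v \<in> prime_powers_from h \<and> aprimedivisor u \<noteq> aprimedivisor v
       then real (hcount {aprimedivisor u, aprimedivisor v} (x / (real u * real v))) else 0)"
proof -
  have "(\<Sum>n\<in>h_full_coprime {} x. real (omega n) * (real (omega n) - 1)) = (\<Sum>n\<in>h_full_coprime {} x. \<Sum>p\<in>prime_factors n. real (omega (n div p ^ multiplicity p n)))"
  proof (rule sum.cong)
    fix n assume n: "n \<in> h_full_coprime {} x"
    have "(\<Sum>p\<in>prime_factors n. real (omega (n div p ^ multiplicity p n))) = (\<Sum>p\<in>prime_factors n. real (omega n) - 1)"
      by (rule sum.cong) (use omega_div_prime_power[OF n] in auto)
    thus "real (omega n) * (real (omega n) - 1) = (\<Sum>p\<in>prime_factors n. real (omega (n div p ^ multiplicity p n)))"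
      by (simp add: omega_def)
  qed auto
  also have "\<dots> = (\<Sum>u\<in>{u \<in> upto_real x. u \<in> prime_powers_from h}. \<Sum>m\<in>h_full_coprime {aprimedivisor u} (x / real u). real (omega m))"
    by (subst sum_over_prime_factors) auto
  also have "\<dots> = (\<Sum>u\<in>{u \<in> upto_real x. u \<in> prime_powers_from h}. \<Sum>v\<in>{v \<in> upto_real (x / real u). v \<in> prime_powers_from h \<and> aprimedivisor v \<notin> {aprimedivisor u}}.
       real (hcount {aprimedivisor u, aprimedivisor v} (x / (real u * real v))))"
  proof (rule sum.cong)
    fix u assume "u \<in> {u \<in> upto_real x. u \<in> prime_powers_from h}"
    hence "prime (aprimedivisor u)" by (simp add: aprimedivisor_prime_powers_from)
    thus "(\<Sum>m\<in>h_full_coprime {aprimedivisor u} (x / real u). real (omega m)) = (\<Sum>v\<in>{v \<in> upto_real (x / real u). v \<in> prime_powers_from h \<and> aprimedivisor v \<notin> {aprimedivisor u}}.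
       real (hcount {aprimedivisor u, aprimedivisor v} (x / (real u * real v))))"
      by (subst sum_omega) (auto simp: insert_commute)
  qed auto
  also have "\<dots> = (\<Sum>u\<in>upto_real x. \<Sum>v\<in>upto_real (x / real u). if u \<in> prime_powers_from h \<and> v \<in> prime_powers_from h \<and> aprimedivisor u \<noteq> aprimedivisor v
       then real (hcount {aprimedivisor u, aprimedivisor v} (x / (real u * real v))) else 0)"
  proof (rule sum.mono_neutral_cong_left)
    fix u assume u: "u \<in> {u \<in> upto_real x. u \<in> prime_powers_from h}"
    show "(\<Sum>v\<in>{v \<in> upto_real (x / real u). v \<in> prime_powers_from h \<and> aprimedivisor v \<notin> {aprimedivisor u}}.
       real (hcount {aprimedivisor u, aprimedivisor v} (x / (real u * real v)))) =
       (\<Sum>v\<in>upto_real (x / real u). if u \<in> prime_powers_from h \<and> v \<in> prime_powers_from h \<and> aprimedivisor u \<noteq> aprimedivisor v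
       then real (hcount {aprimedivisor u, aprimedivisor v} (x / (real u * real v))) else 0)"
      by (rule sum.mono_neutral_cong_left) (use u in auto)
  qed auto
  also have "\<dots> = (\<Sum>(u, v)\<in>pairs_upto x. if u \<in> prime_powers_from h \<and> v \<in> prime_powers_from h \<and> aprimedivisor u \<noteq> aprimedivisor v
       then real (hcount {aprimedivisor u, aprimedivisor v} (x / (real u * real v))) else 0)"
    by (rule sum_pairs_upto [symmetric])
  finally show ?thesis .
qed

end

section \<open>The moments of omega\<close>

context hfull
begin

definition gap_err_sum :: real where "gap_err_sum = infsum (gap err_exponent) {0<..}"

lemma gap_err_sum_nonneg: "gap_err_sum \<ge> 0"
  unfolding gap_err_sum_def by (rule infsum_nonneg) (simp add: gap_nonneg)

lemma h_weight_eq_0: "u \<notin> prime_powers_from h \<Longrightarrow> h_weight u = 0"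
  by (simp add: h_weight_def)

text \<open>Rewrites the error of \<open>hcount_asymp\<close> in terms of the weight, so that
  \<open>power_sum_bound\<close> and \<open>pair_power_sum_bound\<close> can sum it. The constant is
  harmless since \<open>coprime_density\<close> is bounded away from 0.\<close>

lemma powr_err_exponent_le:
  assumes "u \<in> prime_powers_from h"
  shows "real u powr - err_exponent \<le> (1 + ratio_bound) * (h_weight u * real u powr exponent_gap)"
proof -
  have "1 \<le> (1 + ratio_bound) * coprime_density (aprimedivisor u)"
    using coprime_density_bounds(2)[OF aprimedivisor_prime_powers_from(1)[OF assms]] ratio_bound_pos by (simp add: field_simps)
  hence "1 * real u powr - err_exponent \<le> (1 + ratio_bound) * coprime_density (aprimedivisor u) * real u powr - err_exponent"
    by (intro mult_right_mono) auto
  also have "\<dots> = (1 + ratio_bound) * (h_weight u * real u powr exponent_gap)"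
    using assms by (simp add: h_weight_def exponent_gap_def powr_add [symmetric])
  finally show ?thesis by simp
qed

lemma hcount_asymp_single:
  assumes "u \<in> prime_powers_from h" "x > 0"
  shows "\<bar>real (hcount {aprimedivisor u} (x / real u)) - gap_sum * x powr (1 / real h) * h_weight u\<bar>
          \<le> 3 * gap_err_sum * (1 + ratio_bound) * x powr err_exponent * (h_weight u * real u powr exponent_gap)"
proof -
  have u: "real u > 0" using prime_powers_from_pos[OF assms(1)] by simp
  have "\<bar>real (hcount {aprimedivisor u} (x / real u)) - gap_sum * (\<Prod>p\<in>{aprimedivisor u}. coprime_density p) * (x / real u) powr (1 / real h)\<bar>
      \<le> (1 + 2 ^ card {aprimedivisor u}) * gap_err_sum * (x / real u) powr err_exponent"
    unfolding gap_err_sum_def by (rule hcount_asymp) (use assms u aprimedivisor_prime_powers_from in auto)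
  also have "gap_sum * (\<Prod>p\<in>{aprimedivisor u}. coprime_density p) * (x / real u) powr (1 / real h) = gap_sum * x powr (1 / real h) * h_weight u"
    using assms u by (simp add: h_weight_def powr_divide powr_minus_divide)
  \<comment> \<open>One prime is sieved, hence \<open>3 = 1 + 2 ^ 1\<close>.\<close>
  also have "(1 + 2 ^ card {aprimedivisor u}) * gap_err_sum * (x / real u) powr err_exponent = (3 * gap_err_sum * x powr err_exponent) * real u powr - err_exponent"
    using assms u by (simp add: powr_divide powr_minus_divide)
  also have "\<dots> \<le> (3 * gap_err_sum * x powr err_exponent) * ((1 + ratio_bound) * (h_weight u * real u powr exponent_gap))"
    using assms gap_err_sum_nonneg by (intro mult_left_mono powr_err_exponent_le) auto
  also have "\<dots> = 3 * gap_err_sum * (1 + ratio_bound) * x powr err_exponent * (h_weight u * real u powr exponent_gap)" by (simp only: mult_ac)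
  finally show ?thesis .
qed

text \<open>For distinct primes the densities multiply, so the main term is a product of two
  weights, which would fail on \<open>same_prime\<close>. Two primes are sieved, hence
  \<open>5 = 1 + 2 ^ 2\<close>.\<close>

lemma hcount_asymp_pair:
  assumes uv: "u \<in> prime_powers_from h" "v \<in> prime_powers_from h" "aprimedivisor u \<noteq> aprimedivisor v" and "x > 0"
  shows "\<bar>real (hcount {aprimedivisor u, aprimedivisor v} (x / (real u * real v))) - gap_sum * x powr (1 / real h) * (h_weight u * h_weight v)\<bar>
          \<le> 5 * gap_err_sum * (1 + ratio_bound)\<^sup>2 * x powr err_exponent * (h_weight u * h_weight v * (real u * real v) powr exponent_gap)"
proof -
  have u: "real u > 0" "real v > 0" using prime_powers_from_pos uv by auto
  let ?S = "{aprimedivisor u, aprimedivisor v}" and ?y = "x / (real u * real v)"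
  have "\<bar>real (hcount ?S ?y) - gap_sum * (\<Prod>p\<in>?S. coprime_density p) * ?y powr (1 / real h)\<bar> \<le> (1 + 2 ^ card ?S) * gap_err_sum * ?y powr err_exponent"
    unfolding gap_err_sum_def by (rule hcount_asymp) (use assms u aprimedivisor_prime_powers_from in auto)
  also have "gap_sum * (\<Prod>p\<in>?S. coprime_density p) * ?y powr (1 / real h) = gap_sum * x powr (1 / real h) * (h_weight u * h_weight v)"
    using assms u by (simp add: h_weight_def powr_divide powr_mult powr_minus_divide)
  also have "(1 + 2 ^ card ?S) * gap_err_sum * ?y powr err_exponent = (5 * gap_err_sum * x powr err_exponent) * (real u powr - err_exponent * real v powr - err_exponent)"
    using assms u by (simp add: powr_divide powr_mult powr_minus_divide)
  also have "\<dots> \<le> (5 * gap_err_sum * x powr err_exponent) * (((1 + ratio_bound) * (h_weight u * real u powr exponent_gap)) * ((1 + ratio_bound) * (h_weight v * real v powr exponent_gap)))"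
    using uv gap_err_sum_nonneg ratio_bound_pos by (intro mult_left_mono mult_mono powr_err_exponent_le) (auto simp: h_weight_nonneg)
  also have "\<dots> = 5 * gap_err_sum * (1 + ratio_bound)\<^sup>2 * x powr err_exponent * (h_weight u * h_weight v * (real u * real v) powr exponent_gap)"
    by (simp add: powr_mult power2_eq_square mult_ac)
  finally show ?thesis .
qed

lemma powr_err_exponent_gap: "x powr err_exponent * x powr exponent_gap = x powr (1 / real h)"
  by (simp add: powr_add [symmetric] exponent_gap_def)

text \<open>The summed errors are \<open>x powr err_exponent\<close> times a weighted sum of
  \<open>u powr exponent_gap\<close>. As the two exponents add up to \<open>1 / h\<close>, the
  factor \<open>1 / ln x\<close> of \<open>power_sum_bound\<close> is exactly what brings them below
  the main term.\<close>

lemma omega_sum_asymp: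
  obtains C where "C \<ge> 0" "\<And>x. x \<ge> 2 \<Longrightarrow>
    \<bar>(\<Sum>n\<in>h_full_coprime {} x. real (omega n)) - gap_sum * x powr (1 / real h) * (ln (ln x) + D1 h)\<bar> \<le> C * (x powr (1 / real h) / ln x)"
proof -
  obtain K where "log_weight h_weight K" by (rule log_weight_h_weight)
  then interpret hw: log_weight h_weight K .
  obtain C1 where C1: "C1 \<ge> 0" "\<And>x. x \<ge> 2 \<Longrightarrow> (\<Sum>u\<in>upto_real x. h_weight u * real u powr exponent_gap) \<le> C1 * x powr exponent_gap / ln x"
    by (rule hw.power_sum_bound[OF exponent_gap_pos]) auto
  define A where "A = 3 * gap_err_sum * (1 + ratio_bound)"
  have A: "A \<ge> 0" using gap_err_sum_nonneg ratio_bound_pos by (simp add: A_def)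
  define B where "B = A * C1 + gap_sum * (8 + 8 * K)"
  show ?thesis
  proof (rule that[of B])
    show "B \<ge> 0" using A C1(1) gap_sum_pos hw.K_nonneg by (simp add: B_def)
    fix x :: real assume x: "x \<ge> 2"
    have lx: "ln x > 0" using x by simp
    define X where "X = x powr (1 / real h)"
    have X: "X \<ge> 0" by (simp add: X_def)
    have "\<bar>(\<Sum>u\<in>{u \<in> upto_real x. u \<in> prime_powers_from h}. real (hcount {aprimedivisor u} (x / real u))) - (\<Sum>u\<in>{u \<in> upto_real x. u \<in> prime_powers_from h}. gap_sum * X * h_weight u)\<bar>
        \<le> (\<Sum>u\<in>{u \<in> upto_real x. u \<in> prime_powers_from h}. A * x powr err_exponent * (h_weight u * real u powr exponent_gap))"
      unfolding sum_subtractf [symmetric] A_def X_def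
      by (intro order.trans[OF sum_abs] sum_mono hcount_asymp_single) (use x in auto)
    also have "\<dots> = (\<Sum>u\<in>upto_real x. A * x powr err_exponent * (h_weight u * real u powr exponent_gap))"
      by (rule sum.mono_neutral_left) (auto simp: h_weight_def)
    also have "\<dots> = A * x powr err_exponent * (\<Sum>u\<in>upto_real x. h_weight u * real u powr exponent_gap)"
      by (simp add: sum_distrib_left)
    also have "\<dots> \<le> A * x powr err_exponent * (C1 * x powr exponent_gap / ln x)"
      using A by (intro mult_left_mono C1 x) auto
    also have "\<dots> = A * C1 * ((x powr err_exponent * x powr exponent_gap) / ln x)" by simp
    also have "\<dots> = A * C1 * (X / ln x)" unfolding powr_err_exponent_gap X_def ..
    also have "(\<Sum>u\<in>{u \<in> upto_real x. u \<in> prime_powers_from h}. gap_sum * X * h_weight u) = (\<Sum>u\<in>upto_real x. gap_sum * X * h_weight u)"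
      by (rule sum.mono_neutral_left) (auto simp: h_weight_def)
    also have "\<dots> = gap_sum * X * hw.W x" by (simp add: hw.W_def sum_distrib_left)
    also have "(\<Sum>u\<in>{u \<in> upto_real x. u \<in> prime_powers_from h}. real (hcount {aprimedivisor u} (x / real u))) = (\<Sum>n\<in>h_full_coprime {} x. real (omega n))"
      by (subst sum_omega) auto
    finally have 1: "\<bar>(\<Sum>n\<in>h_full_coprime {} x. real (omega n)) - gap_sum * X * hw.W x\<bar> \<le> A * C1 * (X / ln x)" .
    have "gap_sum * X * \<bar>hw.W x - (ln (ln x) + D1 h)\<bar> \<le> gap_sum * X * ((8 + 8 * K) / ln x)"
      using hw.W_asymp[OF x] D_h_weight gap_sum_pos X by (intro mult_left_mono) (simp_all add: diff_diff_eq)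
    hence "\<bar>gap_sum * X * hw.W x - gap_sum * X * (ln (ln x) + D1 h)\<bar> \<le> gap_sum * (8 + 8 * K) * (X / ln x)"
      unfolding right_diff_distrib [symmetric] abs_mult using gap_sum_pos X by (simp add: mult_ac)
    with 1 have "\<bar>(\<Sum>n\<in>h_full_coprime {} x. real (omega n)) - gap_sum * X * (ln (ln x) + D1 h)\<bar> \<le> A * C1 * (X / ln x) + gap_sum * (8 + 8 * K) * (X / ln x)"
      by linarith
    also have "\<dots> = B * (X / ln x)" unfolding B_def by (rule distrib_right [symmetric])
    finally show "\<bar>(\<Sum>n\<in>h_full_coprime {} x. real (omega n)) - gap_sum * x powr (1 / real h) * (ln (ln x) + D1 h)\<bar> \<le> B * (x powr (1 / real h) / ln x)"
      unfolding X_def .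
  qed
qed

text \<open>The total error has three sources: the counting errors, where \<open>W x\<close>
  supplies the factor \<open>1 + ln (ln x)\<close>; the asymptotics of the convolution square; and
  the truncation of the diagonal.\<close>

lemma omega_pair_sum_asymp:
  obtains C where "C \<ge> 0" "\<And>x. x \<ge> exp 1 \<Longrightarrow>
    \<bar>(\<Sum>n\<in>h_full_coprime {} x. real (omega n) * (real (omega n) - 1))
       - gap_sum * x powr (1 / real h) * ((ln (ln x) + D1 h)\<^sup>2 - zeta 2 - same_prime_sum)\<bar>
      \<le> C * (x powr (1 / real h) * (1 + ln (ln x)) / ln x)"
proof -
  obtain K where "log_weight h_weight K" by (rule log_weight_h_weight)
  then interpret hw: log_weight h_weight K .
  obtain C1 where C1: "C1 \<ge> 0" "\<And>x. x \<ge> 2 \<Longrightarrow>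
      (\<Sum>(u, v)\<in>pairs_upto x. h_weight u * h_weight v * (real u * real v) powr exponent_gap) \<le> C1 * x powr exponent_gap / ln x * hw.W x"
    by (rule hw.pair_power_sum_bound[OF exponent_gap_pos]) auto
  obtain C2 where C2: "C2 \<ge> 0" "\<And>x. x \<ge> exp 1 \<Longrightarrow>
    \<bar>(\<Sum>(u, v)\<in>pairs_upto x. h_weight u * h_weight v) - ((ln (ln x) + D1 h)\<^sup>2 - zeta 2)\<bar> \<le> C2 * (1 + ln (ln x)) / ln x"
    by (rule hw.pair_sum_asymp_exp) (auto simp: zeta_2 D_h_weight)
  obtain C3 where C3: "C3 \<ge> 0" "\<And>x. x > 1 \<Longrightarrow>
    \<bar>(\<Sum>(u, v)\<in>pairs_upto x \<inter> same_prime. h_weight u * h_weight v) - same_prime_sum\<bar> \<le> C3 / ln x"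
    by (rule same_prime_sum_asymp) auto
  define A where "A = 5 * gap_err_sum * (1 + ratio_bound)\<^sup>2"
  have A: "A \<ge> 0" using gap_err_sum_nonneg ratio_bound_pos by (simp add: A_def)
  define c where "c = 1 + \<bar>D1 h\<bar> + (8 + 8 * K) / ln 2"
  have c: "c \<ge> 1" using hw.K_nonneg by (simp add: c_def)
  define B where "B = A * C1 * c + gap_sum * (C2 + C3)"
  show ?thesis
  proof (rule that[of B])
    show "B \<ge> 0" using A C1(1) C2(1) C3(1) gap_sum_pos c by (simp add: B_def)
    fix x :: real assume x: "x \<ge> exp 1"
    have "exp 1 \<ge> (2::real)" using exp_ge_add_one_self[of 1] by simp
    hence x2: "x \<ge> 2" using x by linarith
    hence lx: "ln x \<ge> 1" using x by (simp add: ln_ge_iff)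
    hence L: "ln (ln x) \<ge> 0" by simp
    define X where "X = x powr (1 / real h)"
    have X: "X \<ge> 0" by (simp add: X_def)
    define L where "L = ln (ln x)"
    have L0: "L \<ge> 0" using L by (simp add: L_def)
    define Y where "Y = X * (1 + L) / ln x"
    let ?H = "\<lambda>u v. real (hcount {aprimedivisor u, aprimedivisor v} (x / (real u * real v)))"
    let ?P = "\<lambda>u v. u \<in> prime_powers_from h \<and> v \<in> prime_powers_from h \<and> aprimedivisor u \<noteq> aprimedivisor v"
    have "\<bar>(\<Sum>(u, v)\<in>pairs_upto x. if ?P u v then ?H u v else 0) - (\<Sum>(u, v)\<in>pairs_upto x. if ?P u v then gap_sum * X * (h_weight u * h_weight v) else 0)\<bar>
        \<le> (\<Sum>(u, v)\<in>pairs_upto x. A * x powr err_exponent * (h_weight u * h_weight v * (real u * real v) powr exponent_gap))"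
      unfolding sum_subtractf [symmetric]
    proof (rule order.trans[OF sum_abs sum_mono])
      fix z assume "z \<in> pairs_upto x"
      obtain u v where z: "z = (u, v)" by (cases z)
      have nn: "0 \<le> A * x powr err_exponent * (h_weight u * h_weight v * (real u * real v) powr exponent_gap)"
        using A by (intro mult_nonneg_nonneg h_weight_nonneg) auto
      show "\<bar>(case z of (u, v) \<Rightarrow> if ?P u v then ?H u v else 0) - (case z of (u, v) \<Rightarrow> if ?P u v then gap_sum * X * (h_weight u * h_weight v) else 0)\<bar>
          \<le> (case z of (u, v) \<Rightarrow> A * x powr err_exponent * (h_weight u * h_weight v * (real u * real v) powr exponent_gap))"
      proof (cases "?P u v")
        case True
        show ?thesis unfolding z prod.case if_P[OF True] A_def X_def
          by (rule hcount_asymp_pair) (use True x2 in auto)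
      next
        case False
        show ?thesis unfolding z prod.case if_not_P[OF False] using nn by simp
      qed
    qed
    also have "\<dots> = A * x powr err_exponent * (\<Sum>(u, v)\<in>pairs_upto x. h_weight u * h_weight v * (real u * real v) powr exponent_gap)"
      by (simp add: sum_distrib_left case_prod_unfold)
    also have "\<dots> \<le> A * x powr err_exponent * (C1 * x powr exponent_gap / ln x * (c * (1 + L)))"
    proof (rule mult_left_mono)
      have "(\<Sum>(u, v)\<in>pairs_upto x. h_weight u * h_weight v * (real u * real v) powr exponent_gap) \<le> C1 * x powr exponent_gap / ln x * hw.W x"
        by (rule C1(2)) fact
      also have "\<dots> \<le> C1 * x powr exponent_gap / ln x * (c * (1 + L))"
      proof (rule mult_left_mono)
        have "hw.W x \<le> L + (c - 1)" using hw.W_le[OF x2] unfolding L_def c_def D_h_weight by simp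
        moreover have "(c - 1) * L \<ge> 0" using c L0 by simp
        moreover have "c * (1 + L) = L + (c - 1) * L + c" by (simp add: algebra_simps)
        ultimately show "hw.W x \<le> c * (1 + L)" by linarith
      qed (use C1(1) lx in auto)
      finally show "(\<Sum>(u, v)\<in>pairs_upto x. h_weight u * h_weight v * (real u * real v) powr exponent_gap) \<le> C1 * x powr exponent_gap / ln x * (c * (1 + L))" .
    qed (use A in auto)
    also have "\<dots> = A * C1 * c * ((x powr err_exponent * x powr exponent_gap) * (1 + L) / ln x)" by simp
    also have "\<dots> = A * C1 * c * Y" unfolding powr_err_exponent_gap X_def Y_def ..
    also have "(\<Sum>(u, v)\<in>pairs_upto x. if ?P u v then ?H u v else 0) = (\<Sum>n\<in>h_full_coprime {} x. real (omega n) * (real (omega n) - 1))"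
      by (rule sum_omega_omega_minus_1 [symmetric])
    \<comment> \<open>Pairs with distinct primes are all pairs minus the diagonal, since the weights
      vanish off the prime powers.\<close>
    also have "(\<Sum>(u, v)\<in>pairs_upto x. if ?P u v then gap_sum * X * (h_weight u * h_weight v) else 0)
        = gap_sum * X * ((\<Sum>(u, v)\<in>pairs_upto x. h_weight u * h_weight v) - (\<Sum>(u, v)\<in>pairs_upto x \<inter> same_prime. h_weight u * h_weight v))"
    proof -
      have "(\<Sum>(u, v)\<in>pairs_upto x. h_weight u * h_weight v) - (\<Sum>(u, v)\<in>pairs_upto x \<inter> same_prime. h_weight u * h_weight v)
          = (\<Sum>(u, v)\<in>pairs_upto x - same_prime. h_weight u * h_weight v)"
        by (simp add: sum.Int_Diff[of "pairs_upto x" _ same_prime])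
      also have "\<dots> = (\<Sum>(u, v)\<in>pairs_upto x. if ?P u v then h_weight u * h_weight v else 0)"
      proof (rule sum.mono_neutral_cong_left)
        fix z assume z: "z \<in> pairs_upto x - same_prime"
        obtain u v where uv: "z = (u, v)" by (cases z)
        show "(case z of (u, v) \<Rightarrow> h_weight u * h_weight v) = (case z of (u, v) \<Rightarrow> if ?P u v then h_weight u * h_weight v else 0)"
          using z unfolding uv by (cases "u \<in> prime_powers_from h"; cases "v \<in> prime_powers_from h") (simp_all add: same_prime_def h_weight_eq_0)
      qed (auto simp: same_prime_def)
      finally show ?thesis by (simp add: sum_distrib_left case_prod_unfold if_distrib cong: if_cong)
    qed
    finally have 1: "\<bar>(\<Sum>n\<in>h_full_coprime {} x. real (omega n) * (real (omega n) - 1)) 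
       - gap_sum * X * ((\<Sum>(u, v)\<in>pairs_upto x. h_weight u * h_weight v) - (\<Sum>(u, v)\<in>pairs_upto x \<inter> same_prime. h_weight u * h_weight v))\<bar> \<le> A * C1 * c * Y" .
    define P where "P = (\<Sum>(u, v)\<in>pairs_upto x. h_weight u * h_weight v)"
    define Q where "Q = (\<Sum>(u, v)\<in>pairs_upto x \<inter> same_prime. h_weight u * h_weight v)"
    have "\<bar>Q - same_prime_sum\<bar> \<le> C3 / ln x" unfolding Q_def using x2 by (intro C3) auto
    also have "\<dots> \<le> C3 * (1 + L) / ln x" using C3(1) L0 lx by (intro divide_right_mono) (auto simp: mult_le_cancel_left1)
    finally have "\<bar>(P - Q) - ((L + D1 h)\<^sup>2 - zeta 2 - same_prime_sum)\<bar> \<le> C2 * (1 + L) / ln x + C3 * (1 + L) / ln x"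
      using C2(2)[OF x] unfolding P_def [symmetric] L_def [symmetric] by linarith
    also have "\<dots> = (C2 + C3) * ((1 + L) / ln x)" unfolding distrib_right[of C2] times_divide_eq_right
      by (rule add_divide_distrib [symmetric])
    finally have "gap_sum * X * \<bar>(P - Q) - ((L + D1 h)\<^sup>2 - zeta 2 - same_prime_sum)\<bar> \<le> gap_sum * X * ((C2 + C3) * ((1 + L) / ln x))"
      using gap_sum_pos X by (intro mult_left_mono) auto
    hence "\<bar>gap_sum * X * (P - Q) - gap_sum * X * ((L + D1 h)\<^sup>2 - zeta 2 - same_prime_sum)\<bar> \<le> gap_sum * (C2 + C3) * Y"
      unfolding right_diff_distrib [symmetric] abs_mult Y_def using gap_sum_pos X by (simp add: mult_ac)
    with 1 have "\<bar>(\<Sum>n\<in>h_full_coprime {} x. real (omega n) * (real (omega n) - 1)) - gap_sum * X * ((L + D1 h)\<^sup>2 - zeta 2 - same_prime_sum)\<bar>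
       \<le> A * C1 * c * Y + gap_sum * (C2 + C3) * Y"
      unfolding P_def [symmetric] Q_def [symmetric] by linarith
    also have "\<dots> = B * Y" unfolding B_def by (rule distrib_right [symmetric])
    finally show "\<bar>(\<Sum>n\<in>h_full_coprime {} x. real (omega n) * (real (omega n) - 1))
       - gap_sum * x powr (1 / real h) * ((ln (ln x) + D1 h)\<^sup>2 - zeta 2 - same_prime_sum)\<bar>
      \<le> B * (x powr (1 / real h) * (1 + ln (ln x)) / ln x)" unfolding X_def Y_def L_def .
  qed
qed

lemma h_full_upto_eq: "h_full_upto h x = h_full_coprime {} x"
  by (auto simp: h_full_upto_def h_full_coprime_def coprime_part_def h_full_def)

lemma D2_eq: "D2 h = (D1 h)\<^sup>2 + D1 h - zeta 2 - same_prime_sum"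
  unfolding D2_def same_prime_sum_def divisor_density_def ..

end

text \<open>The second bound is stated on \<open>x >= x0 > exp 1\<close> because
  \<open>ln (ln x)\<close> vanishes at \<open>exp 1\<close> and is negative below it. No
  \<open>h\<close>-full number except 1 is smaller than 4, so near \<open>exp 1\<close> the left
  side tends to the absolute value of \<open>D2 h * gamma0 h * exp (1 / h)\<close>; a single
  constant down to \<open>exp 1\<close> would force \<open>D2 h = 0\<close>.\<close>

theorem theorem1p2:
  fixes h :: nat
  assumes "h \<ge> 2"
  shows
    "(\<exists>C::real. \<forall>x::real. x > 2 \<longrightarrow>
        \<bar>(\<Sum>n\<in>h_full_upto h x. real (omega n))
          - (gamma0 h * x powr (1 / real h) * ln (ln x)
             + D1 h * gamma0 h * x powr (1 / real h))\<bar>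
        \<le> C * (x powr (1 / real h) / ln x)) \<and>
     (\<forall>x0::real. x0 > exp 1 \<longrightarrow> (\<exists>C::real. \<forall>x::real. x \<ge> x0 \<longrightarrow>
        \<bar>(\<Sum>n\<in>h_full_upto h x. (real (omega n))\<^sup>2)
          - (gamma0 h * x powr (1 / real h) * (ln (ln x))\<^sup>2
             + (2 * D1 h + 1) * gamma0 h * x powr (1 / real h) * ln (ln x)
             + D2 h * gamma0 h * x powr (1 / real h))\<bar>
        \<le> C * (x powr (1 / real h) * ln (ln x) / ln x)))"
proof -
  interpret hfull h by standard (rule assms)
  obtain C1 where C1: "C1 \<ge> 0" "\<And>x. x \<ge> 2 \<Longrightarrow>
    \<bar>(\<Sum>n\<in>h_full_coprime {} x. real (omega n)) - gap_sum * x powr (1 / real h) * (ln (ln x) + D1 h)\<bar> \<le> C1 * (x powr (1 / real h) / ln x)"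
    by (rule omega_sum_asymp) auto
  obtain C2 where C2: "C2 \<ge> 0" "\<And>x. x \<ge> exp 1 \<Longrightarrow>
    \<bar>(\<Sum>n\<in>h_full_coprime {} x. real (omega n) * (real (omega n) - 1))
       - gap_sum * x powr (1 / real h) * ((ln (ln x) + D1 h)\<^sup>2 - zeta 2 - same_prime_sum)\<bar>
      \<le> C2 * (x powr (1 / real h) * (1 + ln (ln x)) / ln x)"
    by (rule omega_pair_sum_asymp) auto
  show ?thesis
  proof (rule conjI, rule exI[of _ C1], safe)
    fix x :: real assume x: "x > 2"
    have eq: "gamma0 h * x powr (1 / real h) * ln (ln x) + D1 h * gamma0 h * x powr (1 / real h)
        = gap_sum * x powr (1 / real h) * (ln (ln x) + D1 h)"
      by (simp add: gamma0_eq algebra_simps)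
    show "\<bar>(\<Sum>n\<in>h_full_upto h x. real (omega n))
          - (gamma0 h * x powr (1 / real h) * ln (ln x)
             + D1 h * gamma0 h * x powr (1 / real h))\<bar>
        \<le> C1 * (x powr (1 / real h) / ln x)"
      unfolding h_full_upto_eq eq by (rule C1(2)) (use x in simp)
  next
    fix x0 :: real assume x0: "x0 > exp 1"
    have "x0 > 0" using x0 by (rule less_trans[rotated]) simp
    have "ln x0 > ln (exp 1)" using x0 \<open>x0 > 0\<close> by (subst ln_less_cancel_iff) auto
    hence lx0: "ln x0 > 1" by simp
    define L0 where "L0 = ln (ln x0)"
    have L0: "L0 > 0" using lx0 by (simp add: L0_def)
    show "\<exists>C::real. \<forall>x::real. x \<ge> x0 \<longrightarrow>
        \<bar>(\<Sum>n\<in>h_full_upto h x. (real (omega n))\<^sup>2)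
          - (gamma0 h * x powr (1 / real h) * (ln (ln x))\<^sup>2
             + (2 * D1 h + 1) * gamma0 h * x powr (1 / real h) * ln (ln x)
             + D2 h * gamma0 h * x powr (1 / real h))\<bar>
        \<le> C * (x powr (1 / real h) * ln (ln x) / ln x)"
    proof (intro exI[of _ "(C1 + C2) * (1 + 1 / L0)"] allI impI)
      fix x :: real assume x: "x \<ge> x0"
      define X L where "X = x powr (1 / real h)" and "L = ln (ln x)"
      have xe: "x \<ge> exp 1" using x x0 by simp
      have "exp 1 \<ge> (2::real)" using exp_ge_add_one_self[of 1] by simp
      hence x2: "x \<ge> 2" using xe by linarith
      have "ln x0 \<le> ln x" using x \<open>x0 > 0\<close> by (subst ln_le_cancel_iff) auto
      hence lx: "ln x > 1" using lx0 by linarith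
      have "ln (ln x0) \<le> ln (ln x)" using lx lx0 \<open>ln x0 \<le> ln x\<close> by (subst ln_le_cancel_iff) auto
      hence L: "L \<ge> L0" by (simp add: L_def L0_def)
      have "(\<Sum>n\<in>h_full_upto h x. (real (omega n))\<^sup>2)
          = (\<Sum>n\<in>h_full_coprime {} x. real (omega n)) + (\<Sum>n\<in>h_full_coprime {} x. real (omega n) * (real (omega n) - 1))"
        unfolding h_full_upto_eq sum.distrib [symmetric]
        by (rule sum.cong) (auto simp: power2_eq_square algebra_simps)
      moreover have "gamma0 h * X * L\<^sup>2 + (2 * D1 h + 1) * gamma0 h * X * L + D2 h * gamma0 h * X
          = gap_sum * X * (L + D1 h) + gap_sum * X * ((L + D1 h)\<^sup>2 - zeta 2 - same_prime_sum)"
        unfolding gamma0_eq D2_eq by (simp add: power2_eq_square algebra_simps)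
      ultimately have "\<bar>(\<Sum>n\<in>h_full_upto h x. (real (omega n))\<^sup>2)
          - (gamma0 h * X * L\<^sup>2 + (2 * D1 h + 1) * gamma0 h * X * L + D2 h * gamma0 h * X)\<bar>
          \<le> C1 * (X / ln x) + C2 * (X * (1 + L) / ln x)"
        using C1(2)[OF x2] C2(2)[OF xe] unfolding X_def [symmetric] L_def [symmetric] by linarith
      also have "\<dots> \<le> C1 * (X * (1 + L) / ln x) + C2 * (X * (1 + L) / ln x)"
        using C1(1) L L0 lx by (intro add_right_mono mult_left_mono divide_right_mono) (auto simp: X_def mult_le_cancel_left1)
      also have "\<dots> = (C1 + C2) * (X * (1 + L) / ln x)" by (rule distrib_right [symmetric])
      also have "\<dots> \<le> (C1 + C2) * (X * ((1 + 1 / L0) * L) / ln x)"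
      proof (intro mult_left_mono divide_right_mono)
        \<comment> \<open>Here the distance from \<open>exp 1\<close> enters:
          \<open>L >= L0 > 0\<close> allows the 1 to be absorbed as
          \<open>1 <= L / L0\<close>.\<close>
        show "1 + L \<le> (1 + 1 / L0) * L" using L L0 by (simp add: field_simps)
      qed (use C1(1) C2(1) lx in \<open>auto simp: X_def\<close>)
      also have "\<dots> = (C1 + C2) * (1 + 1 / L0) * (X * L / ln x)" by simp
      finally show "\<bar>(\<Sum>n\<in>h_full_upto h x. (real (omega n))\<^sup>2)
          - (gamma0 h * x powr (1 / real h) * (ln (ln x))\<^sup>2
             + (2 * D1 h + 1) * gamma0 h * x powr (1 / real h) * ln (ln x)
             + D2 h * gamma0 h * x powr (1 / real h))\<bar>
        \<le> (C1 + C2) * (1 + 1 / L0) * (x powr (1 / real h) * ln (ln x) / ln x)"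
        unfolding X_def L_def .
    qed
  qed
qed

end
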